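(* Let $n\ge 1$, $f\in\mathcal S(\mathbb R^n)$, $0<\beta<2$ and $\beta\le\alpha<n$. Then $$C_\alpha\int_{\mathbb R^n}|\xi|^\alpha|\hat f(\xi)|^2\,d\xi\ \ge\ \int_{\mathbb R^n}|x|^{-\alpha}|f(x)|^2\,dx+\frac{C_\alpha}{D_\beta}\int_{\mathbb R^n\times\mathbb R^n}\frac{|g(x)-g(y)|^2}{|x-y|^{n+\beta}}\,|x|^{-(n-\beta)/2}|y|^{-(n-\beta)/2}\,dx\,dy,$$ where $$g(x)=|x|^{(n-\beta)/2}\,\big((-\Delta/4\pi^2)^{(\alpha-\beta)/4}f\big)(x),$$ $$C_\alpha=\pi^\alpha\left[\frac{\Gamma(\frac{n-\alpha}4)}{\Gamma(\frac{n+\alpha}4)}\right]^2,\qquad D_\beta=\frac4\beta\,\pi^{\frac n2+\beta}\,\frac{\Gamma(1-\frac\beta2)}{\Gamma(\frac{n+\beta}2)}.$$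
   Context: $\mathcal S(\mathbb R^n)$ is the Schwartz class. The Fourier transform is $\hat f(\xi)=(\mathcal F f)(\xi)=\int_{\mathbb R^n}e^{2\pi i\xi\cdot x}f(x)\,dx$. $\Delta$ is the Laplacian on $\mathbb R^n$, and for $s\ge 0$ the operator $(-\Delta/4\pi^2)^{s}$ is the Fourier multiplier with symbol $|\xi|^{2s}$, so that $(-\Delta/4\pi^2)^{(\alpha-\beta)/4}f=\mathcal F^{-1}(|\xi|^{(\alpha-\beta)/2}\hat f)$. *)

theory Defs
  imports "HOL-Analysis.Analysis"
begin

text \<open>
  A partial derivative of order \<open>m\<close> is given by a list of \<open>m\<close> basis vectors. Its value is only
  meaningful if the lower order derivatives are differentiable, as \<open>schwartz\<close> demands below.
\<close>

fun partial_deriv :: "'a::euclidean_space list \<Rightarrow> ('a \<Rightarrow> complex) \<Rightarrow> 'a \<Rightarrow> complex" where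
  "partial_deriv [] f = f"
| "partial_deriv (b # bs) f = (\<lambda>x. frechet_derivative (partial_deriv bs f) (at x) b)"

text \<open>
  All iterated partial derivatives are differentiable everywhere (that is, \<open>f\<close> is smooth), and
  each of them remains bounded after multiplication with any power of \<open>norm x\<close>.
\<close>

definition schwartz :: "('a::euclidean_space \<Rightarrow> complex) \<Rightarrow> bool" where
  "schwartz f \<longleftrightarrow> (\<forall>bs. set bs \<subseteq> Basis \<longrightarrow>
     (\<forall>x. partial_deriv bs f differentiable (at x)) \<and>
     (\<forall>k::nat. bounded (range (\<lambda>x. norm x ^ k *\<^sub>R partial_deriv bs f x))))"

text \<open>The sign convention is \<open>exp (+ 2 \<pi> i \<xi> \<bullet> x)\<close> for the transform and the opposite sign for its inverse.\<close>

definition fourier :: "('a::euclidean_space \<Rightarrow> complex) \<Rightarrow> 'a \<Rightarrow> complex" where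
  "fourier f \<xi> = (LINT x|lborel. cis (2 * pi * (\<xi> \<bullet> x)) * f x)"

definition inv_fourier :: "('a::euclidean_space \<Rightarrow> complex) \<Rightarrow> 'a \<Rightarrow> complex" where
  "inv_fourier h x = (LINT \<xi>|lborel. cis (- (2 * pi * (\<xi> \<bullet> x))) * h \<xi>)"

text \<open>
  The operator \<open>(- \<Delta> / 4\<pi>\<^sup>2)\<^sup>s\<close> for \<open>s \<ge> 0\<close>. For \<open>s = 0\<close> the symbol is \<open>1\<close> except at the origin,
  where \<open>0 powr 0 = 0\<close>; the integral does not see this point.
\<close>

definition laplacian_power :: "real \<Rightarrow> ('a::euclidean_space \<Rightarrow> complex) \<Rightarrow> 'a \<Rightarrow> complex" where
  "laplacian_power s f = inv_fourier (\<lambda>\<xi>. norm \<xi> powr (2 * s) *\<^sub>R fourier f \<xi>)"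

definition C_const :: "nat \<Rightarrow> real \<Rightarrow> real" where
  "C_const n \<alpha> = pi powr \<alpha> * (Gamma ((real n - \<alpha>) / 4) / Gamma ((real n + \<alpha>) / 4))\<^sup>2"

definition D_const :: "nat \<Rightarrow> real \<Rightarrow> real" where
  "D_const n \<beta> = 4 / \<beta> * pi powr (real n / 2 + \<beta>) * (Gamma (1 - \<beta> / 2) / Gamma ((real n + \<beta>) / 2))"

end

theory Submission
  imports Defs "HOL-Probability.Characteristic_Functions" "HOL-Probability.Sinc_Integral"
begin

text \<open>
  Put \<open>h = laplacian_power ((\<alpha> - \<beta>) / 4) f\<close> and let \<open>H = |\<xi>| powr ((\<alpha> - \<beta>) / 2) * fourier f\<close> be the
  function with \<open>h = inv_fourier H\<close>, so that \<open>|\<xi>| powr \<beta> * |H|\<^sup>2 = |\<xi>| powr \<alpha> * |fourier f|\<^sup>2\<close>. The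
  inequality is the combination of an identity for \<open>h\<close> with a sharp inequality between \<open>f\<close> and \<open>h\<close>.

  The identity is the ground state representation \<open>ground_state_representation\<close>: the integral of
  \<open>|\<xi>| powr \<beta> * |H|\<^sup>2\<close> is the sum of \<open>1 / C_const n \<beta>\<close> times the integral of \<open>|x| powr (- \<beta>) * |h|\<^sup>2\<close> and
  of \<open>1 / D_const n \<beta>\<close> times the double integral of the statement. To see this, write \<open>|\<xi>| powr \<beta>\<close> as an
  average of \<open>1 - exp (- \<pi> t |\<xi>|\<^sup>2)\<close> over the time \<open>t\<close>. For fixed \<open>t\<close> the energy is a double integral of
  \<open>|h x - h y|\<^sup>2 * heat t (x - y)\<close> (\<open>nn_integral_heat_energy\<close>). Substituting \<open>h = w * g\<close> with
  \<open>w = |x| powr (- (n - \<beta>) / 2)\<close> and expanding the square leaves \<open>w x * w y * |g x - g y|\<^sup>2\<close> and a term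
  that measures by how much \<open>w\<close> fails to be invariant under the heat flow (\<open>ground_state_flow\<close>).
  As \<open>w\<close> is itself a superposition of heat kernels, this defect is explicit, and its average over
  \<open>t\<close> is a Beta integral times \<open>|x| powr (- \<beta>) * w\<close> (\<open>nn_integral_flow_loss\<close>,
  \<open>nn_integral_flow_gain\<close>).

  The inequality is the Stein-Weiss inequality \<open>stein_weiss\<close>: the integral of
  \<open>|x| powr (- \<alpha>) * |f|\<^sup>2\<close> is at most \<open>C_const n \<alpha> / C_const n \<beta>\<close> times the integral of
  \<open>|x| powr (- \<beta>) * |h|\<^sup>2\<close>. Here \<open>f\<close> is a Riesz potential of \<open>h\<close> (\<open>inv_fourier_le_heat_potential\<close>), and the
  Schur test with suitable powers of \<open>|x|\<close> gives the sharp constant, because Riesz potentials map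
  powers to powers (\<open>heat_potential_convolution\<close>).

  Multiplying the identity by \<open>C_const n \<alpha>\<close> and inserting the inequality proves the claim. All kernels
  are handled as integrals over heat kernels, so that the computations consist of exchanges
  of nonnegative integrals and of the semigroup property. The Fourier analysis is limited to
  inversion and to the Plancherel identity for bounded integrable functions that are continuous
  almost everywhere; the decay of \<open>fourier f\<close> for a Schwartz function \<open>f\<close> makes both available.
\<close>

section \<open>Changes of variables and Gaussian integrals\<close>

lemma nn_integral_lborel_shift:
  fixes c :: "'a::euclidean_space"
  assumes [measurable]: "f \<in> borel_measurable borel"
  shows "(\<integral>\<^sup>+x. f (x + c) \<partial>lborel) = (\<integral>\<^sup>+x. f x \<partial>lborel)"
  by (subst (2) lborel_distr_plus[symmetric, of c]) (simp add: nn_integral_distr add.commute)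

lemma nn_integral_lborel_reflect:
  fixes c :: "'a::euclidean_space"
  assumes [measurable]: "f \<in> borel_measurable borel"
  shows "(\<integral>\<^sup>+x. f (c - x) \<partial>lborel) = (\<integral>\<^sup>+x. f x \<partial>lborel)"
  by (subst (2) lborel_affine[of "-1" c]) (simp_all add: nn_integral_density nn_integral_distr)

lemma lborel_density_reflect:
  fixes c :: "'a::euclidean_space"
  shows "distr lborel borel (\<lambda>x. c - x) = lborel"
  using lborel_affine[of "-1" c] by (simp add: density_1)

lemma lborel_integrable_shift:
  fixes f :: "'a::euclidean_space \<Rightarrow> 'b::{banach, second_countable_topology}"
  assumes "integrable lborel f"
  shows "integrable lborel (\<lambda>x. f (x + c))"
proof -
  have "integrable (distr lborel borel ((+) c)) f"
    using assms by (simp only: lborel_distr_plus)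
  from integrable_distr[OF _ this] show ?thesis by (simp add: add.commute)
qed

lemma lborel_integral_shift:
  fixes f :: "'a::euclidean_space \<Rightarrow> 'b::{banach, second_countable_topology}"
  assumes [measurable]: "f \<in> borel_measurable borel"
  shows "(\<integral>x. f (x + c) \<partial>lborel) = (\<integral>x. f x \<partial>lborel)"
  by (subst (2) lborel_distr_plus[symmetric, of c]) (simp add: integral_distr add.commute)

lemma lborel_integral_reflect:
  fixes f :: "'a::euclidean_space \<Rightarrow> 'b::{banach, second_countable_topology}"
  assumes [measurable]: "f \<in> borel_measurable borel"
  shows "(\<integral>x. f (c - x) \<partial>lborel) = (\<integral>x. f x \<partial>lborel)"
  by (subst (2) lborel_density_reflect[symmetric, of c]) (simp add: integral_distr)

lemma lborel_integral_scale:
  fixes f :: "'a::euclidean_space \<Rightarrow> 'b::{banach, second_countable_topology}"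
  assumes [measurable]: "f \<in> borel_measurable borel" and c: "c > 0"
  shows "(\<integral>x. f x \<partial>lborel) = (c ^ DIM('a)) *\<^sub>R (\<integral>x. f (c *\<^sub>R x) \<partial>lborel)"
  using c by (subst lborel_affine[of c 0]) (simp_all add: integral_density integral_distr)

text \<open>
  Lebesgue measure on a Euclidean space is the image of a product of one-dimensional Lebesgue
  measures, so that functions that factor over the coordinates can be integrated factor by factor.
\<close>

lemma
  fixes F :: "'a::euclidean_space \<Rightarrow> real \<Rightarrow> complex"
  assumes F: "\<And>b. b \<in> Basis \<Longrightarrow> integrable lborel (F b)"
  shows lborel_integrable_prod_Basis: "integrable lborel (\<lambda>x::'a. \<Prod>b\<in>Basis. F b (x \<bullet> b))"
    and lborel_integral_prod_Basis:
      "(\<integral>x. (\<Prod>b\<in>Basis. F b (x \<bullet> b)) \<partial>lborel) = (\<Prod>b\<in>Basis. \<integral>r. F b r \<partial>lborel)"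
proof -
  interpret product_sigma_finite "\<lambda>b::'a. lborel :: real measure" ..
  have [measurable]: "F b \<in> borel_measurable borel" if "b \<in> Basis" for b
    using F[OF that] by simp
  show "integrable lborel (\<lambda>x::'a. \<Prod>b\<in>Basis. F b (x \<bullet> b))"
    unfolding lborel_eq[where 'a='a]
    by (subst integrable_distr_eq) (auto intro!: product_integrable_prod F cong: prod.cong)
  show "(\<integral>x. (\<Prod>b\<in>Basis. F b (x \<bullet> b)) \<partial>lborel) = (\<Prod>b\<in>Basis. \<integral>r. F b r \<partial>lborel)"
    unfolding lborel_eq[where 'a='a]
    by (subst integral_distr) (auto simp: product_integral_prod F cong: prod.cong)
qed

text \<open>
  The normalisation is chosen for the Fourier transform with kernel \<open>exp (2 \<pi> i \<xi> \<bullet> x)\<close>: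
  \<open>heat t\<close> has total mass \<open>1\<close> and Fourier transform \<open>exp (- \<pi> t |\<xi>|\<^sup>2)\<close>, hence is the kernel of
  the semigroup \<open>exp (t \<Delta> / 4\<pi>)\<close>.
\<close>

definition heat :: "real \<Rightarrow> 'a::euclidean_space \<Rightarrow> real" where
  "heat t x = t powr (- (real DIM('a) / 2)) * exp (- (pi * (norm x)\<^sup>2 / t))"

lemma heat_measurable [measurable (raw)]:
  assumes [measurable]: "f \<in> borel_measurable M" "g \<in> M \<rightarrow>\<^sub>M borel"
  shows "(\<lambda>x. heat (f x) (g x)) \<in> borel_measurable M"
  unfolding heat_def by measurable

lemma heat_nonneg [simp]: "0 \<le> heat t x"
  by (simp add: heat_def)

lemma heat_uminus [simp]: "heat t (- x) = heat t x"
  by (simp add: heat_def)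

lemma heat_minus_commute: "heat t (x - y) = heat t (y - x)"
  by (simp add: heat_def norm_minus_commute)

lemma gaussian_fourier_real:
  assumes t: "0 < t"
  shows "integrable lborel (\<lambda>x. complex_of_real (t powr (-(1/2)) * exp (- (pi * x\<^sup>2 / t))) * cis (2 * pi * (\<xi> * x)))" (is ?I)
    and "(\<integral>x. complex_of_real (t powr (-(1/2)) * exp (- (pi * x\<^sup>2 / t))) * cis (2 * pi * (\<xi> * x)) \<partial>lborel)
      = complex_of_real (exp (- (pi * t * \<xi>\<^sup>2)))" (is "?L = _")
proof -
  \<comment> \<open>the density of the standard normal law at \<open>c * x\<close>, multiplied by \<open>c\<close>, is the heat kernel\<close>
  define c where "c = sqrt (2 * pi / t)"
  define s where "s = 2 * pi * \<xi> / c"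
  have c: "c > 0" "c\<^sup>2 = 2 * pi / t" using t by (auto simp: c_def)
  define F where "F = (\<lambda>x. std_normal_density x *\<^sub>R iexp (s * x))"
  have int: "integrable lborel F"
    unfolding F_def
    by (rule Bochner_Integration.integrable_bound[OF integrable_normal_density[of 1 0]]) auto
  have "char std_normal_distribution s = (\<integral>x. F x \<partial>lborel)"
    unfolding char_def F_def by (subst integral_density) auto
  then have 1: "(\<integral>x. F x \<partial>lborel) = complex_of_real (exp (- (s\<^sup>2) / 2))"
    by (simp add: char_std_normal_distribution)
  have F: "c *\<^sub>R F (c * x) = complex_of_real (t powr (-(1/2)) * exp (- (pi * x\<^sup>2 / t))) * cis (2 * pi * (\<xi> * x))" for x
  proof -
    have "c * (1 / sqrt (2 * pi)) = t powr (-(1/2))"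
      using t by (simp add: c_def powr_minus powr_half_sqrt real_sqrt_divide field_simps)
    moreover have "(c * x)\<^sup>2 / 2 = pi * x\<^sup>2 / t"
      using t c by (simp add: power_mult_distrib)
    moreover have "s * (c * x) = 2 * pi * (\<xi> * x)"
      using c by (simp add: s_def)
    ultimately have 1: "c * std_normal_density (c * x) = t powr (-(1/2)) * exp (- (pi * x\<^sup>2 / t))"
      and 2: "s * (c * x) = 2 * pi * (\<xi> * x)"
      unfolding std_normal_density_def by (simp_all only: mult.assoc[symmetric] minus_divide_left[symmetric])
    have "c *\<^sub>R F (c * x) = complex_of_real (c * std_normal_density (c * x)) * iexp (s * (c * x))"
      by (simp add: F_def scaleR_conv_of_real)
    then show ?thesis
      by (simp only: 1 2 cis_conv_exp)
  qed
  have "integrable lborel (\<lambda>x. c *\<^sub>R F (c * x))"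
    using lborel_integrable_real_affine[OF int, of c 0] c by simp
  then show ?I unfolding F .
  have "?L = c *\<^sub>R (\<integral>x. F (c * x) \<partial>lborel)"
    unfolding F[symmetric] by simp
  also have "\<dots> = (\<integral>x. F x \<partial>lborel)"
    using lborel_integral_real_affine[of c F 0] c by simp
  also have "\<dots> = complex_of_real (exp (- (pi * t * \<xi>\<^sup>2)))"
    unfolding 1 s_def using c t by (simp add: power_divide power_mult_distrib power2_eq_square)
  finally show "?L = complex_of_real (exp (- (pi * t * \<xi>\<^sup>2)))" .
qed

lemma heat_prod_Basis:
  assumes "0 < t"
  shows "heat t (x::'a::euclidean_space) = (\<Prod>b\<in>Basis. t powr (-(1/2)) * exp (- (pi * (x \<bullet> b)\<^sup>2 / t)))"
proof -
  have "(norm x)\<^sup>2 = (\<Sum>b\<in>Basis. (x \<bullet> b)\<^sup>2)"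
    unfolding power2_norm_eq_inner by (subst euclidean_inner) (simp add: power2_eq_square)
  then have "exp (- (pi * (norm x)\<^sup>2 / t)) = (\<Prod>b\<in>(Basis::'a set). exp (- (pi * (x \<bullet> b)\<^sup>2 / t)))"
    by (simp add: exp_sum[symmetric] sum_negf sum_divide_distrib sum_distrib_left)
  moreover have "t powr (- (real DIM('a) / 2)) = (\<Prod>b\<in>(Basis::'a set). t powr (-(1/2)))"
    using assms by (simp add: powr_power)
  ultimately show ?thesis
    by (simp add: heat_def prod.distrib)
qed

lemma
  fixes \<xi> :: "'a::euclidean_space"
  assumes t: "0 < t"
  shows integrable_heat_cis: "integrable lborel (\<lambda>x. heat t x * cis (2 * pi * (\<xi> \<bullet> x)))"
    and integral_heat_cis: "(\<integral>x. heat t x * cis (2 * pi * (\<xi> \<bullet> x)) \<partial>lborel) = complex_of_real (exp (- (pi * t * (norm \<xi>)\<^sup>2)))"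
proof -
  define F where "F = (\<lambda>b r. complex_of_real (t powr (-(1/2)) * exp (- (pi * r\<^sup>2 / t))) * cis (2 * pi * ((\<xi> \<bullet> b) * r)))"
  have F: "integrable lborel (F b)" "integral\<^sup>L lborel (F b) = complex_of_real (exp (- (pi * t * (\<xi> \<bullet> b)\<^sup>2)))" for b
    unfolding F_def using gaussian_fourier_real[OF t] by auto
  have cis_sum: "cis (\<Sum>b\<in>A. f b) = (\<Prod>b\<in>A. cis (f b))" if "finite A" for A and f :: "'a \<Rightarrow> real"
    using that by induction (auto simp: cis_mult[symmetric])
  have eq: "heat t x * cis (2 * pi * (\<xi> \<bullet> x)) = (\<Prod>b\<in>Basis. F b (x \<bullet> b))" for x
    unfolding F_def prod.distrib of_real_prod[symmetric] heat_prod_Basis[OF t]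
    by (simp add: euclidean_inner[of \<xi> x] sum_distrib_left cis_sum[symmetric] mult_ac)
  show "integrable lborel (\<lambda>x. heat t x * cis (2 * pi * (\<xi> \<bullet> x)))"
    unfolding eq by (intro lborel_integrable_prod_Basis F)
  have n: "(norm \<xi>)\<^sup>2 = (\<Sum>b\<in>Basis. (\<xi> \<bullet> b)\<^sup>2)"
    unfolding power2_norm_eq_inner by (subst euclidean_inner) (simp add: power2_eq_square)
  show "(\<integral>x. heat t x * cis (2 * pi * (\<xi> \<bullet> x)) \<partial>lborel) = complex_of_real (exp (- (pi * t * (norm \<xi>)\<^sup>2)))"
    unfolding eq by (subst lborel_integral_prod_Basis)
      (simp_all add: F n exp_sum[symmetric] sum_negf sum_distrib_left of_real_prod[symmetric] del: of_real_exp of_real_prod)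
qed

lemma
  assumes t: "0 < t"
  shows integrable_heat: "integrable lborel (heat t :: 'a::euclidean_space \<Rightarrow> real)"
    and integral_heat: "(\<integral>x. heat t (x::'a) \<partial>lborel) = 1"
    and nn_integral_heat: "(\<integral>\<^sup>+x. ennreal (heat t (x::'a)) \<partial>lborel) = 1"
proof -
  have "integrable lborel (\<lambda>x::'a. complex_of_real (heat t x))"
    using integrable_heat_cis[OF t, of "0::'a"] by simp
  then show 1: "integrable lborel (heat t :: 'a \<Rightarrow> real)"
    by (rule complex_of_real_integrable_eq[THEN iffD1])
  have "(\<integral>x. complex_of_real (heat t (x::'a)) \<partial>lborel) = 1"
    using integral_heat_cis[OF t, of "0::'a"] by simp
  then show 2: "(\<integral>x. heat t (x::'a) \<partial>lborel) = 1"
    by (subst (asm) integral_complex_of_real) simp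
  show "(\<integral>\<^sup>+x. ennreal (heat t (x::'a)) \<partial>lborel) = 1"
    using 1 2 by (subst nn_integral_eq_integral) auto
qed

text \<open>
  Completing the square in \<open>y\<close>: the product of two Gaussians is a Gaussian in \<open>y\<close> around
  \<open>(t / (s + t)) x\<close>. Integrating it out gives the semigroup property.
\<close>

lemma heat_mult:
  fixes x y :: "'a::euclidean_space"
  assumes "0 < s" "0 < t"
  shows "heat s (x - y) * heat t y = heat (s + t) x * heat (s * t / (s + t)) (y - (t / (s + t)) *\<^sub>R x)"
proof -
  have st: "s + t > 0" using assms by simp
  have n: "(norm (x - y))\<^sup>2 / s + (norm y)\<^sup>2 / t
      = (norm x)\<^sup>2 / (s + t) + (norm (y - (t / (s + t)) *\<^sub>R x))\<^sup>2 / (s * t / (s + t))"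
  proof -
    define X Y Z where "X = x \<bullet> x" and "Y = y \<bullet> y" and "Z = x \<bullet> y"
    have e1: "(norm (x - y))\<^sup>2 = X - 2 * Z + Y"
      by (simp add: power2_norm_eq_inner inner_diff inner_commute X_def Y_def Z_def)
    have e2: "(norm (y - (t / (s + t)) *\<^sub>R x))\<^sup>2 = Y - 2 * (t / (s + t)) * Z + (t / (s + t))\<^sup>2 * X"
      unfolding power2_norm_eq_inner
      by (simp add: inner_diff inner_commute X_def Y_def Z_def power2_eq_square)
    have e3: "(norm x)\<^sup>2 = X" "(norm y)\<^sup>2 = Y"
      by (simp_all add: power2_norm_eq_inner X_def Y_def)
    define w where "w = s + t"
    have "w > 0" "t = w - s" using st by (simp_all add: w_def)
    show ?thesis
      unfolding e1 e2 e3 unfolding w_def[symmetric] using assms \<open>w > 0\<close>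
      by (simp add: field_simps power2_eq_square) (simp add: w_def algebra_simps)
  qed
  have p: "s powr r * t powr r = (s + t) powr r * (s * t / (s + t)) powr r" for r
    using assms st by (simp add: powr_mult[symmetric])
  have e: "exp (- (pi * (norm (x - y))\<^sup>2 / s)) * exp (- (pi * (norm y)\<^sup>2 / t))
     = exp (- (pi * (norm x)\<^sup>2 / (s + t))) * exp (- (pi * (norm (y - (t / (s + t)) *\<^sub>R x))\<^sup>2 / (s * t / (s + t))))"
  proof -
    have "exp (- (pi * A / s)) * exp (- (pi * B / t)) = exp (- (pi * C / w)) * exp (- (pi * D / u))"
      if "A / s + B / t = C / w + D / u" for A B C D w u :: real
    proof -
      have "- (pi * A / s) + - (pi * B / t) = - pi * (A / s + B / t)" by (simp add: algebra_simps)
      also have "\<dots> = - (pi * C / w) + - (pi * D / u)" unfolding that by (simp add: algebra_simps)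
      finally show ?thesis unfolding exp_add[symmetric] by simp
    qed
    then show ?thesis using n by blast
  qed
  have rearrange: "(p1 * q1) * (p2 * q2) = (p3 * q3) * (p4 * q4)" if "p1 * p2 = p3 * p4" "q1 * q2 = q3 * q4"
    for p1 p2 p3 p4 q1 q2 q3 q4 :: real
  proof -
    have "(p1 * q1) * (p2 * q2) = (p1 * p2) * (q1 * q2)" by (simp add: mult_ac)
    also have "\<dots> = (p3 * q3) * (p4 * q4)" unfolding that by (simp add: mult_ac)
    finally show ?thesis .
  qed
  show ?thesis
    unfolding heat_def by (rule rearrange[OF p e])
qed

lemma nn_integral_heat_mult_heat:
  fixes x :: "'a::euclidean_space"
  assumes "0 < s" "0 < t"
  shows "(\<integral>\<^sup>+y. ennreal (heat s (x - y) * heat t y) \<partial>lborel) = heat (s + t) x"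
proof -
  let ?c = "(t / (s + t)) *\<^sub>R x" and ?u = "s * t / (s + t)"
  have "(\<integral>\<^sup>+y. ennreal (heat s (x - y) * heat t y) \<partial>lborel)
     = (\<integral>\<^sup>+y. ennreal (heat (s + t) x) * ennreal (heat ?u (y + (- ?c))) \<partial>lborel)"
    using assms by (simp add: heat_mult ennreal_mult)
  also have "\<dots> = heat (s + t) x * (\<integral>\<^sup>+y. ennreal (heat ?u (y + (- ?c))) \<partial>lborel)"
    by (rule nn_integral_cmult) measurable
  also have "(\<integral>\<^sup>+y. ennreal (heat ?u (y + (- ?c))) \<partial>lborel) = 1"
    using assms by (subst nn_integral_lborel_shift) (auto simp: nn_integral_heat)
  finally show ?thesis by simp
qed

section \<open>Gamma and Beta integrals of nonnegative functions\<close>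

lemma set_nn_integral_has_integral:
  fixes f :: "'a::euclidean_space \<Rightarrow> real"
  assumes "\<And>x. x \<in> \<Omega> \<Longrightarrow> 0 \<le> f x" and "(f has_integral I) \<Omega>"
  shows "(\<integral>\<^sup>+x\<in>\<Omega>. ennreal (f x) \<partial>lborel) = ennreal I"
proof -
  have "(\<integral>\<^sup>+x\<in>\<Omega>. ennreal (f x) \<partial>lborel) = (\<integral>\<^sup>+x. ennreal (indicator \<Omega> x * f x) \<partial>lborel)"
    by (intro nn_integral_cong) (auto simp: indicator_def)
  also have "\<dots> = ennreal I"
    using nn_integral_has_integral_lebesgue[OF assms] by simp
  finally show ?thesis .
qed

lemma set_nn_integral_Beta:
  assumes a: "0 < a" and b: "0 < b" and r: "0 < (r::real)"
  shows "(\<integral>\<^sup>+t\<in>{0<..<r}. ennreal ((r - t) powr (a - 1) * t powr (b - 1)) \<partial>lborel)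
    = ennreal (Beta a b * r powr (a + b - 1))"
proof -
  have "((\<lambda>t. t powr (b - 1) * (1 - t) powr (a - 1)) has_integral Beta b a) (cbox 0 1)"
    using has_integral_Beta_real[OF b a] by simp
  from has_integral_affinity[OF this, of "1/r" 0] r
  have "((\<lambda>t. (t / r) powr (b - 1) * (1 - t / r) powr (a - 1)) has_integral r * Beta b a) {0..r}"
    by simp
  note I = has_integral_mult_right[OF this, of "r powr (a + b - 2)"]
  have c: "r powr (a + b - 2) * (r * Beta b a) = Beta a b * r powr (a + b - 1)"
    using r powr_add[of r "a + b - 2" 1] by (simp add: Beta_commute)
  have eq: "r powr (a + b - 2) * ((t / r) powr (b - 1) * (1 - t / r) powr (a - 1)) =
    (r - t) powr (a - 1) * t powr (b - 1)" if "t \<in> {0..r}" for t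
  proof -
    have "r powr (a + b - 2) = r powr (a - 1) * r powr (b - 1)"
      by (simp add: powr_add[symmetric])
    moreover have "t powr (b - 1) = r powr (b - 1) * (t / r) powr (b - 1)"
      using r that by (simp add: powr_mult[symmetric])
    moreover have "(r - t) powr (a - 1) = r powr (a - 1) * (1 - t / r) powr (a - 1)"
      using r that by (simp add: powr_mult[symmetric] right_diff_distrib)
    ultimately show ?thesis by (simp only: mult_ac)
  qed
  have "((\<lambda>t. (r - t) powr (a - 1) * t powr (b - 1)) has_integral (Beta a b * r powr (a + b - 1))) {0..r}"
    unfolding c[symmetric] by (rule has_integral_eq[OF eq I])
  then have "((\<lambda>t. (r - t) powr (a - 1) * t powr (b - 1)) has_integral (Beta a b * r powr (a + b - 1))) {0<..<r}"
    by (simp add: has_integral_Icc_iff_Ioo)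
  then show ?thesis
    by (intro set_nn_integral_has_integral) auto
qed

text \<open>
  The substitution \<open>r = c / u\<close> leads to the integral that defines \<open>Gamma s\<close>.
\<close>

lemma set_nn_integral_Gamma_inverse:
  assumes s: "0 < s" and c: "0 < c"
  shows "(\<integral>\<^sup>+r\<in>{0<..}. ennreal (r powr (- s - 1) * exp (- (c / r))) \<partial>lborel) = ennreal (Gamma s * c powr (- s))"
proof -
  have 1: "((\<lambda>t. t powr (s - 1) / exp t) has_integral Gamma s) {0<..}"
  proof -
    have "((\<lambda>t. if t \<in> {0<..} then t powr (s - 1) / exp t else 0) has_integral Gamma s) {0..}"
      by (rule has_integral_spike[OF _ _ Gamma_integral_real[OF s], of "{0}"]) auto
    moreover have "{0<..} \<inter> {0..} = {0::real<..}" by auto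
    ultimately show ?thesis
      by (subst (asm) has_integral_restrict_Int) simp
  qed
  define f where "f = (\<lambda>r. r powr (- s - 1) * exp (- (c / r)))"
  have img: "(\<lambda>u. c / u) ` {0<..} = {0<..}"
  proof safe
    fix x :: real assume "0 < x"
    then show "x \<in> (\<lambda>u. c / u) ` {0<..}"
      using c by (intro image_eqI[of _ _ "c / x"]) auto
  qed (use c in auto)
  have eq: "\<bar>- c / u\<^sup>2\<bar> * f (c / u) = c powr (- s) * (u powr (s - 1) / exp u)" if "u \<in> {0<..}" for u
  proof -
    have u: "u > 0" using that by simp
    have "c / u\<^sup>2 * (c / u) powr (- s - 1) = c powr (- s) * u powr (s - 1)"
      using u c by (simp add: powr_divide powr_minus powr_diff powr_add power2_eq_square field_simps)
    then show ?thesis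
      using u c by (simp add: f_def exp_minus field_simps)
  qed
  have "((\<lambda>u. c powr (- s) * (u powr (s - 1) / exp u)) has_integral c powr (- s) * Gamma s) {0<..}"
    using has_integral_mult_right[OF 1] by simp
  then have I: "((\<lambda>u. \<bar>- c / u\<^sup>2\<bar> * f (c / u)) has_integral c powr (- s) * Gamma s) {0<..}"
    by (simp only: eq cong: has_integral_cong)
  have "(\<lambda>u. \<bar>- c / u\<^sup>2\<bar> * f (c / u)) absolutely_integrable_on {0<..} \<and>
     integral {0<..} (\<lambda>u. \<bar>- c / u\<^sup>2\<bar> * f (c / u)) = c powr (- s) * Gamma s"
    using I by (auto simp: integral_unique f_def intro!: nonnegative_absolutely_integrable_1)
  moreover have "(\<lambda>u. \<bar>- c / u\<^sup>2\<bar> * f (c / u)) absolutely_integrable_on {0<..} \<and>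
     integral {0<..} (\<lambda>u. \<bar>- c / u\<^sup>2\<bar> * f (c / u)) = c powr (- s) * Gamma s \<longleftrightarrow>
     f absolutely_integrable_on (\<lambda>u. c / u) ` {0<..} \<and> integral ((\<lambda>u. c / u) ` {0<..}) f = c powr (- s) * Gamma s"
    using c by (intro has_absolute_integral_change_of_variables_1')
      (auto intro!: derivative_eq_intros inj_onI simp: power2_eq_square)
  ultimately have "(f has_integral (c powr (- s) * Gamma s)) {0<..}"
    unfolding img using set_lebesgue_integral_eq_integral(1) has_integral_integral by (metis)
  then show ?thesis
    unfolding f_def by (subst set_nn_integral_has_integral) (auto simp: mult.commute)
qed

text \<open>
  As a function of the time \<open>r\<close>, the heat kernel at a fixed point \<open>x \<noteq> 0\<close> is a power of \<open>r\<close> times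
  \<open>exp (- \<pi> |x|\<^sup>2 / r)\<close>. All negative powers of \<open>|x|\<close> are therefore superpositions of heat kernels.
\<close>

lemma nn_integral_heat_potential:
  fixes x :: "'a::euclidean_space"
  assumes x: "x \<noteq> 0" and a: "a < real DIM('a) / 2"
  shows "(\<integral>\<^sup>+r\<in>{0<..}. ennreal (heat r x * r powr (a - 1)) \<partial>lborel)
     = ennreal (Gamma (real DIM('a) / 2 - a) * pi powr (a - real DIM('a) / 2) * norm x powr (2 * a - real DIM('a)))"
proof -
  define s where "s = real DIM('a) / 2 - a"
  have e: "a - 1 - real DIM('a) / 2 = a - real DIM('a) / 2 - 1" by simp
  have "(\<integral>\<^sup>+r\<in>{0<..}. ennreal (heat r x * r powr (a - 1)) \<partial>lborel)
     = (\<integral>\<^sup>+r\<in>{0<..}. ennreal (r powr (- s - 1) * exp (- (pi * (norm x)\<^sup>2 / r))) \<partial>lborel)"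
    by (intro nn_integral_cong) (auto simp: heat_def s_def indicator_def mult_ac powr_add[symmetric] e)
  also have "\<dots> = ennreal (Gamma s * (pi * (norm x)\<^sup>2) powr (- s))"
    using x a by (intro set_nn_integral_Gamma_inverse) (auto simp: s_def)
  also have "(pi * (norm x)\<^sup>2) powr (- s) = pi powr (-s) * norm x powr (2 * (- s))"
    using x powr_powr[of "norm x" 2 "- s"] by (simp add: powr_mult)
  finally show ?thesis
    by (simp add: s_def algebra_simps)
qed

lemma set_nn_integral_Gamma:
  assumes s: "0 < s" and c: "0 < c"
  shows "(\<integral>\<^sup>+r\<in>{0<..}. ennreal (r powr (s - 1) * exp (- (c * r))) \<partial>lborel) = ennreal (Gamma s * c powr (- s))"
proof -
  have e: "(r / c) powr (s - 1) = c powr (1 - s) * r powr (s - 1)" if "r > 0" for r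
    using c that by (simp add: powr_divide powr_diff field_simps)
  have "(\<integral>\<^sup>+r\<in>{0<..}. ennreal (r powr (s - 1) * exp (- (c * r))) \<partial>lborel)
    = (1/c) * (\<integral>\<^sup>+r. ennreal ((r/c) powr (s - 1) * exp (- r)) * indicator {0<..} r \<partial>lborel)"
    using c by (subst nn_integral_real_affine[of _ "1/c" 0]) (auto simp: indicator_def zero_less_divide_iff intro!: arg_cong2[of _ _ _ _ "(*)"] nn_integral_cong)
  also have "\<dots>
    = (1/c) * (\<integral>\<^sup>+r. ennreal (c powr (1 - s)) * ennreal (indicator {0..} r * r powr (s - 1) / exp r) \<partial>lborel)"
  proof (rule arg_cong2[of _ _ _ _ "(*)", OF refl], rule nn_integral_cong)
    fix r :: real
    show "ennreal ((r/c) powr (s - 1) * exp (- r)) * indicator {0<..} r =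
      ennreal (c powr (1 - s)) * ennreal (indicator {0..} r * r powr (s - 1) / exp r)"
      using e[of r] by (cases "r > 0"; cases "r = 0")
        (auto simp: ennreal_mult'[symmetric] exp_minus field_simps)
  qed
  also have "\<dots> = (1/c) * (ennreal (c powr (1 - s)) * Gamma s)"
    by (subst nn_integral_cmult) (auto simp: Gamma_conv_nn_integral_real[OF s])
  also have "\<dots> = ennreal (Gamma s * c powr (- s))"
    using c s by (auto simp: ennreal_mult[symmetric] powr_diff powr_minus field_simps)
  finally show ?thesis .
qed

lemma set_nn_integral_powr_tail:
  assumes "0 < b" "0 < (u::real)"
  shows "(\<integral>\<^sup>+t\<in>{u<..}. ennreal (t powr (- 1 - b)) \<partial>lborel) = ennreal (u powr (- b) / b)"
proof -
  have "((\<lambda>t. t powr (- 1 - b)) has_integral - (u powr (- 1 - b + 1)) / (- 1 - b + 1)) {u..}"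
    using assms by (intro has_integral_powr_to_inf) auto
  then have "(\<integral>\<^sup>+t\<in>{u..}. ennreal (t powr (- 1 - b)) \<partial>lborel) = ennreal (u powr (- b) / b)"
    by (subst set_nn_integral_has_integral) auto
  moreover have "(\<integral>\<^sup>+t\<in>{u<..}. ennreal (t powr (- 1 - b)) \<partial>lborel) = (\<integral>\<^sup>+t\<in>{u..}. ennreal (t powr (- 1 - b)) \<partial>lborel)"
    using AE_lborel_singleton[of u] by (intro nn_integral_cong_AE) (auto simp: indicator_def)
  ultimately show ?thesis by simp
qed

text \<open>
  Integration by parts against the singular weight \<open>t powr (- 1 - b)\<close>, written as an exchange of
  two nonnegative integrals: \<open>\<phi>\<close> is a primitive of \<open>\<psi>\<close>, and \<open>u powr (- b) / b\<close> is the tail of the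
  weight.
\<close>

lemma set_nn_integral_primitive_powr:
  fixes \<phi> :: "real \<Rightarrow> real"
  assumes b: "0 < b" and [measurable]: "\<psi> \<in> borel_measurable borel"
    and \<phi>: "\<And>t. 0 < t \<Longrightarrow> ennreal (\<phi> t) = (\<integral>\<^sup>+u\<in>{0<..<t}. ennreal (\<psi> u) \<partial>lborel)"
  shows "(\<integral>\<^sup>+t\<in>{0<..}. ennreal (\<phi> t * t powr (- 1 - b)) \<partial>lborel)
    = (\<integral>\<^sup>+u\<in>{0<..}. ennreal (\<psi> u * u powr (- b) / b) \<partial>lborel)"
proof -
  let ?F = "\<lambda>t u. ennreal (\<psi> u) * ennreal (t powr (- 1 - b)) * indicator {(t, u). 0 < u \<and> u < t} (t, u)"
  have "(\<integral>\<^sup>+t\<in>{0<..}. ennreal (\<phi> t * t powr (- 1 - b)) \<partial>lborel)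
    = (\<integral>\<^sup>+t. (\<integral>\<^sup>+u. ?F t u \<partial>lborel) \<partial>lborel)"
  proof (intro nn_integral_cong)
    fix t :: real
    show "ennreal (\<phi> t * t powr (- 1 - b)) * indicator {0<..} t =
      (\<integral>\<^sup>+u. ?F t u \<partial>lborel)"
    proof (cases "t > 0")
      case True
      have "ennreal (\<phi> t * t powr (- 1 - b)) * indicator {0<..} t = ennreal (\<phi> t) * ennreal (t powr (- 1 - b))"
        using True by (simp add: ennreal_mult'')
      also have "\<dots> = (\<integral>\<^sup>+u\<in>{0<..<t}. ennreal (\<psi> u) \<partial>lborel) * ennreal (t powr (- 1 - b))"
        using \<phi> True by simp
      also have "\<dots> = (\<integral>\<^sup>+u. ennreal (\<psi> u) * indicator {0<..<t} u * ennreal (t powr (- 1 - b)) \<partial>lborel)"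
        by (rule nn_integral_multc[symmetric]) measurable
      also have "\<dots> = (\<integral>\<^sup>+u. ?F t u \<partial>lborel)"
        by (intro nn_integral_cong) (auto simp: indicator_def)
      finally show ?thesis .
    next
      case False
      then have "(\<integral>\<^sup>+u. ?F t u \<partial>lborel)
        = (\<integral>\<^sup>+u. 0 \<partial>(lborel::real measure))"
        by (intro nn_integral_cong) (auto simp: indicator_def)
      then show ?thesis using False by simp
    qed
  qed
  also have "\<dots> = (\<integral>\<^sup>+u. (\<integral>\<^sup>+t. ?F t u \<partial>lborel) \<partial>lborel)"
    by (rule lborel_pair.Fubini') measurable
  also have "\<dots> = (\<integral>\<^sup>+u\<in>{0<..}. ennreal (\<psi> u * u powr (- b) / b) \<partial>lborel)"
  proof (intro nn_integral_cong)
    fix u :: real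
    show "(\<integral>\<^sup>+t. ?F t u \<partial>lborel)
      = ennreal (\<psi> u * u powr (- b) / b) * indicator {0<..} u"
    proof (cases "u > 0")
      case True
      have "(\<integral>\<^sup>+t. ?F t u \<partial>lborel)
        = (\<integral>\<^sup>+t. ennreal (\<psi> u) * (ennreal (t powr (- 1 - b)) * indicator {u<..} t) \<partial>lborel)"
        using True by (intro nn_integral_cong) (auto simp: indicator_def)
      also have "\<dots> = ennreal (\<psi> u) * (\<integral>\<^sup>+t\<in>{u<..}. ennreal (t powr (- 1 - b)) \<partial>lborel)"
        by (rule nn_integral_cmult) measurable
      also have "\<dots> = ennreal (\<psi> u) * ennreal (u powr (- b) / b)"
        using set_nn_integral_powr_tail[OF b True] by simp
      finally show ?thesis using True b by (simp add: ennreal_mult''[symmetric])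
    qed simp
  qed
  finally show ?thesis .
qed

text \<open>
  With \<open>c = \<pi> |\<xi>|\<^sup>2\<close> and \<open>b = \<beta> / 2\<close> this writes the symbol \<open>|\<xi>| powr \<beta>\<close> as a time average of the
  symbols \<open>1 - exp (- \<pi> t |\<xi>|\<^sup>2)\<close>. The restriction \<open>b < 1\<close>, that is \<open>\<beta> < 2\<close>, makes the average
  converge at \<open>t = 0\<close>.
\<close>

lemma set_nn_integral_one_minus_exp_powr:
  assumes b: "0 < b" "b < 1" and c: "0 < c"
  shows "(\<integral>\<^sup>+t\<in>{0<..}. ennreal ((1 - exp (- (c * t))) * t powr (- 1 - b)) \<partial>lborel)
    = ennreal (c powr b * Gamma (1 - b) / b)"
proof -
  have "(\<integral>\<^sup>+t\<in>{0<..}. ennreal ((1 - exp (- (c * t))) * t powr (- 1 - b)) \<partial>lborel)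
    = (\<integral>\<^sup>+u\<in>{0<..}. ennreal (c * exp (- (c * u)) * u powr (- b) / b) \<partial>lborel)"
  proof (rule set_nn_integral_primitive_powr[OF b(1)])
    fix t :: real assume t: "0 < t"
    have "((\<lambda>u. c * exp (- (c * u))) has_integral (- exp (- (c * t))) - (- exp (- (c * 0)))) {0..t}"
      using t by (intro fundamental_theorem_of_calculus)
        (auto intro!: derivative_eq_intros simp flip: has_real_derivative_iff_has_vector_derivative)
    then have "((\<lambda>u. c * exp (- (c * u))) has_integral (1 - exp (- (c * t)))) {0<..<t}"
      by (simp add: has_integral_Icc_iff_Ioo)
    then show "ennreal (1 - exp (- (c * t))) = (\<integral>\<^sup>+u\<in>{0<..<t}. ennreal (c * exp (- (c * u))) \<partial>lborel)"
      using c by (subst set_nn_integral_has_integral) auto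
  qed measurable
  also have "\<dots> = (\<integral>\<^sup>+u. ennreal (c / b) * (ennreal (u powr ((1 - b) - 1) * exp (- (c * u))) * indicator {0<..} u) \<partial>lborel)"
    using b c by (intro nn_integral_cong) (auto simp: indicator_def ennreal_mult[symmetric] mult_ac)
  also have "\<dots> = ennreal (c / b) * ennreal (Gamma (1 - b) * c powr (- (1 - b)))"
    using set_nn_integral_Gamma[of "1 - b" c] b c by (subst nn_integral_cmult) simp_all
  also have "\<dots> = ennreal (c powr b * Gamma (1 - b) / b)"
    using b c by (auto simp: ennreal_mult''[symmetric] powr_diff)
  finally show ?thesis .
qed

text \<open>
  The increment is the integral of \<open>a * (r - u) powr (a - 1)\<close> over \<open>0 < u < min r t\<close>; after the
  exchange of integrals a Beta integral over \<open>{0<..<r}\<close> remains.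
\<close>

lemma set_nn_integral_powr_increment_powr:
  assumes a: "0 < a" and b: "0 < b" "b < 1" and r: "0 < r"
  shows "(\<integral>\<^sup>+t\<in>{0<..}. ennreal ((r powr a - (max 0 (r - t)) powr a) * t powr (- 1 - b)) \<partial>lborel)
    = ennreal (a / b * Beta a (1 - b) * r powr (a - b))"
proof -
  have "(\<integral>\<^sup>+t\<in>{0<..}. ennreal ((r powr a - (max 0 (r - t)) powr a) * t powr (- 1 - b)) \<partial>lborel)
    = (\<integral>\<^sup>+u\<in>{0<..}. ennreal ((a * (r - u) powr (a - 1) * indicator {..<r} u) * u powr (- b) / b) \<partial>lborel)"
  proof (rule set_nn_integral_primitive_powr[OF b(1)])
    fix t :: real assume t: "0 < t"
    define m where "m = min r t"
    have m: "0 < m" "m \<le> r" using t r by (auto simp: m_def)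
    have "((\<lambda>u. a * (r - u) powr (a - 1)) has_integral (- ((r - m) powr a)) - (- ((r - 0) powr a))) {0..m}"
      using m a by (intro fundamental_theorem_of_calculus_interior)
        (auto intro!: derivative_eq_intros continuous_intros continuous_on_powr' simp flip: has_real_derivative_iff_has_vector_derivative)
    moreover have "(r - m) = max 0 (r - t)" by (auto simp: m_def)
    ultimately have "((\<lambda>u. a * (r - u) powr (a - 1)) has_integral (r powr a - (max 0 (r - t)) powr a)) {0<..<m}"
      by (simp add: has_integral_Icc_iff_Ioo)
    then have "ennreal (r powr a - max 0 (r - t) powr a) = (\<integral>\<^sup>+u\<in>{0<..<m}. ennreal (a * (r - u) powr (a - 1)) \<partial>lborel)"
      using a by (subst set_nn_integral_has_integral) auto
    also have "\<dots> = (\<integral>\<^sup>+u\<in>{0<..<t}. ennreal (a * (r - u) powr (a - 1) * indicator {..<r} u) \<partial>lborel)"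
      by (intro nn_integral_cong) (auto simp: indicator_def m_def)
    finally show "ennreal (r powr a - max 0 (r - t) powr a) = (\<integral>\<^sup>+u\<in>{0<..<t}. ennreal (a * (r - u) powr (a - 1) * indicator {..<r} u) \<partial>lborel)" .
  qed measurable
  also have "\<dots> = (\<integral>\<^sup>+u. ennreal (a / b) * (ennreal ((r - u) powr (a - 1) * u powr ((1 - b) - 1)) * indicator {0<..<r} u) \<partial>lborel)"
    using a b by (intro nn_integral_cong) (auto simp: indicator_def ennreal_mult[symmetric] mult_ac)
  also have "\<dots> = ennreal (a / b) * ennreal (Beta a (1 - b) * r powr (a + (1 - b) - 1))"
    using set_nn_integral_Beta[of a "1 - b" r] a b r by (subst nn_integral_cmult) simp_all
  also have "\<dots> = ennreal (a / b * Beta a (1 - b) * r powr (a - b))"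
    using a b by (auto simp: ennreal_mult'[symmetric] mult_ac)
  finally show ?thesis .
qed

section \<open>Fourier inversion and the Plancherel identity\<close>

lemma heat_scale:
  fixes u :: "'a::euclidean_space"
  assumes "0 < c"
  shows "c ^ DIM('a) * heat (c\<^sup>2) (c *\<^sub>R u) = heat 1 u"
proof -
  have "(c\<^sup>2) powr (- (real DIM('a) / 2)) = c powr (- real DIM('a))"
    using assms powr_powr[of c 2 "- (real DIM('a) / 2)"] by simp
  moreover have "c ^ DIM('a) = c powr real DIM('a)"
    using assms by (simp add: powr_realpow)
  ultimately show ?thesis
    using assms by (simp add: heat_def power_mult_distrib powr_minus)
qed

text \<open>
  The substitution \<open>y = x - c u\<close> with \<open>c\<^sup>2 = t\<close> freezes the kernel at time \<open>1\<close> and moves the small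
  parameter into the argument of \<open>F\<close>, where dominated convergence applies.
\<close>

lemma heat_approximate_identity:
  fixes F :: "'a::euclidean_space \<Rightarrow> complex"
  assumes [measurable]: "F \<in> borel_measurable borel" and M: "\<And>y. cmod (F y) \<le> M" and cont: "isCont F x"
  shows "(\<lambda>k. \<integral>y. heat (1 / real (Suc k)) (x - y) *\<^sub>R F y \<partial>lborel) \<longlonglongrightarrow> F x"
proof -
  define c where "c k = sqrt (1 / real (Suc k))" for k
  have c: "c k > 0" "(c k)\<^sup>2 = 1 / real (Suc k)" for k by (simp_all add: c_def)
  have c0: "c \<longlonglongrightarrow> 0"
    unfolding c_def using tendsto_real_sqrt[OF LIMSEQ_inverse_real_of_nat] by (simp add: inverse_eq_divide)
  have eq: "(\<integral>y. heat (1 / real (Suc k)) (x - y) *\<^sub>R F y \<partial>lborel) = (\<integral>u. heat 1 u *\<^sub>R F (x - c k *\<^sub>R u) \<partial>lborel)" for k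
  proof -
    have "(\<integral>y. heat (1 / real (Suc k)) (x - y) *\<^sub>R F y \<partial>lborel)
      = (\<integral>y. heat ((c k)\<^sup>2) (x - y) *\<^sub>R F y \<partial>lborel)" by (simp only: c)
    also have "\<dots> = (\<integral>y. heat ((c k)\<^sup>2) (x - (x - y)) *\<^sub>R F (x - y) \<partial>lborel)"
      by (rule lborel_integral_reflect[symmetric, where f="\<lambda>y. heat ((c k)\<^sup>2) (x - y) *\<^sub>R F y"]) measurable
    also have "\<dots> = (c k ^ DIM('a)) *\<^sub>R (\<integral>u. heat ((c k)\<^sup>2) (c k *\<^sub>R u) *\<^sub>R F (x - c k *\<^sub>R u) \<partial>lborel)"
      using c(1)[of k] by (subst lborel_integral_scale[of _ "c k"]) auto
    also have "\<dots> = (\<integral>u. (c k ^ DIM('a)) *\<^sub>R heat ((c k)\<^sup>2) (c k *\<^sub>R u) *\<^sub>R F (x - c k *\<^sub>R u) \<partial>lborel)"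
      by (rule integral_scaleR_right[symmetric])
    also have "\<dots> = (\<integral>u. heat 1 u *\<^sub>R F (x - c k *\<^sub>R u) \<partial>lborel)"
      by (simp only: scaleR_scaleR heat_scale[OF c(1)])
    finally show ?thesis .
  qed
  have "(\<lambda>k. \<integral>u. heat 1 u *\<^sub>R F (x - c k *\<^sub>R u) \<partial>lborel) \<longlonglongrightarrow> (\<integral>(u::'a). heat 1 u *\<^sub>R F x \<partial>lborel)"
  proof (rule integral_dominated_convergence[where w="\<lambda>u::'a. heat 1 u * M"])
    show "integrable lborel (\<lambda>u::'a. heat 1 u * M)"
      by (intro integrable_mult_left integrable_heat) simp
    show "AE u in lborel. (\<lambda>k. heat 1 u *\<^sub>R F (x - c k *\<^sub>R u)) \<longlonglongrightarrow> heat 1 u *\<^sub>R F x"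
    proof (rule AE_I2)
      fix u
      have "(\<lambda>k. x - c k *\<^sub>R u) \<longlonglongrightarrow> x - 0 *\<^sub>R u"
        by (intro tendsto_intros c0)
      then show "(\<lambda>k. heat 1 u *\<^sub>R F (x - c k *\<^sub>R u)) \<longlonglongrightarrow> heat 1 u *\<^sub>R F x"
        by (intro tendsto_intros isCont_tendsto_compose[OF cont]) simp
    qed
    show "AE u in lborel. norm (heat 1 u *\<^sub>R F (x - c k *\<^sub>R u)) \<le> heat 1 u * M" for k
      using M by (intro AE_I2) (auto intro!: mult_left_mono)
  qed measurable
  also have "(\<integral>(u::'a). heat 1 u *\<^sub>R F x \<partial>lborel) = F x"
    using integrable_heat[of 1, where 'a='a] integral_heat[of 1, where 'a='a] by (subst integral_scaleR_left) auto
  finally show ?thesis unfolding eq .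
qed

lemma inv_fourier_measurable [measurable]:
  fixes H :: "'a::euclidean_space \<Rightarrow> complex"
  assumes [measurable]: "H \<in> borel_measurable borel"
  shows "inv_fourier H \<in> borel_measurable borel"
  unfolding inv_fourier_def[abs_def] cis_conv_exp by measurable

lemma fourier_conv_inv_fourier: "fourier f x = inv_fourier f (- x)"
  by (simp add: fourier_def inv_fourier_def inner_commute)

lemma integrable_cis_mult:
  fixes H :: "'a::euclidean_space \<Rightarrow> complex"
  assumes "integrable lborel H" and [measurable]: "\<theta> \<in> borel_measurable borel"
  shows "integrable lborel (\<lambda>\<xi>. cis (\<theta> \<xi>) * H \<xi>)"
proof (rule Bochner_Integration.integrable_bound[OF assms(1)])
  have [measurable]: "H \<in> borel_measurable borel" using assms(1) by simp
  show "(\<lambda>\<xi>. cis (\<theta> \<xi>) * H \<xi>) \<in> borel_measurable lborel"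
    unfolding cis_conv_exp by measurable
qed (simp add: norm_mult)

lemma norm_inv_fourier_le:
  fixes H :: "'a::euclidean_space \<Rightarrow> complex"
  shows "cmod (inv_fourier H x) \<le> (\<integral>\<xi>. cmod (H \<xi>) \<partial>lborel)"
  unfolding inv_fourier_def
  by (rule order_trans[OF integral_norm_bound]) (simp add: norm_mult)

lemma integrable_product_complex:
  fixes A B :: "'a::euclidean_space \<Rightarrow> complex"
  assumes A: "integrable lborel A" and B: "integrable lborel B"
  shows "integrable (lborel \<Otimes>\<^sub>M lborel) (\<lambda>(x, y). A x * B y)"
proof -
  have [measurable]: "A \<in> borel_measurable borel" "B \<in> borel_measurable borel" using A B by simp_all
  show ?thesis
  proof (rule lborel_pair.Fubini_integrable)
    show "integrable lborel (\<lambda>x. \<integral>y. norm (case (x, y) of (x, y) \<Rightarrow> A x * B y) \<partial>lborel)"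
      using A by (simp add: norm_mult)
    show "AE x in lborel. integrable lborel (\<lambda>y. case (x, y) of (x, y) \<Rightarrow> A x * B y)"
      using B by simp
  qed measurable
qed

lemma fubini_cis:
  fixes A B :: "'a::euclidean_space \<Rightarrow> complex" and \<theta> :: "'a \<Rightarrow> 'a \<Rightarrow> real"
  assumes A: "integrable lborel A" and B: "integrable lborel B"
    and \<theta>: "(\<lambda>(x, y). \<theta> x y) \<in> borel_measurable (borel \<Otimes>\<^sub>M borel)"
  shows "(\<integral>x. A x * (\<integral>y. cis (\<theta> x y) * B y \<partial>lborel) \<partial>lborel) = (\<integral>y. (\<integral>x. cis (\<theta> x y) * A x \<partial>lborel) * B y \<partial>lborel)"
proof -
  have [measurable]: "A \<in> borel_measurable borel" "B \<in> borel_measurable borel" using A B by simp_all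
  note \<theta>[measurable]
  have int: "integrable (lborel \<Otimes>\<^sub>M lborel) (\<lambda>(x, y). A x * (cis (\<theta> x y) * B y))"
  proof (rule Bochner_Integration.integrable_bound[OF integrable_product_complex[OF A B]])
    show "(\<lambda>(x, y). A x * (cis (\<theta> x y) * B y)) \<in> borel_measurable (lborel \<Otimes>\<^sub>M lborel)"
      unfolding cis_conv_exp by measurable
  qed (auto simp: norm_mult)
  have "(\<integral>x. A x * (\<integral>y. cis (\<theta> x y) * B y \<partial>lborel) \<partial>lborel) = (\<integral>x. (\<integral>y. A x * (cis (\<theta> x y) * B y) \<partial>lborel) \<partial>lborel)"
    by simp
  also have "\<dots> = (\<integral>y. (\<integral>x. A x * (cis (\<theta> x y) * B y) \<partial>lborel) \<partial>lborel)"
    using lborel_pair.Fubini_integral[OF int] by simp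
  also have "\<dots> = (\<integral>y. (\<integral>x. cis (\<theta> x y) * A x * B y \<partial>lborel) \<partial>lborel)"
    by (simp add: mult_ac)
  also have "\<dots> = (\<integral>y. (\<integral>x. cis (\<theta> x y) * A x \<partial>lborel) * B y \<partial>lborel)"
    by simp
  finally show ?thesis .
qed

lemma exp_conv_heat:
  assumes "0 < \<epsilon>"
  shows "exp (- (pi * \<epsilon> * (norm (x::'a::euclidean_space))\<^sup>2)) = \<epsilon> powr (- (real DIM('a) / 2)) * heat (1 / \<epsilon>) x"
proof -
  let ?p = "- (real DIM('a) / 2)"
  have "\<epsilon> powr ?p * (1 / \<epsilon>) powr ?p = 1"
    using assms by (simp add: powr_mult[symmetric])
  moreover have "heat (1 / \<epsilon>) x = (1 / \<epsilon>) powr ?p * exp (- (pi * \<epsilon> * (norm x)\<^sup>2))"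
    by (simp add: heat_def mult_ac)
  ultimately show ?thesis
    by (metis mult.assoc mult_1)
qed

lemma heat_conv_exp:
  assumes "0 < \<epsilon>"
  shows "heat \<epsilon> (x::'a::euclidean_space) = \<epsilon> powr (- (real DIM('a) / 2)) * exp (- (pi * (1 / \<epsilon>) * (norm x)\<^sup>2))"
  using assms by (simp add: heat_def)

lemma integrable_gaussian:
  assumes "0 < \<epsilon>"
  shows "integrable lborel (\<lambda>x::'a::euclidean_space. exp (- (pi * \<epsilon> * (norm x)\<^sup>2)))"
  unfolding exp_conv_heat[OF assms] by (intro integrable_mult_right integrable_heat) (use assms in simp)

lemma integral_gaussian_cis:
  fixes z :: "'a::euclidean_space"
  assumes e: "0 < \<epsilon>"
  shows "(\<integral>x. cis (2 * pi * (z \<bullet> x)) * complex_of_real (exp (- (pi * \<epsilon> * (norm x)\<^sup>2))) \<partial>lborel) = complex_of_real (heat \<epsilon> z)"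
proof -
  have "(\<integral>x. cis (2 * pi * (z \<bullet> x)) * complex_of_real (exp (- (pi * \<epsilon> * (norm x)\<^sup>2))) \<partial>lborel)
   = (\<integral>x. complex_of_real (\<epsilon> powr (- (real DIM('a) / 2))) * (heat (1 / \<epsilon>) x * cis (2 * pi * (z \<bullet> x))) \<partial>lborel)"
    unfolding exp_conv_heat[OF e] by (simp only: of_real_mult mult_ac)
  also have "\<dots> = complex_of_real (\<epsilon> powr (- (real DIM('a) / 2))) * complex_of_real (exp (- (pi * (1 / \<epsilon>) * (norm z)\<^sup>2)))"
    using e by (simp add: integral_heat_cis)
  also have "\<dots> = heat \<epsilon> z"
    unfolding heat_conv_exp[OF e] by simp
  finally show ?thesis .
qed

text \<open>
  The Gaussian factor makes the double integral absolutely convergent; since its Fourier transform is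
  a heat kernel, Gaussian means of \<open>inv_fourier H\<close> are local averages of \<open>H\<close>.
\<close>

lemma gaussian_mean_inv_fourier:
  fixes H :: "'a::euclidean_space \<Rightarrow> complex"
  assumes H: "integrable lborel H" and e: "0 < \<epsilon>"
  shows "(\<integral>x. exp (- (pi * \<epsilon> * (norm x)\<^sup>2)) *\<^sub>R (cis (2 * pi * (z \<bullet> x)) * inv_fourier H x) \<partial>lborel)
     = (\<integral>\<xi>. heat \<epsilon> (z - \<xi>) *\<^sub>R H \<xi> \<partial>lborel)"
proof -
  define E :: "'a \<Rightarrow> complex" where "E = (\<lambda>x. complex_of_real (exp (- (pi * \<epsilon> * (norm x)\<^sup>2))))"
  have E: "integrable lborel E"
    unfolding E_def by (rule complex_of_real_integrable_eq[THEN iffD2, OF integrable_gaussian[OF e]])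
  have "(\<integral>x. exp (- (pi * \<epsilon> * (norm x)\<^sup>2)) *\<^sub>R (cis (2 * pi * (z \<bullet> x)) * inv_fourier H x) \<partial>lborel)
    = (\<integral>x. E x * (\<integral>\<xi>. cis (2 * pi * (z \<bullet> x) + - (2 * pi * (\<xi> \<bullet> x))) * H \<xi> \<partial>lborel) \<partial>lborel)"
    unfolding E_def inv_fourier_def cis_mult[symmetric] mult.assoc
    by (simp add: scaleR_conv_of_real)
  also have "\<dots> = (\<integral>\<xi>. (\<integral>x. cis (2 * pi * (z \<bullet> x) + - (2 * pi * (\<xi> \<bullet> x))) * E x \<partial>lborel) * H \<xi> \<partial>lborel)"
    by (rule fubini_cis[OF E H]) measurable
  also have "\<dots> = (\<integral>\<xi>. heat \<epsilon> (z - \<xi>) *\<^sub>R H \<xi> \<partial>lborel)"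
  proof (rule Bochner_Integration.integral_cong[OF refl])
    fix \<xi>
    have "(\<integral>x. cis (2 * pi * (z \<bullet> x) + - (2 * pi * (\<xi> \<bullet> x))) * E x \<partial>lborel) = heat \<epsilon> (z - \<xi>)"
      unfolding integral_gaussian_cis[OF e, symmetric] E_def
      by (simp add: inner_diff_left algebra_simps)
    then show "(\<integral>x. cis (2 * pi * (z \<bullet> x) + - (2 * pi * (\<xi> \<bullet> x))) * E x \<partial>lborel) * H \<xi> = heat \<epsilon> (z - \<xi>) *\<^sub>R H \<xi>"
      by (simp add: scaleR_conv_of_real)
  qed
  finally show ?thesis .
qed

lemma gaussian_tendsto_1:
  "(\<lambda>k. exp (- (pi * (1 / real (Suc k)) * r))) \<longlonglongrightarrow> 1"
proof -
  have "(\<lambda>k. exp (- (pi * (1 / real (Suc k)) * r))) \<longlonglongrightarrow> exp (- (pi * 0 * r))"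
    by (intro tendsto_intros) (use LIMSEQ_inverse_real_of_nat in \<open>simp add: inverse_eq_divide\<close>)
  then show ?thesis by simp
qed

text \<open>
  Gaussian means of the Fourier integral converge to \<open>inv_fourier (fourier f) z\<close> by dominated
  convergence, and they are heat averages of \<open>f\<close>, which converge to \<open>f z\<close>.
\<close>

theorem inv_fourier_fourier:
  fixes f :: "'a::euclidean_space \<Rightarrow> complex"
  assumes f: "integrable lborel f" and M: "\<And>y. cmod (f y) \<le> M" and cont: "isCont f z"
    and F: "integrable lborel (fourier f)"
  shows "inv_fourier (fourier f) z = f z"
proof -
  define E :: "nat \<Rightarrow> 'a \<Rightarrow> real" where "E k x = exp (- (pi * (1 / real (Suc k)) * (norm x)\<^sup>2))" for k x
  have [measurable]: "f \<in> borel_measurable borel" "fourier f \<in> borel_measurable borel" using f F by simp_all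
  have [measurable]: "E k \<in> borel_measurable borel" for k unfolding E_def by measurable
  have "(\<lambda>k. \<integral>x. E k x *\<^sub>R (cis (- (2 * pi * (x \<bullet> z))) * fourier f x) \<partial>lborel)
     \<longlonglongrightarrow> (\<integral>x. cis (- (2 * pi * (x \<bullet> z))) * fourier f x \<partial>lborel)"
  proof (rule integral_dominated_convergence[where w="\<lambda>x. cmod (fourier f x)"])
    have "(\<lambda>k. E k x *\<^sub>R (cis (- (2 * pi * (x \<bullet> z))) * fourier f x))
        \<longlonglongrightarrow> 1 *\<^sub>R (cis (- (2 * pi * (x \<bullet> z))) * fourier f x)" for x
      unfolding E_def by (intro tendsto_scaleR gaussian_tendsto_1 tendsto_const)
    then show "AE x in lborel. (\<lambda>k. E k x *\<^sub>R (cis (- (2 * pi * (x \<bullet> z))) * fourier f x))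
        \<longlonglongrightarrow> cis (- (2 * pi * (x \<bullet> z))) * fourier f x" by simp
    show "AE x in lborel. norm (E k x *\<^sub>R (cis (- (2 * pi * (x \<bullet> z))) * fourier f x)) \<le> cmod (fourier f x)" for k
      by (auto simp: norm_mult E_def intro!: mult_left_le_one_le)
    show "integrable lborel (\<lambda>x. cmod (fourier f x))" using F by simp
  qed (auto simp: cis_conv_exp)
  moreover have "(\<integral>x. E k x *\<^sub>R (cis (- (2 * pi * (x \<bullet> z))) * fourier f x) \<partial>lborel)
     = (\<integral>y. heat (1 / real (Suc k)) (z - y) *\<^sub>R f y \<partial>lborel)" for k
  proof -
    have "(\<integral>x. E k x *\<^sub>R (cis (- (2 * pi * (x \<bullet> z))) * fourier f x) \<partial>lborel)
      = (\<integral>x. E k (0 - x) *\<^sub>R (cis (- (2 * pi * ((0 - x) \<bullet> z))) * fourier f (0 - x)) \<partial>lborel)"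
      by (rule lborel_integral_reflect[symmetric, where f="\<lambda>x. E k x *\<^sub>R (cis (- (2 * pi * (x \<bullet> z))) * fourier f x)"])
        (simp add: cis_conv_exp)
    also have "\<dots> = (\<integral>x. E k x *\<^sub>R (cis (2 * pi * (z \<bullet> x)) * inv_fourier f x) \<partial>lborel)"
      by (simp add: E_def fourier_conv_inv_fourier inner_commute)
    also have "\<dots> = (\<integral>y. heat (1 / real (Suc k)) (z - y) *\<^sub>R f y \<partial>lborel)"
      unfolding E_def by (rule gaussian_mean_inv_fourier[OF f]) simp
    finally show ?thesis .
  qed
  moreover have "(\<lambda>k. \<integral>y. heat (1 / real (Suc k)) (z - y) *\<^sub>R f y \<partial>lborel) \<longlonglongrightarrow> f z"
    by (rule heat_approximate_identity[OF _ M cont]) simp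
  ultimately show ?thesis
    unfolding inv_fourier_def using LIMSEQ_unique by (simp add: ) blast
qed

text \<open>
  Under a Gaussian weight, the square of \<open>inv_fourier H\<close> integrates to the pairing of \<open>H\<close> with a heat
  average of \<open>H\<close>. When the weight increases to \<open>1\<close>, the left side converges by monotone and the right
  side by dominated convergence. Continuity is asked for almost everywhere because the multiplier
  \<open>norm \<xi> powr 0\<close> vanishes at the origin and equals \<open>1\<close> elsewhere.
\<close>

theorem plancherel_inv_fourier:
  fixes H :: "'a::euclidean_space \<Rightarrow> complex"
  assumes H: "integrable lborel H" and M: "\<And>y. cmod (H y) \<le> M" and cont: "AE z in lborel. isCont H z"
  shows "(\<integral>\<^sup>+x. ennreal ((cmod (inv_fourier H x))\<^sup>2) \<partial>lborel) = (\<integral>\<^sup>+\<xi>. ennreal ((cmod (H \<xi>))\<^sup>2) \<partial>lborel)"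
proof -
  define E :: "nat \<Rightarrow> 'a \<Rightarrow> real" where "E k x = exp (- (pi * (1 / real (Suc k)) * (norm x)\<^sup>2))" for k x
  let ?h = "inv_fourier H"
  let ?A = "\<lambda>k z. (\<integral>\<xi>. heat (1 / real (Suc k)) (z - \<xi>) *\<^sub>R H \<xi> \<partial>lborel)"
  have [measurable]: "H \<in> borel_measurable borel" using H by simp
  have [measurable]: "E k \<in> borel_measurable borel" for k unfolding E_def by measurable
  have M0: "M \<ge> 0" by (rule order_trans[OF norm_ge_zero M])
  define B where "B = (\<integral>\<xi>. cmod (H \<xi>) \<partial>lborel)"
  have B: "cmod (?h x) \<le> B" for x unfolding B_def by (rule norm_inv_fourier_le)
  have B0: "B \<ge> 0" by (rule order_trans[OF norm_ge_zero B])
  have E: "integrable lborel (E k)" for k unfolding E_def by (rule integrable_gaussian) simp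
  have Eh: "integrable lborel (\<lambda>x. E k x *\<^sub>R ?h x)" for k
  proof (rule Bochner_Integration.integrable_bound[OF integrable_mult_right[OF E, of B]])
    show "AE x in lborel. norm (E k x *\<^sub>R ?h x) \<le> norm (B * E k x)"
      using B B0 by (auto simp: E_def abs_mult intro!: AE_I2)
  qed measurable
  have Eh2: "integrable lborel (\<lambda>x. E k x * (cmod (?h x))\<^sup>2)" for k
  proof (rule Bochner_Integration.integrable_bound[OF integrable_mult_right[OF E, of "B\<^sup>2"]])
    show "AE x in lborel. norm (E k x * (cmod (?h x))\<^sup>2) \<le> norm (B\<^sup>2 * E k x)"
      using B B0 by (auto simp: E_def abs_mult intro!: AE_I2 power_mono)
  qed measurable
  have cnjH: "integrable lborel (\<lambda>x. cnj (H x))" using H by simp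
  have [measurable]: "(\<lambda>x. cnj (H x)) \<in> borel_measurable borel"
    using borel_measurable_integrable[OF cnjH] by simp
  have cnjh: "cnj (?h x) = (\<integral>z. cis (2 * pi * (z \<bullet> x)) * cnj (H z) \<partial>lborel)" for x
  proof -
    have "cnj (?h x) = (\<integral>z. cnj (cis (- (2 * pi * (z \<bullet> x))) * H z) \<partial>lborel)"
      unfolding inv_fourier_def by (rule Bochner_Integration.integral_cnj[symmetric])
    then show ?thesis by (simp add: cis_cnj)
  qed
  have key: "complex_of_real (\<integral>x. E k x * (cmod (?h x))\<^sup>2 \<partial>lborel)
      = (\<integral>z. ?A k z * cnj (H z) \<partial>lborel)" for k
  proof -
    have "complex_of_real (\<integral>x. E k x * (cmod (?h x))\<^sup>2 \<partial>lborel)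
      = (\<integral>x. complex_of_real (E k x * (cmod (?h x))\<^sup>2) \<partial>lborel)" by (simp only: integral_complex_of_real)
    also have "\<dots> = (\<integral>x. (E k x *\<^sub>R ?h x) * (\<integral>z. cis (2 * pi * (z \<bullet> x)) * cnj (H z) \<partial>lborel) \<partial>lborel)"
      by (simp only: cnjh[symmetric]) (simp only: scaleR_conv_of_real complex_norm_square of_real_mult mult.assoc)
    also have "\<dots> = (\<integral>z. (\<integral>x. cis (2 * pi * (z \<bullet> x)) * (E k x *\<^sub>R ?h x) \<partial>lborel) * cnj (H z) \<partial>lborel)"
      by (rule fubini_cis[OF Eh cnjH]) measurable
    also have "\<dots> = (\<integral>z. ?A k z * cnj (H z) \<partial>lborel)"
      unfolding E_def mult_scaleR_right by (intro Bochner_Integration.integral_cong refl arg_cong2[where f="(*)"] gaussian_mean_inv_fourier[OF H]) simp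
    finally show ?thesis .
  qed
  have "(\<lambda>k. \<integral>z. ?A k z * cnj (H z) \<partial>lborel)
     \<longlonglongrightarrow> (\<integral>z. H z * cnj (H z) \<partial>lborel)"
  proof (rule integral_dominated_convergence[where w="\<lambda>z. M * cmod (H z)"])
    show "AE z in lborel. (\<lambda>k. ?A k z * cnj (H z)) \<longlonglongrightarrow> H z * cnj (H z)"
      using cont by eventually_elim (rule tendsto_mult[OF heat_approximate_identity[OF _ M] tendsto_const], simp_all)
    have hb: "cmod (?A k z) \<le> M" for k z
    proof -
      let ?t = "1 / real (Suc k)"
      have i: "integrable lborel (\<lambda>\<xi>::'a. heat ?t (\<xi> + (- z)))"
        by (intro lborel_integrable_shift integrable_heat) simp
      have "cmod (\<integral>\<xi>. heat ?t (z - \<xi>) *\<^sub>R H \<xi> \<partial>lborel) \<le> (\<integral>\<xi>. heat ?t (\<xi> + (- z)) * M \<partial>lborel)"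
        using M M0 i by (intro order_trans[OF integral_norm_bound] integral_mono_AE' integrable_mult_left)
          (auto simp: heat_minus_commute[of _ z] intro!: mult_left_mono AE_I2)
      also have "\<dots> = (\<integral>\<xi>. heat ?t (\<xi> + (- z)) \<partial>lborel) * M"
        by simp
      also have "(\<integral>\<xi>. heat ?t (\<xi> + (- z)) \<partial>lborel) = 1"
        using integral_heat[of ?t] by (subst lborel_integral_shift) auto
      finally show ?thesis by simp
    qed
    show "AE z in lborel. norm (?A k z * cnj (H z)) \<le> M * cmod (H z)" for k
      using hb by (auto simp: norm_mult intro!: AE_I2 mult_right_mono)
    show "integrable lborel (\<lambda>z. M * cmod (H z))" using H by simp
  qed measurable
  also have "(\<integral>z. H z * cnj (H z) \<partial>lborel) = complex_of_real (\<integral>z. (cmod (H z))\<^sup>2 \<partial>lborel)"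
    by (simp add: complex_norm_square[symmetric] flip: of_real_power)
  finally have lim: "(\<lambda>k. \<integral>x. E k x * (cmod (?h x))\<^sup>2 \<partial>lborel) \<longlonglongrightarrow> (\<integral>z. (cmod (H z))\<^sup>2 \<partial>lborel)"
    unfolding key[symmetric] by (simp only: tendsto_of_real_iff)
  have H2: "integrable lborel (\<lambda>z. (cmod (H z))\<^sup>2)"
  proof (rule Bochner_Integration.integrable_bound[OF integrable_mult_right[OF integrable_norm[OF H], of M]])
    show "AE x in lborel. norm ((cmod (H x))\<^sup>2) \<le> norm (M * cmod (H x))"
      using M M0 by (auto simp: power2_eq_square abs_mult intro!: AE_I2 mult_right_mono)
  qed measurable
  have "(\<lambda>k. \<integral>\<^sup>+x. ennreal (E k x * (cmod (?h x))\<^sup>2) \<partial>lborel) \<longlonglongrightarrow> (\<integral>\<^sup>+x. ennreal ((cmod (?h x))\<^sup>2) \<partial>lborel)"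
  proof (rule nn_integral_LIMSEQ)
    show "incseq (\<lambda>k x. ennreal (E k x * (cmod (?h x))\<^sup>2))"
      unfolding E_def
      by (auto simp: incseq_def le_fun_def intro!: ennreal_leI mult_right_mono mult_left_mono divide_left_mono)
    have "(\<lambda>k. E k x * (cmod (?h x))\<^sup>2) \<longlonglongrightarrow> 1 * (cmod (?h x))\<^sup>2" for x
      unfolding E_def by (intro tendsto_mult gaussian_tendsto_1 tendsto_const)
    then show "(\<lambda>k. ennreal (E k x * (cmod (?h x))\<^sup>2)) \<longlonglongrightarrow> ennreal ((cmod (?h x))\<^sup>2)" for x
      by simp
  qed measurable
  moreover have "(\<integral>\<^sup>+x. ennreal (E k x * (cmod (?h x))\<^sup>2) \<partial>lborel) = ennreal (\<integral>x. E k x * (cmod (?h x))\<^sup>2 \<partial>lborel)" for k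
    by (rule nn_integral_eq_integral[OF Eh2]) (auto simp: E_def)
  moreover have "(\<integral>\<^sup>+\<xi>. ennreal ((cmod (H \<xi>))\<^sup>2) \<partial>lborel) = ennreal (\<integral>z. (cmod (H z))\<^sup>2 \<partial>lborel)"
    by (rule nn_integral_eq_integral[OF H2]) auto
  ultimately show ?thesis
    using LIMSEQ_unique tendsto_ennrealI[OF lim] by force
qed

lemma cmod_one_minus_cis: "(cmod (1 - cis \<theta>))\<^sup>2 = 2 - 2 * cos \<theta>"
  unfolding cmod_power2 using sin_cos_squared_add[of \<theta>] by (simp add: cmod_power2 power2_eq_square algebra_simps)

lemma nn_integral_heat_one_minus_cos:
  fixes \<xi> :: "'a::euclidean_space"
  assumes t: "0 < t"
  shows "(\<integral>\<^sup>+z. ennreal (heat t z * (2 - 2 * cos (2 * pi * (\<xi> \<bullet> z)))) \<partial>lborel) = ennreal (2 * (1 - exp (- (pi * t * (norm \<xi>)\<^sup>2))))"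
proof -
  have i: "integrable lborel (\<lambda>z. heat t z * cos (2 * pi * (\<xi> \<bullet> z)))"
    using integrable_Re[OF integrable_heat_cis[OF t, of \<xi>]] by simp
  have "(\<integral>z. heat t z * cos (2 * pi * (\<xi> \<bullet> z)) \<partial>lborel) = Re (\<integral>z. heat t z * cis (2 * pi * (\<xi> \<bullet> z)) \<partial>lborel)"
    by (subst integral_Re[symmetric, OF integrable_heat_cis[OF t]]) simp
  also have "\<dots> = exp (- (pi * t * (norm \<xi>)\<^sup>2))"
    unfolding integral_heat_cis[OF t] by simp
  finally have I: "(\<integral>z. heat t z * cos (2 * pi * (\<xi> \<bullet> z)) \<partial>lborel) = exp (- (pi * t * (norm \<xi>)\<^sup>2))" .
  have "(\<integral>\<^sup>+z. ennreal (heat t z * (2 - 2 * cos (2 * pi * (\<xi> \<bullet> z)))) \<partial>lborel)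
     = (\<integral>\<^sup>+z. ennreal (2 * heat t z - 2 * (heat t z * cos (2 * pi * (\<xi> \<bullet> z)))) \<partial>lborel)"
    by (simp add: algebra_simps)
  also have "\<dots> = ennreal (\<integral>z. 2 * heat t z - 2 * (heat t z * cos (2 * pi * (\<xi> \<bullet> z))) \<partial>lborel)"
    using i integrable_heat[OF t, where 'a='a]
    by (intro nn_integral_eq_integral) (auto intro!: AE_I2 mult_left_le)
  also have "(\<integral>z. 2 * heat t z - 2 * (heat t z * cos (2 * pi * (\<xi> \<bullet> z))) \<partial>lborel)
      = 2 * (1 - exp (- (pi * t * (norm \<xi>)\<^sup>2)))"
    using i integrable_heat[OF t, where 'a='a] by (simp add: I integral_heat[OF t])
  finally show ?thesis .
qed

text \<open>
  For fixed \<open>z\<close>, the increment \<open>h x - h (x - z)\<close> is the inverse Fourier transform of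
  \<open>(1 - cis (2 \<pi> \<xi> \<bullet> z)) * H \<xi>\<close>. Plancherel turns its square integral into one of
  \<open>(2 - 2 cos (2 \<pi> \<xi> \<bullet> z)) |H \<xi>|\<^sup>2\<close>, and the average over \<open>z\<close> with weight \<open>heat t z\<close> is the Fourier
  transform of the heat kernel.
\<close>

lemma nn_integral_heat_energy:
  fixes H :: "'a::euclidean_space \<Rightarrow> complex"
  assumes H: "integrable lborel H" and M: "\<And>y. cmod (H y) \<le> M" and cont: "AE z in lborel. isCont H z"
    and t: "0 < t"
  shows "(\<integral>\<^sup>+x. (\<integral>\<^sup>+y. ennreal ((cmod (inv_fourier H x - inv_fourier H y))\<^sup>2 * heat t (x - y)) \<partial>lborel) \<partial>lborel)
     = (\<integral>\<^sup>+\<xi>. ennreal (2 * (1 - exp (- (pi * t * (norm \<xi>)\<^sup>2))) * (cmod (H \<xi>))\<^sup>2) \<partial>lborel)"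
proof -
  let ?h = "inv_fourier H"
  let ?D = "\<lambda>x z. ennreal ((cmod (?h x - ?h (x - z)))\<^sup>2 * heat t (x - (x - z)))"
  let ?S = "\<lambda>z \<xi>. ennreal (heat t z * (2 - 2 * cos (2 * pi * (\<xi> \<bullet> z))) * (cmod (H \<xi>))\<^sup>2)"
  let ?c = "\<lambda>z \<xi>. 2 - 2 * cos (2 * pi * (\<xi> \<bullet> z))"
  have [measurable]: "H \<in> borel_measurable borel" using H by simp
  have "(\<integral>\<^sup>+x. (\<integral>\<^sup>+y. ennreal ((cmod (?h x - ?h y))\<^sup>2 * heat t (x - y)) \<partial>lborel) \<partial>lborel)
    = (\<integral>\<^sup>+x. (\<integral>\<^sup>+z. ?D x z \<partial>lborel) \<partial>lborel)"
    by (intro nn_integral_cong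
       nn_integral_lborel_reflect[symmetric, where f="\<lambda>y. ennreal ((cmod (?h x - ?h y))\<^sup>2 * heat t (x - y))" for x]) measurable
  also have "\<dots> = (\<integral>\<^sup>+z. (\<integral>\<^sup>+x. ?D x z \<partial>lborel) \<partial>lborel)"
    by (rule lborel_pair.Fubini'[symmetric]) measurable
  also have "\<dots> = (\<integral>\<^sup>+z. (\<integral>\<^sup>+\<xi>. ?S z \<xi> \<partial>lborel) \<partial>lborel)"
  proof (rule nn_integral_cong)
    fix z
    define G where "G = (\<lambda>\<xi>. H \<xi> - cis (2 * pi * (\<xi> \<bullet> z)) * H \<xi>)"
    have G: "integrable lborel G"
      unfolding G_def using H by (intro Bochner_Integration.integrable_diff integrable_cis_mult) auto
    have Gh: "inv_fourier G x = ?h x - ?h (x - z)" for x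
    proof -
      have "inv_fourier G x = (\<integral>\<xi>. cis (- (2 * pi * (\<xi> \<bullet> x))) * H \<xi> - cis (- (2 * pi * (\<xi> \<bullet> (x - z)))) * H \<xi> \<partial>lborel)"
        unfolding inv_fourier_def
      proof (rule Bochner_Integration.integral_cong[OF refl])
        fix \<xi>
        have "cis (- (2 * pi * (\<xi> \<bullet> x))) * cis (2 * pi * (\<xi> \<bullet> z)) = cis (- (2 * pi * (\<xi> \<bullet> (x - z))))"
          by (simp add: cis_mult inner_diff_right algebra_simps)
        then show "cis (- (2 * pi * (\<xi> \<bullet> x))) * G \<xi> = cis (- (2 * pi * (\<xi> \<bullet> x))) * H \<xi> - cis (- (2 * pi * (\<xi> \<bullet> (x - z)))) * H \<xi>"
          unfolding G_def right_diff_distrib by (simp only: mult.assoc[symmetric])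
      qed
      also have "\<dots> = ?h x - ?h (x - z)"
        unfolding inv_fourier_def by (intro Bochner_Integration.integral_diff integrable_cis_mult H) measurable
      finally show ?thesis .
    qed
    have GG: "(cmod (G \<xi>))\<^sup>2 = (?c z \<xi>) * (cmod (H \<xi>))\<^sup>2" for \<xi>
    proof -
      have "G \<xi> = (1 - cis (2 * pi * (\<xi> \<bullet> z))) * H \<xi>" by (simp add: G_def algebra_simps)
      then show ?thesis by (simp add: norm_mult power_mult_distrib cmod_one_minus_cis)
    qed
    have "(\<integral>\<^sup>+x. ennreal ((cmod (inv_fourier G x))\<^sup>2) \<partial>lborel) = (\<integral>\<^sup>+\<xi>. ennreal ((cmod (G \<xi>))\<^sup>2) \<partial>lborel)"
    proof (rule plancherel_inv_fourier[OF G])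
      show "cmod (G y) \<le> M + M" for y
        unfolding G_def using M[of y] by (intro order_trans[OF norm_triangle_ineq4] add_mono) (auto simp: norm_mult)
      show "AE z in lborel. isCont G z"
        using cont unfolding G_def cis_conv_exp by eventually_elim (auto intro!: continuous_intros)
    qed
    then have P: "(\<integral>\<^sup>+x. ennreal ((cmod (?h x - ?h (x - z)))\<^sup>2) \<partial>lborel)
      = (\<integral>\<^sup>+\<xi>. ennreal ((?c z \<xi>) * (cmod (H \<xi>))\<^sup>2) \<partial>lborel)"
      unfolding Gh GG .
    have "(\<integral>\<^sup>+x. ?D x z \<partial>lborel)
       = (\<integral>\<^sup>+x. ennreal (heat t z) * ennreal ((cmod (?h x - ?h (x - z)))\<^sup>2) \<partial>lborel)"
      by (simp add: ennreal_mult mult.commute)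
    also have "\<dots> = ennreal (heat t z) * (\<integral>\<^sup>+x. ennreal ((cmod (?h x - ?h (x - z)))\<^sup>2) \<partial>lborel)"
      by (rule nn_integral_cmult) measurable
    also have "\<dots> = (\<integral>\<^sup>+\<xi>. ennreal (heat t z) * ennreal ((?c z \<xi>) * (cmod (H \<xi>))\<^sup>2) \<partial>lborel)"
      unfolding P by (rule nn_integral_cmult[symmetric]) measurable
    also have "\<dots> = (\<integral>\<^sup>+\<xi>. ?S z \<xi> \<partial>lborel)"
      by (simp add: ennreal_mult'[symmetric] mult.assoc)
    finally show "(\<integral>\<^sup>+x. ?D x z \<partial>lborel)
      = (\<integral>\<^sup>+\<xi>. ?S z \<xi> \<partial>lborel)" .
  qed
  also have "\<dots> = (\<integral>\<^sup>+\<xi>. (\<integral>\<^sup>+z. ?S z \<xi> \<partial>lborel) \<partial>lborel)"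
    by (rule lborel_pair.Fubini') measurable
  also have "\<dots> = (\<integral>\<^sup>+\<xi>. ennreal (2 * (1 - exp (- (pi * t * (norm \<xi>)\<^sup>2))) * (cmod (H \<xi>))\<^sup>2) \<partial>lborel)"
  proof (intro nn_integral_cong)
    fix \<xi>
    have "(\<integral>\<^sup>+z. ?S z \<xi> \<partial>lborel)
      = (\<integral>\<^sup>+z. ennreal (heat t z * (?c z \<xi>)) * ennreal ((cmod (H \<xi>))\<^sup>2) \<partial>lborel)"
      by (simp add: ennreal_mult'')
    also have "\<dots> = (\<integral>\<^sup>+z. ennreal (heat t z * (?c z \<xi>)) \<partial>lborel) * ennreal ((cmod (H \<xi>))\<^sup>2)"
      by (rule nn_integral_multc) measurable
    also have "\<dots> = ennreal (2 * (1 - exp (- (pi * t * (norm \<xi>)\<^sup>2))) * (cmod (H \<xi>))\<^sup>2)"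
      unfolding nn_integral_heat_one_minus_cos[OF t] by (simp add: ennreal_mult''[symmetric])
    finally show "(\<integral>\<^sup>+z. ?S z \<xi> \<partial>lborel)
       = ennreal (2 * (1 - exp (- (pi * t * (norm \<xi>)\<^sup>2))) * (cmod (H \<xi>))\<^sup>2)" .
  qed
  finally show ?thesis .
qed

section \<open>Fourier transforms of Schwartz functions\<close>

text \<open>
  The power dominates the product of \<open>1 + (x \<bullet> b)\<^sup>2\<close> over all coordinates, whose reciprocal is
  integrable because it factors.
\<close>

lemma integrable_bracket_power:
  "integrable lborel (\<lambda>x::'a::euclidean_space. 1 / (1 + (norm x)\<^sup>2) ^ DIM('a))"
proof -
  have 1: "integrable lborel (\<lambda>r::real. complex_of_real (inverse (1 + r\<^sup>2)))"
  proof -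
    have "set_integrable lborel UNIV (\<lambda>r::real. inverse (1 + r\<^sup>2))"
      using integrable_inverse_1_plus_square by simp
    then have "integrable lborel (\<lambda>r::real. inverse (1 + r\<^sup>2))"
      by (simp add: set_integrable_def)
    then show ?thesis by (rule complex_of_real_integrable_eq[THEN iffD2])
  qed
  have int: "integrable lborel (\<lambda>x::'a. \<Prod>b\<in>Basis. complex_of_real (inverse (1 + (x \<bullet> b)\<^sup>2)))"
    by (rule lborel_integrable_prod_Basis[OF 1])
  show ?thesis
  proof (rule Bochner_Integration.integrable_bound[OF int])
    show "AE x in lborel. norm (1 / (1 + (norm x)\<^sup>2) ^ DIM('a))
       \<le> norm (\<Prod>b\<in>Basis. complex_of_real (inverse (1 + ((x::'a) \<bullet> b)\<^sup>2)))"
    proof (rule AE_I2)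
      fix x :: 'a
      have "(\<Prod>b\<in>Basis. 1 + (x \<bullet> b)\<^sup>2) \<le> (\<Prod>b\<in>(Basis::'a set). 1 + (norm x)\<^sup>2)"
        by (intro prod_mono conjI add_left_mono power2_le_iff_abs_le[THEN iffD2]) (auto simp: Basis_le_norm)
      then have le: "(\<Prod>b\<in>Basis. 1 + (x \<bullet> b)\<^sup>2) \<le> (1 + (norm x)\<^sup>2) ^ DIM('a)" by simp
      have pos: "0 < (\<Prod>b\<in>Basis. 1 + (x \<bullet> b)\<^sup>2)"
        by (intro prod_pos) (auto intro: add_pos_nonneg)
      have "norm (\<Prod>b\<in>Basis. complex_of_real (inverse (1 + (x \<bullet> b)\<^sup>2))) = (\<Prod>b\<in>Basis. \<bar>inverse (1 + (x \<bullet> b)\<^sup>2)\<bar>)"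
        by (simp only: prod_norm[symmetric] norm_of_real)
      also have "\<dots> = (\<Prod>b\<in>Basis. inverse (1 + (x \<bullet> b)\<^sup>2))"
        by (intro prod.cong refl abs_of_nonneg) (simp add: add_nonneg_nonneg)
      also have "\<dots> = 1 / (\<Prod>b\<in>Basis. 1 + (x \<bullet> b)\<^sup>2)"
        using prod_inversef[of "\<lambda>b. 1 + (x \<bullet> b)\<^sup>2" Basis] by (simp add: o_def inverse_eq_divide)
      finally have eq: "norm (\<Prod>b\<in>Basis. complex_of_real (inverse (1 + (x \<bullet> b)\<^sup>2))) = 1 / (\<Prod>b\<in>Basis. 1 + (x \<bullet> b)\<^sup>2)" .
      have "0 < (1 + (norm x)\<^sup>2) ^ DIM('a)"
        by (intro zero_less_power add_pos_nonneg) auto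
      then show "norm (1 / (1 + (norm x)\<^sup>2) ^ DIM('a))
         \<le> norm (\<Prod>b\<in>Basis. complex_of_real (inverse (1 + (x \<bullet> b)\<^sup>2)))"
        unfolding eq using le pos by (simp add: frac_le)
    qed
  qed measurable
qed

lemma bracket_power_le: "(1 + (r::real)\<^sup>2) ^ m \<le> 2 ^ m * (1 + r ^ (2 * m))"
proof (cases "r\<^sup>2 \<le> 1")
  case True
  then have "(1 + r\<^sup>2) ^ m \<le> 2 ^ m" by (intro power_mono) auto
  also have "\<dots> \<le> 2 ^ m * (1 + r ^ (2 * m))" by (simp add: power_mult)
  finally show ?thesis .
next
  case False
  then have "(1 + r\<^sup>2) ^ m \<le> (2 * r\<^sup>2) ^ m" by (intro power_mono) auto
  also have "\<dots> \<le> 2 ^ m * (1 + r ^ (2 * m))" by (simp add: power_mult_distrib power_mult)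
  finally show ?thesis .
qed

lemma rapid_decay_bracket:
  fixes F :: "'a::euclidean_space \<Rightarrow> complex"
  assumes "\<And>k::nat. \<exists>C. \<forall>x. norm x ^ k * cmod (F x) \<le> C"
  obtains C where "C \<ge> 0" "\<And>x. cmod (F x) \<le> C / (1 + (norm x)\<^sup>2) ^ m"
proof -
  obtain A where A: "\<And>x. norm x ^ 0 * cmod (F x) \<le> A" using assms[of 0] by blast
  obtain B where B: "\<And>x. norm x ^ (2 * m) * cmod (F x) \<le> B" using assms[of "2 * m"] by blast
  have "0 \<le> norm (0::'a) ^ 0 * cmod (F 0)" "0 \<le> norm (0::'a) ^ (2 * m) * cmod (F 0)" by simp_all
  with A[of 0] B[of 0] have AB: "0 \<le> A" "0 \<le> B" by linarith+
  show thesis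
  proof (rule that[of "2 ^ m * (A + B)"])
    fix x :: 'a
    have pos: "0 < (1 + (norm x)\<^sup>2) ^ m" by (intro zero_less_power add_pos_nonneg) auto
    have "(1 + (norm x)\<^sup>2) ^ m * cmod (F x) \<le> (2 ^ m * (1 + norm x ^ (2 * m))) * cmod (F x)"
      by (intro mult_right_mono bracket_power_le) auto
    also have "\<dots> = 2 ^ m * (norm x ^ 0 * cmod (F x) + norm x ^ (2 * m) * cmod (F x))"
      by (simp add: algebra_simps)
    also have "\<dots> \<le> 2 ^ m * (A + B)" by (intro mult_left_mono add_mono A B) auto
    finally show "cmod (F x) \<le> 2 ^ m * (A + B) / (1 + (norm x)\<^sup>2) ^ m"
      using pos by (simp add: pos_le_divide_eq mult.commute)
  qed (use AB in simp)
qed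

lemma integrable_bracket_bound:
  fixes F :: "'a::euclidean_space \<Rightarrow> complex"
  assumes [measurable]: "F \<in> borel_measurable borel"
    and "\<And>x. cmod (F x) \<le> C / (1 + (norm x)\<^sup>2) ^ DIM('a)"
  shows "integrable lborel F"
proof (rule Bochner_Integration.integrable_bound[OF integrable_mult_right[OF integrable_bracket_power, of C]])
  show "AE x in lborel. norm (F x) \<le> norm (C * (1 / (1 + (norm x)\<^sup>2) ^ DIM('a)))"
    by (auto intro!: order_trans[OF assms(2)] divide_right_mono AE_I2)
qed measurable

lemma bracket_ge_1: "1 \<le> (1 + (norm x)\<^sup>2) ^ m"
  by (intro one_le_power) auto

lemma bracket_bound_le:
  assumes "0 \<le> C"
  shows "C / (1 + (norm x)\<^sup>2) ^ m \<le> C"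
proof -
  have p: "1 \<le> (1 + (norm x)\<^sup>2) ^ m" by (rule bracket_ge_1)
  have "C / (1 + (norm x)\<^sup>2) ^ m \<le> C / 1"
    by (rule divide_left_mono[OF p assms]) (use p in linarith)
  then show ?thesis by simp
qed

lemma partial_deriv_append: "partial_deriv cs (partial_deriv bs f) = partial_deriv (cs @ bs) f"
  by (induction cs) auto

lemma schwartz_partial_deriv:
  assumes "schwartz f" "set bs \<subseteq> Basis"
  shows "schwartz (partial_deriv bs f)"
  using assms unfolding schwartz_def partial_deriv_append by simp

lemma schwartz_differentiable: "schwartz f \<Longrightarrow> f differentiable (at x)"
  unfolding schwartz_def by (drule spec[of _ "[]"]) simp

lemma schwartz_continuous: "schwartz f \<Longrightarrow> isCont f x"
  by (simp add: schwartz_differentiable differentiable_imp_continuous_within)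

lemma schwartz_measurable: "schwartz f \<Longrightarrow> f \<in> borel_measurable borel"
  by (intro borel_measurable_continuous_onI continuous_at_imp_continuous_on) (simp add: schwartz_continuous)

lemma schwartz_decay:
  assumes "schwartz f"
  shows "\<exists>C. \<forall>x. norm x ^ k * cmod (f x) \<le> C"
proof -
  have "bounded (range (\<lambda>x. norm x ^ k *\<^sub>R partial_deriv [] f x))"
    using assms unfolding schwartz_def by (metis empty_subsetI list.set(1))
  then show ?thesis by (auto simp: bounded_iff)
qed

lemma schwartz_bracket:
  fixes f :: "'a::euclidean_space \<Rightarrow> complex"
  assumes "schwartz f"
  obtains C where "C \<ge> 0" "\<And>x. cmod (f x) \<le> C / (1 + (norm x)\<^sup>2) ^ m"
  by (rule rapid_decay_bracket[OF schwartz_decay[OF assms], where m=m]) (rule that)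

lemma schwartz_integrable:
  fixes f :: "'a::euclidean_space \<Rightarrow> complex"
  assumes f: "schwartz f"
  shows "integrable lborel f"
proof -
  obtain C where "\<And>x. cmod (f x) \<le> C / (1 + (norm x)\<^sup>2) ^ DIM('a)"
    by (rule schwartz_bracket[OF f, where m="DIM('a)"]) (rule that)
  then show ?thesis by (rule integrable_bracket_bound[OF schwartz_measurable[OF f]])
qed

lemma norm_fourier_le: "cmod (fourier f x) \<le> (\<integral>y. cmod (f y) \<partial>lborel)"
  unfolding fourier_conv_inv_fourier by (rule norm_inv_fourier_le)

lemma bracket_shift:
  fixes x y :: "'a::euclidean_space"
  assumes "norm (y - x) \<le> 1"
  shows "1 / (1 + (norm y)\<^sup>2) ^ m \<le> 3 ^ m / (1 + (norm x)\<^sup>2) ^ m"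
proof -
  have pos: "0 < 1 + (norm z)\<^sup>2" for z :: 'a by (intro add_pos_nonneg) auto
  have "norm x \<le> norm y + 1"
    using assms norm_triangle_ineq2[of x y] by (simp add: norm_minus_commute)
  then have "(norm x)\<^sup>2 \<le> (norm y + 1)\<^sup>2" by (intro power_mono) auto
  also have "\<dots> \<le> 2 * (norm y)\<^sup>2 + 2"
    using zero_le_power2[of "norm y - 1"] by (simp add: power2_eq_square algebra_simps)
  finally have le: "(norm x)\<^sup>2 \<le> 2 * (norm y)\<^sup>2 + 2" .
  have "1 + X \<le> 3 * (1 + Y)" if "X \<le> 2 * Y + 2" "0 \<le> Y" for X Y :: real
    using that by simp
  from this[OF le] have "1 + (norm x)\<^sup>2 \<le> 3 * (1 + (norm y)\<^sup>2)" by simp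
  then have "(1 + (norm x)\<^sup>2) ^ m \<le> (3 * (1 + (norm y)\<^sup>2)) ^ m" using pos[of x] by (intro power_mono) auto
  also have "\<dots> = 3 ^ m * (1 + (norm y)\<^sup>2) ^ m" by (rule power_mult_distrib)
  finally show ?thesis
    using zero_less_power[OF pos[of x], of m] zero_less_power[OF pos[of y], of m]
    by (simp add: divide_simps)
qed

lemma vector_derivative_difference_quotient:
  fixes \<phi> :: "real \<Rightarrow> 'b::real_normed_vector"
  assumes "(\<phi> has_vector_derivative v) (at 0)"
  shows "((\<lambda>h. (1 / h) *\<^sub>R (\<phi> h - \<phi> 0)) \<longlongrightarrow> v) (at 0)"
proof -
  have L: "((\<lambda>h. norm (\<phi> (0 + h) - \<phi> 0 - h *\<^sub>R v) / norm h) \<longlongrightarrow> 0) (at 0)"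
    using assms unfolding has_vector_derivative_def has_derivative_at by blast
  have "((\<lambda>h. norm ((1 / h) *\<^sub>R (\<phi> h - \<phi> 0) - v)) \<longlongrightarrow> 0) (at 0)"
  proof (rule Lim_transform_eventually[OF L])
    have "norm (\<phi> (0 + h) - \<phi> 0 - h *\<^sub>R v) / norm h = norm ((1 / h) *\<^sub>R (\<phi> h - \<phi> 0) - v)" if "h \<noteq> 0" for h
    proof -
      have "(1 / h) *\<^sub>R (\<phi> h - \<phi> 0) - v = (1 / h) *\<^sub>R (\<phi> (0 + h) - \<phi> 0 - h *\<^sub>R v)"
        using that by (simp add: scaleR_diff_right)
      then show ?thesis by simp
    qed
    then show "\<forall>\<^sub>F h in at 0. norm (\<phi> (0 + h) - \<phi> 0 - h *\<^sub>R v) / norm h = norm ((1 / h) *\<^sub>R (\<phi> h - \<phi> 0) - v)"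
      by (auto simp: eventually_at_filter)
  qed
  then show ?thesis
    by (rule LIM_zero_cancel[OF tendsto_norm_zero_cancel])
qed

text \<open>
  Difference quotients replace integration by parts: a translation of \<open>f\<close> multiplies the Fourier
  transform by a unimodular factor. The quotients are dominated through the mean value theorem, since
  the decay of the derivative is uniform over balls of radius \<open>1\<close>.
\<close>

lemma fourier_partial_deriv:
  fixes f :: "'a::euclidean_space \<Rightarrow> complex"
  assumes f: "schwartz f" and b: "b \<in> Basis"
  shows "fourier (partial_deriv [b] f) \<xi> = - (2 * pi * \<i> * (\<xi> \<bullet> b)) * fourier f \<xi>"
proof -
  let ?e = "\<lambda>x. cis (2 * pi * (\<xi> \<bullet> x))"
  let ?N = "\<lambda>x. (1 + (norm x)\<^sup>2) ^ DIM('a)"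
  define s where "s k = 1 / real (Suc k)" for k
  have s: "0 < s k" "s k \<le> 1" for k by (auto simp: s_def)
  have s0: "s \<longlonglongrightarrow> 0" unfolding s_def using LIMSEQ_inverse_real_of_nat by (simp add: inverse_eq_divide)
  have s0': "filterlim s (at 0) sequentially"
    using s0 s by (auto simp: filterlim_at intro!: always_eventually) (metis less_irrefl)
  define f' where "f' = partial_deriv [b] f"
  have f's: "schwartz f'" unfolding f'_def using f b by (intro schwartz_partial_deriv) auto
  note [measurable] = schwartz_measurable[OF f] schwartz_measurable[OF f's]
  obtain C where C: "C \<ge> 0" "\<And>x. cmod (f' x) \<le> C / ?N x"
    by (rule schwartz_bracket[OF f's, where m="DIM('a)"]) (rule that)
  have der: "((\<lambda>r. f (x + r *\<^sub>R b)) has_vector_derivative f' (x + r *\<^sub>R b)) (at r within S)" for x r S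
  proof -
    have 1: "(f has_derivative frechet_derivative f (at (x + r *\<^sub>R b))) (at (x + r *\<^sub>R b))"
      using schwartz_differentiable[OF f] frechet_derivative_works by blast
    have 2: "((\<lambda>r. x + r *\<^sub>R b) has_vector_derivative b) (at r within S)"
      by (auto intro!: derivative_eq_intros)
    have "(f \<circ> (\<lambda>r. x + r *\<^sub>R b) has_derivative frechet_derivative f (at (x + r *\<^sub>R b)) \<circ> (\<lambda>h. h *\<^sub>R b)) (at r within S)"
      by (rule diff_chain_within[OF 2[unfolded has_vector_derivative_def] has_derivative_at_withinI[OF 1]])
    moreover have "frechet_derivative f (at (x + r *\<^sub>R b)) \<circ> (\<lambda>h. h *\<^sub>R b) = (\<lambda>h. h *\<^sub>R f' (x + r *\<^sub>R b))"
      using linear_cmul[OF has_derivative_linear[OF 1]] by (auto simp: f'_def)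
    ultimately show ?thesis by (simp add: has_vector_derivative_def o_def)
  qed
  define D where "D k x = (1 / s k) *\<^sub>R (f (x + s k *\<^sub>R b) - f x)" for k x
  have Dlim: "(\<lambda>k. D k x) \<longlonglongrightarrow> f' x" for x
  proof -
    have "((\<lambda>r. f (x + r *\<^sub>R b)) has_vector_derivative f' x) (at 0)"
      using der[of x 0 UNIV] by simp
    from vector_derivative_difference_quotient[OF this]
    have "((\<lambda>h. (1 / h) *\<^sub>R (f (x + h *\<^sub>R b) - f x)) \<longlongrightarrow> f' x) (at 0)"
      by simp
    from filterlim_compose[OF this s0'] show ?thesis by (simp add: D_def)
  qed
  have Dbound: "cmod (D k x) \<le> (C * 3 ^ DIM('a)) / ?N x" for k x
  proof -
    let ?B = "(C * 3 ^ DIM('a)) / ?N x"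
    have "norm (f (x + s k *\<^sub>R b) - f (x + 0 *\<^sub>R b)) \<le> ?B * norm (s k - 0)"
    proof (rule differentiable_bound[where S="{0..s k}" and f'="\<lambda>r h. h *\<^sub>R f' (x + r *\<^sub>R b)"])
      fix r assume r: "r \<in> {0..s k}"
      show "((\<lambda>r. f (x + r *\<^sub>R b)) has_derivative (\<lambda>h. h *\<^sub>R f' (x + r *\<^sub>R b))) (at r within {0..s k})"
        using der unfolding has_vector_derivative_def by blast
      have "cmod (f' (x + r *\<^sub>R b)) \<le> C / (1 + (norm (x + r *\<^sub>R b))\<^sup>2) ^ DIM('a)" by (rule C)
      also have "\<dots> = C * (1 / (1 + (norm (x + r *\<^sub>R b))\<^sup>2) ^ DIM('a))" by simp
      also have "\<dots> \<le> C * (3 ^ DIM('a) / ?N x)"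
        using r s(2)[of k] b by (intro mult_left_mono bracket_shift C) auto
      finally have "cmod (f' (x + r *\<^sub>R b)) \<le> ?B" by simp
      then have "norm (h *\<^sub>R f' (x + r *\<^sub>R b)) \<le> ?B * norm h" for h
        by (metis mult.commute mult_right_mono norm_scaleR real_norm_def abs_ge_zero)
      then show "onorm (\<lambda>h. h *\<^sub>R f' (x + r *\<^sub>R b)) \<le> ?B"
        by (rule onorm_le)
    qed (use s[of k] in auto)
    then have "norm (f (x + s k *\<^sub>R b) - f x) \<le> ?B * s k" using s(1)[of k] by simp
    then have "norm (f (x + s k *\<^sub>R b) - f x) / s k \<le> ?B" using s(1)[of k] by (simp only: pos_divide_le_eq)
    moreover have "cmod (D k x) = norm (f (x + s k *\<^sub>R b) - f x) / s k"
      unfolding D_def norm_scaleR using s(1)[of k] by simp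
    ultimately show ?thesis by simp
  qed
  have lim1: "(\<lambda>k. \<integral>x. ?e x * D k x \<partial>lborel) \<longlonglongrightarrow> (\<integral>x. ?e x * f' x \<partial>lborel)"
  proof (rule integral_dominated_convergence[where w="\<lambda>x. (C * 3 ^ DIM('a)) * (1 / ?N x)"])
    show "integrable lborel (\<lambda>x::'a. (C * 3 ^ DIM('a)) * (1 / ?N x))"
      by (intro integrable_mult_right integrable_bracket_power)
    show "AE x in lborel. (\<lambda>k. ?e x * D k x) \<longlonglongrightarrow> ?e x * f' x"
      by (intro AE_I2 tendsto_mult tendsto_const Dlim)
    show "AE x in lborel. norm (?e x * D k x) \<le> (C * 3 ^ DIM('a)) * (1 / ?N x)" for k
      using Dbound by (simp add: norm_mult)
  qed (simp_all add: cis_conv_exp D_def)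
  have eq: "(\<integral>x. ?e x * D k x \<partial>lborel)
     = ((1 / s k) *\<^sub>R (cis (- (2 * pi * (\<xi> \<bullet> b)) * s k) - 1)) * fourier f \<xi>" for k
  proof -
    have int: "integrable lborel (\<lambda>x. ?e x * f x)"
      by (intro integrable_cis_mult schwartz_integrable f) measurable
    have c: "?e x = cis (- (2 * pi * (\<xi> \<bullet> b)) * s k) * cis (2 * pi * (\<xi> \<bullet> (x + s k *\<^sub>R b)))" for x
      by (simp add: cis_mult inner_add_right algebra_simps)
    have int': "integrable lborel (\<lambda>x. cis (- (2 * pi * (\<xi> \<bullet> b)) * s k) * (cis (2 * pi * (\<xi> \<bullet> (x + s k *\<^sub>R b))) * f (x + s k *\<^sub>R b)))"
      using lborel_integrable_shift[OF int, of "s k *\<^sub>R b"] by (rule integrable_mult_right)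
    have "(\<integral>x. ?e x * D k x \<partial>lborel)
      = (\<integral>x. (1 / s k) *\<^sub>R (cis (- (2 * pi * (\<xi> \<bullet> b)) * s k) * (cis (2 * pi * (\<xi> \<bullet> (x + s k *\<^sub>R b))) * f (x + s k *\<^sub>R b))
           - ?e x * f x) \<partial>lborel)"
      unfolding mult.assoc[symmetric] c[symmetric] D_def by (simp only: mult_scaleR_right right_diff_distrib)
    also have "\<dots> = (1 / s k) *\<^sub>R (cis (- (2 * pi * (\<xi> \<bullet> b)) * s k) * (\<integral>x. cis (2 * pi * (\<xi> \<bullet> (x + s k *\<^sub>R b))) * f (x + s k *\<^sub>R b) \<partial>lborel)
           - fourier f \<xi>)"
      unfolding fourier_def using int int' by simp
    also have "(\<integral>x. cis (2 * pi * (\<xi> \<bullet> (x + s k *\<^sub>R b))) * f (x + s k *\<^sub>R b) \<partial>lborel) = fourier f \<xi>"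
      unfolding fourier_def
      by (rule lborel_integral_shift[where f="\<lambda>x. ?e x * f x"]) (simp add: cis_conv_exp)
    finally show ?thesis by (simp add: algebra_simps)
  qed
  have lim2: "(\<lambda>k. ((1 / s k) *\<^sub>R (cis (- (2 * pi * (\<xi> \<bullet> b)) * s k) - 1)) * fourier f \<xi>)
     \<longlonglongrightarrow> - (2 * pi * \<i> * (\<xi> \<bullet> b)) * fourier f \<xi>"
  proof (rule tendsto_mult[OF _ tendsto_const])
    define c where "c = - (2 * pi * (\<xi> \<bullet> b))"
    have "((\<lambda>h. cis (c * h)) has_vector_derivative \<i> * c) (at 0)"
      using exp_scaleR_has_vector_derivative_right[of "\<i> * c" 0 UNIV]
      by (simp add: cis_conv_exp scaleR_conv_of_real mult_ac)
    from filterlim_compose[OF vector_derivative_difference_quotient[OF this] s0']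
    show "(\<lambda>k. (1 / s k) *\<^sub>R (cis (- (2 * pi * (\<xi> \<bullet> b)) * s k) - 1)) \<longlonglongrightarrow> - (2 * pi * \<i> * (\<xi> \<bullet> b))"
      unfolding c_def by (simp add: mult_ac)
  qed
  show ?thesis
    unfolding f'_def[symmetric] fourier_def[of f'] by (rule LIMSEQ_unique[OF lim1 lim2[folded eq]])
qed

lemma fourier_partial_deriv_power:
  fixes f :: "'a::euclidean_space \<Rightarrow> complex"
  assumes f: "schwartz f" and b: "b \<in> Basis"
  shows "fourier (partial_deriv (replicate k b) f) \<xi> = (- (2 * pi * \<i> * (\<xi> \<bullet> b))) ^ k * fourier f \<xi>"
proof (induction k)
  case 0
  show ?case by simp
next
  case (Suc k)
  let ?g = "partial_deriv (replicate k b) f"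
  have g: "schwartz ?g"
    using b by (intro schwartz_partial_deriv[OF f]) (simp add: set_replicate_conv_if)
  have "partial_deriv (replicate (Suc k) b) f = partial_deriv [b] ?g"
    by simp
  then have "fourier (partial_deriv (replicate (Suc k) b) f) \<xi> = - (2 * pi * \<i> * (\<xi> \<bullet> b)) * fourier ?g \<xi>"
    by (simp only: fourier_partial_deriv[OF g b])
  then show ?case
    by (simp only: Suc power_Suc mult.assoc)
qed

lemma norm_power_le_sum_Basis:
  fixes x :: "'a::euclidean_space"
  shows "norm x ^ k \<le> real DIM('a) ^ k * (\<Sum>b\<in>Basis. \<bar>x \<bullet> b\<bar> ^ k)"
proof -
  define M where "M = Max ((\<lambda>b. \<bar>x \<bullet> b\<bar>) ` Basis)"
  have "M \<in> (\<lambda>b. \<bar>x \<bullet> b\<bar>) ` Basis" unfolding M_def by (intro Max_in) auto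
  then obtain b where b: "b \<in> Basis" "M = \<bar>x \<bullet> b\<bar>" by auto
  have "norm x \<le> (\<Sum>b\<in>Basis. \<bar>x \<bullet> b\<bar>)" by (rule norm_le_l1)
  also have "\<dots> \<le> (\<Sum>b\<in>(Basis::'a set). M)" by (intro sum_mono) (simp add: M_def)
  finally have "norm x \<le> real DIM('a) * M" by simp
  then have "norm x ^ k \<le> (real DIM('a) * M) ^ k" by (intro power_mono) auto
  also have "\<dots> = real DIM('a) ^ k * \<bar>x \<bullet> b\<bar> ^ k" by (simp add: power_mult_distrib b)
  also have "\<dots> \<le> real DIM('a) ^ k * (\<Sum>b\<in>Basis. \<bar>x \<bullet> b\<bar> ^ k)"
    using b by (intro mult_left_mono member_le_sum) auto
  finally show ?thesis .
qed

text \<open>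
  The power \<open>norm \<xi> ^ k\<close> is controlled by the powers of the single coordinates of \<open>\<xi>\<close>, and these are,
  up to constants, the Fourier multipliers of the \<open>k\<close>-fold derivatives in the coordinate directions.
\<close>

lemma fourier_decay:
  fixes f :: "'a::euclidean_space \<Rightarrow> complex"
  assumes f: "schwartz f"
  shows "\<exists>C. \<forall>\<xi>. norm \<xi> ^ k * cmod (fourier f \<xi>) \<le> C"
proof -
  define I where "I b = (\<integral>y. cmod (partial_deriv (replicate k b) f y) \<partial>lborel)" for b
  have "norm \<xi> ^ k * cmod (fourier f \<xi>) \<le> real DIM('a) ^ k * (\<Sum>b\<in>Basis. I b)" for \<xi>
  proof -
    have le: "\<bar>\<xi> \<bullet> b\<bar> ^ k * cmod (fourier f \<xi>) \<le> I b" if b: "b \<in> Basis" for b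
    proof -
      have "\<bar>\<xi> \<bullet> b\<bar> * 1 \<le> \<bar>\<xi> \<bullet> b\<bar> * (2 * pi)"
        using pi_gt3 by (intro mult_left_mono) auto
      then have "\<bar>\<xi> \<bullet> b\<bar> ^ k * cmod (fourier f \<xi>) \<le> (2 * pi * \<bar>\<xi> \<bullet> b\<bar>) ^ k * cmod (fourier f \<xi>)"
        by (intro mult_right_mono power_mono) (auto simp: mult_ac)
      also have "\<dots> = cmod (fourier (partial_deriv (replicate k b) f) \<xi>)"
        unfolding fourier_partial_deriv_power[OF f b] by (simp add: norm_mult norm_power)
      also have "\<dots> \<le> I b" unfolding I_def by (rule norm_fourier_le)
      finally show ?thesis .
    qed
    have "norm \<xi> ^ k * cmod (fourier f \<xi>) \<le> (real DIM('a) ^ k * (\<Sum>b\<in>Basis. \<bar>\<xi> \<bullet> b\<bar> ^ k)) * cmod (fourier f \<xi>)"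
      by (intro mult_right_mono norm_power_le_sum_Basis) auto
    also have "\<dots> = real DIM('a) ^ k * (\<Sum>b\<in>Basis. \<bar>\<xi> \<bullet> b\<bar> ^ k * cmod (fourier f \<xi>))"
      by (simp add: sum_distrib_right mult.assoc)
    also have "\<dots> \<le> real DIM('a) ^ k * (\<Sum>b\<in>Basis. I b)"
      by (intro mult_left_mono sum_mono le) auto
    finally show ?thesis .
  qed
  then show ?thesis by blast
qed

lemma isCont_fourier:
  fixes f :: "'a::euclidean_space \<Rightarrow> complex"
  assumes f: "integrable lborel f"
  shows "isCont (fourier f) \<xi>"
  unfolding continuous_at_sequentially o_def
proof (intro allI impI)
  fix X :: "nat \<Rightarrow> 'a" assume X: "X \<longlonglongrightarrow> \<xi>"
  have [measurable]: "f \<in> borel_measurable borel" using f by simp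
  show "(\<lambda>n. fourier f (X n)) \<longlonglongrightarrow> fourier f \<xi>"
    unfolding fourier_def
  proof (rule integral_dominated_convergence[where w="\<lambda>x. cmod (f x)"])
    show "AE x in lborel. (\<lambda>n. cis (2 * pi * (X n \<bullet> x)) * f x) \<longlonglongrightarrow> cis (2 * pi * (\<xi> \<bullet> x)) * f x"
      unfolding cis_conv_exp by (intro AE_I2 tendsto_intros X)
    show "integrable lborel (\<lambda>x. cmod (f x))" using f by simp
  qed (auto simp: norm_mult cis_conv_exp)
qed

lemma powr_norm_le_bracket:
  assumes "0 \<le> \<gamma>" "\<gamma> \<le> real m"
  shows "norm x powr \<gamma> \<le> (1 + (norm x)\<^sup>2) ^ m"
proof (cases "norm x \<le> 1")
  case True
  then have "norm x powr \<gamma> \<le> 1" using assms by (cases "norm x = 0") (auto intro: powr_le1)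
  also have "\<dots> \<le> (1 + (norm x)\<^sup>2) ^ m" by (rule bracket_ge_1)
  finally show ?thesis .
next
  case False
  then have "norm x powr \<gamma> \<le> norm x powr real m" using assms by (intro powr_mono) auto
  also have "\<dots> = norm x ^ m" using False by (intro powr_realpow) auto
  also have "\<dots> \<le> (1 + (norm x)\<^sup>2) ^ m"
  proof (rule power_mono)
    have "norm x * 1 \<le> norm x * norm x" using False by (intro mult_left_mono) auto
    then show "norm x \<le> 1 + (norm x)\<^sup>2" by (simp add: power2_eq_square)
  qed simp
  finally show ?thesis .
qed

lemma fourier_multiplier_bound:
  fixes f :: "'a::euclidean_space \<Rightarrow> complex"
  assumes f: "schwartz f" and \<gamma>: "0 \<le> \<gamma>" "\<gamma> \<le> real DIM('a)"
  obtains C where "C \<ge> 0" "\<And>\<xi>. cmod (norm \<xi> powr \<gamma> *\<^sub>R fourier f \<xi>) \<le> C / (1 + (norm \<xi>)\<^sup>2) ^ DIM('a)"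
proof -
  obtain C where C: "C \<ge> 0" "\<And>\<xi>. cmod (fourier f \<xi>) \<le> C / (1 + (norm \<xi>)\<^sup>2) ^ (DIM('a) + DIM('a))"
    by (rule rapid_decay_bracket[OF fourier_decay[OF f], where m="DIM('a) + DIM('a)"]) (rule that)
  show thesis
  proof (rule that[OF C(1)])
    fix \<xi> :: 'a
    have pos: "0 < (1 + (norm \<xi>)\<^sup>2) ^ DIM('a)" by (intro zero_less_power add_pos_nonneg) auto
    have "cmod (norm \<xi> powr \<gamma> *\<^sub>R fourier f \<xi>) = norm \<xi> powr \<gamma> * cmod (fourier f \<xi>)" by simp
    also have "\<dots> \<le> (1 + (norm \<xi>)\<^sup>2) ^ DIM('a) * (C / (1 + (norm \<xi>)\<^sup>2) ^ (DIM('a) + DIM('a)))"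
      using \<gamma> C pos by (intro mult_mono powr_norm_le_bracket) auto
    also have "\<dots> = C / (1 + (norm \<xi>)\<^sup>2) ^ DIM('a)"
      using pos by (simp add: power_add)
    finally show "cmod (norm \<xi> powr \<gamma> *\<^sub>R fourier f \<xi>) \<le> C / (1 + (norm \<xi>)\<^sup>2) ^ DIM('a)" .
  qed
qed

text \<open>
  These are the hypotheses of the Plancherel identity. The multiplier need not be smooth at the origin,
  so that the product is in general no Schwartz function.
\<close>

lemma
  fixes f :: "'a::euclidean_space \<Rightarrow> complex"
  assumes f: "schwartz f" and \<gamma>: "0 \<le> \<gamma>" "\<gamma> \<le> real DIM('a)"
  shows fourier_multiplier_integrable: "integrable lborel (\<lambda>\<xi>. norm \<xi> powr \<gamma> *\<^sub>R fourier f \<xi>)"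
    and fourier_multiplier_bounded: "\<exists>M. \<forall>\<xi>. cmod (norm \<xi> powr \<gamma> *\<^sub>R fourier f \<xi>) \<le> M"
    and fourier_multiplier_isCont: "AE \<xi> in lborel. isCont (\<lambda>\<xi>. norm \<xi> powr \<gamma> *\<^sub>R fourier f \<xi>) \<xi>"
proof -
  obtain C where C: "C \<ge> 0" "\<And>\<xi>. cmod (norm \<xi> powr \<gamma> *\<^sub>R fourier f \<xi>) \<le> C / (1 + (norm \<xi>)\<^sup>2) ^ DIM('a)"
    by (rule fourier_multiplier_bound[OF assms]) (rule that)
  have [measurable]: "fourier f \<in> borel_measurable borel"
    using isCont_fourier[OF schwartz_integrable[OF f]]
    by (intro borel_measurable_continuous_onI continuous_at_imp_continuous_on) auto
  show "integrable lborel (\<lambda>\<xi>. norm \<xi> powr \<gamma> *\<^sub>R fourier f \<xi>)"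
    by (rule integrable_bracket_bound[OF _ C(2)]) measurable
  show "\<exists>M. \<forall>\<xi>. cmod (norm \<xi> powr \<gamma> *\<^sub>R fourier f \<xi>) \<le> M"
    using C bracket_bound_le[OF C(1)] order_trans by blast
  show "AE \<xi> in lborel. isCont (\<lambda>\<xi>. norm \<xi> powr \<gamma> *\<^sub>R fourier f \<xi>) \<xi>"
    using AE_lborel_singleton[of 0]
  proof eventually_elim
    fix \<xi> :: 'a assume "\<xi> \<noteq> 0"
    then show "isCont (\<lambda>\<xi>. norm \<xi> powr \<gamma> *\<^sub>R fourier f \<xi>) \<xi>"
      by (intro continuous_intros isCont_fourier schwartz_integrable f) auto
  qed
qed

lemma integrable_fourier_schwartz:
  fixes f :: "'a::euclidean_space \<Rightarrow> complex"
  assumes f: "schwartz f"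
  shows "integrable lborel (fourier f)"
proof -
  have [measurable]: "fourier f \<in> borel_measurable borel"
    using isCont_fourier[OF schwartz_integrable[OF f]]
    by (intro borel_measurable_continuous_onI continuous_at_imp_continuous_on) auto
  have "integrable lborel (\<lambda>\<xi>::'a. norm \<xi> powr 0 *\<^sub>R fourier f \<xi>)"
    by (rule fourier_multiplier_integrable[OF f]) auto
  moreover have "AE \<xi> in lborel. norm \<xi> powr 0 *\<^sub>R fourier f \<xi> = fourier f \<xi>"
    using AE_lborel_singleton[of "0::'a"] by eventually_elim simp
  ultimately show ?thesis
    by (subst (asm) integrable_cong_AE) auto
qed

lemma schwartz_fourier_inversion:
  fixes f :: "'a::euclidean_space \<Rightarrow> complex"
  assumes f: "schwartz f"
  shows "inv_fourier (fourier f) x = f x"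
proof -
  obtain C where C: "C \<ge> 0" "\<And>x. cmod (f x) \<le> C / (1 + (norm x)\<^sup>2) ^ 0"
    by (rule schwartz_bracket[OF f, where m=0]) (rule that)
  show ?thesis
    by (rule inv_fourier_fourier[OF schwartz_integrable[OF f] _ schwartz_continuous[OF f] integrable_fourier_schwartz[OF f]])
      (use C in simp)
qed

section \<open>Powers of the norm as heat potentials\<close>

text \<open>
  Up to a constant, \<open>heat_potential a\<close> is the power \<open>norm x powr (2 * a - n)\<close>. As an integral over
  heat kernels it is positive and has values in \<open>ennreal\<close>, so that every computation below is an
  exchange of nonnegative integrals. Negative exponents \<open>a\<close> are included; they produce
  the kernel \<open>norm (x - y) powr (- (n + \<beta>))\<close> of the remainder term.
\<close>

definition heat_potential :: "real \<Rightarrow> 'a::euclidean_space \<Rightarrow> ennreal" where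
  "heat_potential a x = (\<integral>\<^sup>+r\<in>{0<..}. ennreal (heat r x * r powr (a - 1)) \<partial>lborel)"

definition riesz_coeff :: "nat \<Rightarrow> real \<Rightarrow> real" where
  "riesz_coeff d a = Gamma (real d / 2 - a) * pi powr (a - real d / 2)"

lemma heat_potential_measurable [measurable]: "heat_potential a \<in> borel_measurable borel"
  unfolding heat_potential_def[abs_def] by measurable

lemma heat_potential_uminus: "heat_potential a (- x) = heat_potential a x"
  by (simp add: heat_potential_def)

lemma riesz_coeff_pos: "a < real d / 2 \<Longrightarrow> 0 < riesz_coeff d a"
  unfolding riesz_coeff_def by (intro mult_pos_pos Gamma_real_pos) auto

lemma heat_potential_eq:
  fixes x :: "'a::euclidean_space"
  assumes "x \<noteq> 0" "a < real DIM('a) / 2"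
  shows "heat_potential a x = ennreal (riesz_coeff DIM('a) a * norm x powr (2 * a - real DIM('a)))"
  unfolding heat_potential_def riesz_coeff_def by (rule nn_integral_heat_potential[OF assms])

lemma nn_integral_swap_weight:
  fixes F :: "'a::euclidean_space \<Rightarrow> 'b::euclidean_space \<Rightarrow> ennreal"
  assumes [measurable]: "(\<lambda>(x, y). F x y) \<in> borel_measurable (borel \<Otimes>\<^sub>M borel)" "c \<in> borel_measurable borel"
  shows "(\<integral>\<^sup>+x. (\<integral>\<^sup>+y. F x y \<partial>lborel) * c x \<partial>lborel) = (\<integral>\<^sup>+y. (\<integral>\<^sup>+x. F x y * c x \<partial>lborel) \<partial>lborel)"
proof -
  have "(\<integral>\<^sup>+x. (\<integral>\<^sup>+y. F x y \<partial>lborel) * c x \<partial>lborel) = (\<integral>\<^sup>+x. (\<integral>\<^sup>+y. F x y * c x \<partial>lborel) \<partial>lborel)"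
    by (rule nn_integral_cong, rule nn_integral_multc[symmetric]) measurable
  also have "\<dots> = (\<integral>\<^sup>+y. (\<integral>\<^sup>+x. F x y * c x \<partial>lborel) \<partial>lborel)"
    by (rule lborel_pair.Fubini') measurable
  finally show ?thesis .
qed

text \<open>
  By the semigroup property, the heat flow for time \<open>t\<close> shifts the time variable of the potential:
  \<open>r powr (a - 1)\<close> becomes \<open>(\<rho> - t) powr (a - 1)\<close> on \<open>{t<..}\<close>.
\<close>

lemma heat_flow_potential:
  fixes x :: "'a::euclidean_space"
  assumes t: "0 < t"
  shows "(\<integral>\<^sup>+y. ennreal (heat t (x - y)) * heat_potential a y \<partial>lborel)
    = (\<integral>\<^sup>+\<rho>\<in>{t<..}. ennreal (heat \<rho> x * (\<rho> - t) powr (a - 1)) \<partial>lborel)"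
proof -
  define f where "f \<rho> = ennreal (heat \<rho> x * (\<rho> - t) powr (a - 1)) * indicator {t<..} \<rho>" for \<rho>
  have [measurable]: "f \<in> borel_measurable borel" unfolding f_def by measurable
  let ?F = "\<lambda>y r. ennreal (heat r y * r powr (a - 1)) * indicator {0<..} r * ennreal (heat t (x - y))"
  have "(\<integral>\<^sup>+y. ennreal (heat t (x - y)) * heat_potential a y \<partial>lborel) = (\<integral>\<^sup>+y. heat_potential a y * ennreal (heat t (x - y)) \<partial>lborel)"
    by (simp add: mult.commute)
  also have "\<dots> = (\<integral>\<^sup>+r. (\<integral>\<^sup>+y. ?F y r \<partial>lborel) \<partial>lborel)"
    unfolding heat_potential_def by (rule nn_integral_swap_weight) measurable
  also have "\<dots> = (\<integral>\<^sup>+r. f (r + t) \<partial>lborel)"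
  proof (rule nn_integral_cong)
    fix r :: real
    have "(\<integral>\<^sup>+y. ?F y r \<partial>lborel)
      = (\<integral>\<^sup>+y. ennreal (heat t (x - y) * heat r y) * (ennreal (r powr (a - 1)) * indicator {0<..} r) \<partial>lborel)"
      by (simp add: ennreal_mult mult_ac)
    also have "\<dots> = (\<integral>\<^sup>+y. ennreal (heat t (x - y) * heat r y) \<partial>lborel) * (ennreal (r powr (a - 1)) * indicator {0<..} r)"
      by (rule nn_integral_multc) measurable
    also have "\<dots> = f (r + t)"
    proof (cases "0 < r")
      case True
      then show ?thesis
        unfolding nn_integral_heat_mult_heat[OF t True] by (simp add: f_def ennreal_mult add.commute)
    qed (simp add: f_def)
    finally show "(\<integral>\<^sup>+y. ?F y r \<partial>lborel) = f (r + t)" .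
  qed
  also have "\<dots> = (\<integral>\<^sup>+\<rho>. f \<rho> \<partial>lborel)"
    by (rule nn_integral_lborel_shift) measurable
  finally show ?thesis unfolding f_def .
qed

lemma nn_integral_Beta_triangle:
  assumes "0 < a" "0 < b" "0 \<le> C"
  shows "(\<integral>\<^sup>+s. ennreal C * (ennreal ((\<rho> - s) powr (a - 1) * s powr (b - 1)) * indicator {(s, \<rho>). 0 < s \<and> s < \<rho>} (s, \<rho>)) \<partial>lborel)
    = ennreal (Beta a b) * (ennreal (C * \<rho> powr (a + b - 1)) * indicator {0<..} \<rho>)"
proof -
  have "(\<integral>\<^sup>+s. ennreal C * (ennreal ((\<rho> - s) powr (a - 1) * s powr (b - 1)) * indicator {(s, \<rho>). 0 < s \<and> s < \<rho>} (s, \<rho>)) \<partial>lborel)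
    = (\<integral>\<^sup>+s. ennreal C * (ennreal ((\<rho> - s) powr (a - 1) * s powr (b - 1)) * indicator {0<..<\<rho>} s) \<partial>lborel)"
    by (rule nn_integral_cong) (simp add: indicator_def)
  also have "\<dots> = ennreal C * (\<integral>\<^sup>+s\<in>{0<..<\<rho>}. ennreal ((\<rho> - s) powr (a - 1) * s powr (b - 1)) \<partial>lborel)"
    by (rule nn_integral_cmult) measurable
  also have "(\<integral>\<^sup>+s\<in>{0<..<\<rho>}. ennreal ((\<rho> - s) powr (a - 1) * s powr (b - 1)) \<partial>lborel)
    = ennreal (Beta a b * \<rho> powr (a + b - 1)) * indicator {0<..} \<rho>"
    by (cases "0 < \<rho>") (simp_all add: set_nn_integral_Beta[OF assms(1,2)])
  finally show ?thesis
    using assms(3) by (simp add: ennreal_mult'' ennreal_mult' mult_ac)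
qed

text \<open>
  Riesz composition. The outer potential is written as a superposition of heat kernels; each of
  them shifts the inner potential, and the remaining integral over the shift is Euler's Beta integral.
\<close>

lemma heat_potential_convolution:
  fixes x :: "'a::euclidean_space"
  assumes c: "0 < c" and a: "0 < a"
  shows "(\<integral>\<^sup>+y. heat_potential c (x - y) * heat_potential a y \<partial>lborel) = ennreal (Beta a c) * heat_potential (a + c) x"
proof -
  let ?F = "\<lambda>y s. ennreal (heat s (x - y) * s powr (c - 1)) * indicator {0<..} s * heat_potential a y"
  let ?G = "\<lambda>s \<rho>. ennreal (heat \<rho> x) * (ennreal ((\<rho> - s) powr (a - 1) * s powr (c - 1)) * indicator {(s, \<rho>). 0 < s \<and> s < \<rho>} (s, \<rho>))"
  have "(\<integral>\<^sup>+y. heat_potential c (x - y) * heat_potential a y \<partial>lborel) = (\<integral>\<^sup>+s. (\<integral>\<^sup>+y. ?F y s \<partial>lborel) \<partial>lborel)"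
    unfolding heat_potential_def[of c] by (rule nn_integral_swap_weight) measurable
  also have "\<dots> = (\<integral>\<^sup>+s. (\<integral>\<^sup>+\<rho>. ?G s \<rho> \<partial>lborel) \<partial>lborel)"
  proof (rule nn_integral_cong)
    fix s :: real
    let ?c = "ennreal (s powr (c - 1)) * indicator {0<..} s"
    have "(\<integral>\<^sup>+y. ?F y s \<partial>lborel) = (\<integral>\<^sup>+y. (ennreal (heat s (x - y)) * heat_potential a y) * ?c \<partial>lborel)"
      by (simp add: ennreal_mult mult_ac)
    also have "\<dots> = (\<integral>\<^sup>+y. ennreal (heat s (x - y)) * heat_potential a y \<partial>lborel) * ?c"
      by (rule nn_integral_multc) measurable
    also have "\<dots> = (\<integral>\<^sup>+\<rho>\<in>{s<..}. ennreal (heat \<rho> x * (\<rho> - s) powr (a - 1)) \<partial>lborel) * ?c"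
      by (cases "0 < s") (simp_all add: heat_flow_potential)
    also have "\<dots> = (\<integral>\<^sup>+\<rho>. ennreal (heat \<rho> x * (\<rho> - s) powr (a - 1)) * indicator {s<..} \<rho> * ?c \<partial>lborel)"
      by (rule nn_integral_multc[symmetric]) measurable
    also have "\<dots> = (\<integral>\<^sup>+\<rho>. ?G s \<rho> \<partial>lborel)"
      by (rule nn_integral_cong) (simp add: ennreal_mult mult_ac indicator_def)
    finally show "(\<integral>\<^sup>+y. ?F y s \<partial>lborel) = (\<integral>\<^sup>+\<rho>. ?G s \<rho> \<partial>lborel)" .
  qed
  also have "\<dots> = (\<integral>\<^sup>+\<rho>. (\<integral>\<^sup>+s. ?G s \<rho> \<partial>lborel) \<partial>lborel)"
    by (rule lborel_pair.Fubini') measurable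
  also have "\<dots> = (\<integral>\<^sup>+\<rho>. ennreal (Beta a c) * (ennreal (heat \<rho> x * \<rho> powr (a + c - 1)) * indicator {0<..} \<rho>) \<partial>lborel)"
    by (rule nn_integral_cong, rule nn_integral_Beta_triangle[OF a c heat_nonneg])
  also have "\<dots> = ennreal (Beta a c) * heat_potential (a + c) x"
    unfolding heat_potential_def by (rule nn_integral_cmult) measurable
  finally show ?thesis .
qed

section \<open>The heat flow of a potential\<close>

text \<open>
  The ground state is \<open>w = heat_potential a\<close>. Its defect, the difference of \<open>w\<close> and its heat flow for
  time \<open>t\<close>, has to be integrated against \<open>t powr (- 1 - b) dt\<close>. In time variables this defect is
  \<open>\<rho> powr (a - 1) - (\<rho> - t) powr (a - 1)\<close>, which changes sign for \<open>a < 1\<close>. Since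
  \<open>\<rho> * (\<rho> - t) powr (a - 1) = (\<rho> - t) powr a + t * (\<rho> - t) powr (a - 1)\<close>, the two functions share
  the part \<open>flow_common\<close>; what remains, \<open>flow_loss\<close> of \<open>w\<close> and \<open>flow_gain\<close> of the flow, is
  nonnegative, and each of the two time integrals converges separately.
\<close>

definition flow_common :: "real \<Rightarrow> real \<Rightarrow> 'a::euclidean_space \<Rightarrow> ennreal" where
  "flow_common a t x = (\<integral>\<^sup>+\<rho>\<in>{t<..}. ennreal (heat \<rho> x * ((\<rho> - t) powr a / \<rho>)) \<partial>lborel)"

definition flow_loss :: "real \<Rightarrow> real \<Rightarrow> 'a::euclidean_space \<Rightarrow> ennreal" where
  "flow_loss a t x = (\<integral>\<^sup>+\<rho>\<in>{0<..}. ennreal (heat \<rho> x * ((\<rho> powr a - (max 0 (\<rho> - t)) powr a) / \<rho>)) \<partial>lborel)"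

definition flow_gain :: "real \<Rightarrow> real \<Rightarrow> 'a::euclidean_space \<Rightarrow> ennreal" where
  "flow_gain a t x = (\<integral>\<^sup>+\<rho>\<in>{t<..}. ennreal (heat \<rho> x * (t / \<rho> * (\<rho> - t) powr (a - 1))) \<partial>lborel)"

lemma flow_measurable [measurable (raw)]:
  assumes [measurable]: "f \<in> borel_measurable M" "g \<in> M \<rightarrow>\<^sub>M borel"
  shows "(\<lambda>z. flow_common a (f z) (g z)) \<in> borel_measurable M"
    and "(\<lambda>z. flow_loss a (f z) (g z)) \<in> borel_measurable M"
    and "(\<lambda>z. flow_gain a (f z) (g z)) \<in> borel_measurable M"
proof -
  have 1: "(\<integral>\<^sup>+\<rho>\<in>{t<..}. F \<rho> \<partial>lborel) = (\<integral>\<^sup>+\<rho>. F \<rho> * (if t < \<rho> then 1 else 0) \<partial>lborel)" for t and F :: "real \<Rightarrow> ennreal"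
    by (rule nn_integral_cong) (simp add: indicator_def)
  show "(\<lambda>z. flow_common a (f z) (g z)) \<in> borel_measurable M"
    unfolding flow_common_def 1 by measurable
  show "(\<lambda>z. flow_loss a (f z) (g z)) \<in> borel_measurable M"
    unfolding flow_loss_def by measurable
  show "(\<lambda>z. flow_gain a (f z) (g z)) \<in> borel_measurable M"
    unfolding flow_gain_def 1 by measurable
qed

lemma powr_increment_nonneg:
  assumes "0 \<le> a" "0 \<le> t" "0 \<le> (\<rho>::real)"
  shows "0 \<le> \<rho> powr a - (max 0 (\<rho> - t)) powr a"
  using powr_mono2[of a "max 0 (\<rho> - t)" \<rho>] assms by auto

lemma heat_potential_split:
  assumes a: "0 < a" and t: "0 < t"
  shows "heat_potential a x = flow_common a t x + flow_loss a t x"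
proof -
  let ?C = "\<lambda>\<rho>. heat \<rho> x * ((\<rho> - t) powr a / \<rho>)"
  let ?L = "\<lambda>\<rho>. heat \<rho> x * ((\<rho> powr a - (max 0 (\<rho> - t)) powr a) / \<rho>)"
  have "flow_common a t x + flow_loss a t x =
    (\<integral>\<^sup>+\<rho>. ennreal (?C \<rho>) * indicator {t<..} \<rho> + ennreal (?L \<rho>) * indicator {0<..} \<rho> \<partial>lborel)"
    unfolding flow_common_def flow_loss_def by (rule nn_integral_add[symmetric]) measurable
  also have "\<dots> = heat_potential a x"
    unfolding heat_potential_def
  proof (rule nn_integral_cong)
    fix \<rho> :: real
    consider "\<rho> \<le> 0" | "0 < \<rho>" "\<rho> \<le> t" | "t < \<rho>" by linarith
    then show "ennreal (?C \<rho>) * indicator {t<..} \<rho> + ennreal (?L \<rho>) * indicator {0<..} \<rho>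
      = ennreal (heat \<rho> x * \<rho> powr (a - 1)) * indicator {0<..} \<rho>"
    proof cases
      case 1 then show ?thesis using t by simp
    next
      case 2 then show ?thesis using a by (simp add: powr_diff)
    next
      case 3
      have "0 \<le> \<rho> powr a - (max 0 (\<rho> - t)) powr a" using 3 a t by (intro powr_increment_nonneg) auto
      then have "ennreal (?C \<rho>) + ennreal (?L \<rho>) = ennreal (?C \<rho> + ?L \<rho>)"
        using 3 t by (intro ennreal_plus[symmetric]) auto
      also have "?C \<rho> + ?L \<rho> = heat \<rho> x * \<rho> powr (a - 1)"
        using 3 t by (simp add: powr_diff distrib_left[symmetric] add_divide_distrib[symmetric] max_def)
      finally show ?thesis using 3 t by simp
    qed
  qed
  finally show ?thesis ..
qed

lemma heat_flow_potential_split: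
  fixes x :: "'a::euclidean_space"
  assumes t: "0 < t"
  shows "(\<integral>\<^sup>+y. ennreal (heat t (x - y)) * heat_potential a y \<partial>lborel) = flow_common a t x + flow_gain a t x"
proof -
  let ?C = "\<lambda>\<rho>. heat \<rho> x * ((\<rho> - t) powr a / \<rho>)"
  let ?G = "\<lambda>\<rho>. heat \<rho> x * (t / \<rho> * (\<rho> - t) powr (a - 1))"
  have "flow_common a t x + flow_gain a t x =
    (\<integral>\<^sup>+\<rho>. ennreal (?C \<rho>) * indicator {t<..} \<rho> + ennreal (?G \<rho>) * indicator {t<..} \<rho> \<partial>lborel)"
    unfolding flow_common_def flow_gain_def by (rule nn_integral_add[symmetric]) measurable
  also have "\<dots> = (\<integral>\<^sup>+\<rho>\<in>{t<..}. ennreal (heat \<rho> x * (\<rho> - t) powr (a - 1)) \<partial>lborel)"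
  proof (rule nn_integral_cong)
    fix \<rho> :: real
    show "ennreal (?C \<rho>) * indicator {t<..} \<rho> + ennreal (?G \<rho>) * indicator {t<..} \<rho>
      = ennreal (heat \<rho> x * (\<rho> - t) powr (a - 1)) * indicator {t<..} \<rho>"
    proof (cases "t < \<rho>")
      case True
      have p: "(\<rho> - t) powr a = (\<rho> - t) * (\<rho> - t) powr (a - 1)"
        using True by (simp add: powr_mult_base)
      have "(\<rho> - t) powr a / \<rho> + t / \<rho> * (\<rho> - t) powr (a - 1) = (\<rho> - t) powr (a - 1)"
        unfolding p using True t by (simp add: field_simps)
      then have "?C \<rho> + ?G \<rho> = heat \<rho> x * (\<rho> - t) powr (a - 1)"
        by (simp only: distrib_left[symmetric])
      then show ?thesis using True t by (simp add: ennreal_plus[symmetric] del: ennreal_plus)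
    qed simp
  qed
  finally show ?thesis unfolding heat_flow_potential[OF t] ..
qed

text \<open>Both time integrals scale like \<open>\<rho> powr (a - b - 1)\<close> and hence reproduce a potential.\<close>

lemma nn_integral_flow_loss:
  assumes a: "0 < a" and b: "0 < b" "b < 1"
  shows "(\<integral>\<^sup>+t\<in>{0<..}. flow_loss a t x * ennreal (t powr (- 1 - b)) \<partial>lborel)
    = ennreal (a / b * Beta a (1 - b)) * heat_potential (a - b) x"
proof -
  let ?d = "\<lambda>t \<rho>. \<rho> powr a - (max 0 (\<rho> - t)) powr a"
  let ?T = "\<lambda>t. ennreal (t powr (- 1 - b)) * indicator {0<..} t"
  let ?F = "\<lambda>t \<rho>. ennreal (heat \<rho> x * (?d t \<rho> / \<rho>)) * indicator {0<..} \<rho>"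
  have "(\<integral>\<^sup>+t\<in>{0<..}. flow_loss a t x * ennreal (t powr (- 1 - b)) \<partial>lborel) = (\<integral>\<^sup>+t. flow_loss a t x * ?T t \<partial>lborel)"
    by (simp add: mult.assoc)
  also have "\<dots> = (\<integral>\<^sup>+\<rho>. (\<integral>\<^sup>+t. ?F t \<rho> * ?T t \<partial>lborel) \<partial>lborel)"
    unfolding flow_loss_def by (rule nn_integral_swap_weight) measurable
  also have "\<dots> = (\<integral>\<^sup>+\<rho>. ennreal (a / b * Beta a (1 - b)) * (ennreal (heat \<rho> x * \<rho> powr (a - b - 1)) * indicator {0<..} \<rho>) \<partial>lborel)"
  proof (rule nn_integral_cong)
    fix \<rho> :: real
    show "(\<integral>\<^sup>+t. ?F t \<rho> * ?T t \<partial>lborel)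
      = ennreal (a / b * Beta a (1 - b)) * (ennreal (heat \<rho> x * \<rho> powr (a - b - 1)) * indicator {0<..} \<rho>)"
    proof (cases "0 < \<rho>")
      case True
      have "(\<integral>\<^sup>+t. ?F t \<rho> * ?T t \<partial>lborel)
        = (\<integral>\<^sup>+t. ennreal (heat \<rho> x / \<rho>) * (ennreal (?d t \<rho> * t powr (- 1 - b)) * indicator {0<..} t) \<partial>lborel)"
      proof (rule nn_integral_cong)
        fix t :: real
        have "heat \<rho> x * (?d t \<rho> / \<rho>) * t powr (- 1 - b) = heat \<rho> x / \<rho> * (?d t \<rho> * t powr (- 1 - b))" by simp
        then show "?F t \<rho> * ?T t = ennreal (heat \<rho> x / \<rho>) * (ennreal (?d t \<rho> * t powr (- 1 - b)) * indicator {0<..} t)"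
          using True by (cases "0 < t") (simp_all only: indicator_simps greaterThan_iff mult_1_right mult_zero_right not_False_eq_True
            ennreal_mult''[OF powr_ge_zero, symmetric] ennreal_mult'[OF divide_nonneg_pos[OF heat_nonneg True], symmetric] mult.assoc[symmetric])
      qed
      also have "\<dots> = ennreal (heat \<rho> x / \<rho>) * (\<integral>\<^sup>+t\<in>{0<..}. ennreal (?d t \<rho> * t powr (- 1 - b)) \<partial>lborel)"
        by (rule nn_integral_cmult) measurable
      also have "\<dots> = ennreal (heat \<rho> x / \<rho>) * ennreal (a / b * Beta a (1 - b) * \<rho> powr (a - b))"
        unfolding set_nn_integral_powr_increment_powr[OF a b True] ..
      also have "\<dots> = ennreal (a / b * Beta a (1 - b)) * ennreal (heat \<rho> x * \<rho> powr (a - b - 1))"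
        using True a b by (simp add: ennreal_mult'[symmetric] ennreal_mult''[symmetric] powr_diff mult_ac)
      finally show ?thesis using True by simp
    qed simp
  qed
  also have "\<dots> = ennreal (a / b * Beta a (1 - b)) * heat_potential (a - b) x"
    unfolding heat_potential_def by (rule nn_integral_cmult) measurable
  finally show ?thesis .
qed

lemma nn_integral_flow_gain:
  assumes a: "0 < a" and b: "b < 1"
  shows "(\<integral>\<^sup>+t\<in>{0<..}. flow_gain a t x * ennreal (t powr (- 1 - b)) \<partial>lborel)
    = ennreal (Beta a (1 - b)) * heat_potential (a - b) x"
proof -
  let ?T = "\<lambda>t. ennreal (t powr (- 1 - b)) * indicator {0<..} t"
  let ?F = "\<lambda>t \<rho>. ennreal (heat \<rho> x * (t / \<rho> * (\<rho> - t) powr (a - 1))) * (if t < \<rho> then 1 else 0)"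
  have gain: "flow_gain a t x = (\<integral>\<^sup>+\<rho>. ?F t \<rho> \<partial>lborel)" for t
    unfolding flow_gain_def by (rule nn_integral_cong) (simp add: indicator_def)
  have "(\<integral>\<^sup>+t\<in>{0<..}. flow_gain a t x * ennreal (t powr (- 1 - b)) \<partial>lborel) = (\<integral>\<^sup>+t. flow_gain a t x * ?T t \<partial>lborel)"
    by (simp add: mult.assoc)
  also have "\<dots> = (\<integral>\<^sup>+\<rho>. (\<integral>\<^sup>+t. ?F t \<rho> * ?T t \<partial>lborel) \<partial>lborel)"
    unfolding gain by (rule nn_integral_swap_weight) measurable
  also have "\<dots> = (\<integral>\<^sup>+\<rho>. ennreal (Beta a (1 - b)) * (ennreal (heat \<rho> x * \<rho> powr (a - b - 1)) * indicator {0<..} \<rho>) \<partial>lborel)"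
  proof (rule nn_integral_cong)
    fix \<rho> :: real
    let ?G = "\<lambda>t. ennreal \<bar>heat \<rho> x / \<rho>\<bar> * (ennreal ((\<rho> - t) powr (a - 1) * t powr ((1 - b) - 1)) * indicator {(t, \<rho>). 0 < t \<and> t < \<rho>} (t, \<rho>))"
    have "(\<integral>\<^sup>+t. ?F t \<rho> * ?T t \<partial>lborel) = (\<integral>\<^sup>+t. ?G t \<partial>lborel)"
    proof (rule nn_integral_cong)
      fix t :: real
      show "?F t \<rho> * ?T t = ?G t"
      proof (cases "0 < t \<and> t < \<rho>")
        case True
        have "t powr ((1 - b) - 1) = t * t powr (- 1 - b)" using True by (simp add: powr_mult_base)
        then have "heat \<rho> x * (t / \<rho> * (\<rho> - t) powr (a - 1)) * t powr (- 1 - b) = heat \<rho> x / \<rho> * ((\<rho> - t) powr (a - 1) * t powr ((1 - b) - 1))"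
          by simp
        then show ?thesis
          using True by (simp add: ennreal_mult'[symmetric] ennreal_mult''[symmetric])
      qed (auto simp: indicator_def)
    qed
    also have "\<dots> = ennreal (Beta a (1 - b)) * (ennreal (\<bar>heat \<rho> x / \<rho>\<bar> * \<rho> powr (a + (1 - b) - 1)) * indicator {0<..} \<rho>)"
      using a b by (intro nn_integral_Beta_triangle) auto
    also have "\<dots> = ennreal (Beta a (1 - b)) * (ennreal (heat \<rho> x * \<rho> powr (a - b - 1)) * indicator {0<..} \<rho>)"
      by (cases "0 < \<rho>") (simp_all add: powr_diff mult.commute)
    finally show "(\<integral>\<^sup>+t. ?F t \<rho> * ?T t \<partial>lborel)
      = ennreal (Beta a (1 - b)) * (ennreal (heat \<rho> x * \<rho> powr (a - b - 1)) * indicator {0<..} \<rho>)" .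
  qed
  also have "\<dots> = ennreal (Beta a (1 - b)) * heat_potential (a - b) x"
    unfolding heat_potential_def by (rule nn_integral_cmult) measurable
  finally show ?thesis .
qed

section \<open>The ground state representation\<close>

text \<open>
  The substitution \<open>h = w g\<close> at two points, with \<open>u = w x\<close> and \<open>v = w y\<close>: the cross terms of both
  squares are \<open>- 2 u v (p \<bullet> q)\<close>, so that the difference consists of diagonal terms only.
\<close>

lemma ground_state_pointwise:
  fixes p q :: complex
  assumes "0 < u" "0 < v"
  shows "(cmod (u *\<^sub>R p - v *\<^sub>R q))\<^sup>2 + (cmod (u *\<^sub>R p))\<^sup>2 * (v / u) + (cmod (v *\<^sub>R q))\<^sup>2 * (u / v)
    = (cmod (p - q))\<^sup>2 * u * v + (cmod (u *\<^sub>R p))\<^sup>2 + (cmod (v *\<^sub>R q))\<^sup>2"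
proof -
  define P Q R where "P = p \<bullet> p" and "Q = q \<bullet> q" and "R = p \<bullet> q"
  have 1: "(cmod (u *\<^sub>R p - v *\<^sub>R q))\<^sup>2 = u * u * P - 2 * u * v * R + v * v * Q"
    unfolding power2_norm_eq_inner P_def Q_def R_def
    by (simp add: inner_diff_left inner_diff_right inner_commute algebra_simps)
  have 2: "(cmod (p - q))\<^sup>2 = P - 2 * R + Q"
    unfolding power2_norm_eq_inner P_def Q_def R_def
    by (simp add: inner_diff_left inner_diff_right inner_commute algebra_simps)
  have 3: "(cmod (u *\<^sub>R p))\<^sup>2 = u * u * P" "(cmod (v *\<^sub>R q))\<^sup>2 = v * v * Q"
    unfolding power2_norm_eq_inner P_def Q_def R_def by simp_all
  show ?thesis unfolding 1 2 3 using assms by (simp add: field_simps)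
qed

lemma nn_integral_heat_marginal:
  fixes F :: "'a::euclidean_space \<Rightarrow> real"
  assumes t: "0 < t" and [measurable]: "F \<in> borel_measurable borel" and F: "\<And>x. 0 \<le> F x"
  shows "(\<integral>\<^sup>+x. (\<integral>\<^sup>+y. ennreal (F x * heat t (x - y)) \<partial>lborel) \<partial>lborel) = (\<integral>\<^sup>+x. ennreal (F x) \<partial>lborel)"
proof (rule nn_integral_cong)
  fix x :: 'a
  have "(\<integral>\<^sup>+y. ennreal (F x * heat t (x - y)) \<partial>lborel) = (\<integral>\<^sup>+y. ennreal (F x) * ennreal (heat t (x - y)) \<partial>lborel)"
    using F by (simp add: ennreal_mult)
  also have "\<dots> = ennreal (F x) * (\<integral>\<^sup>+y. ennreal (heat t (x - y)) \<partial>lborel)"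
    by (rule nn_integral_cmult) measurable
  also have "(\<integral>\<^sup>+y. ennreal (heat t (x - y)) \<partial>lborel) = (\<integral>\<^sup>+y. ennreal (heat t (y::'a)) \<partial>lborel)"
    by (rule nn_integral_lborel_reflect) measurable
  also have "\<dots> = 1" using nn_integral_heat[OF t] by simp
  finally show "(\<integral>\<^sup>+y. ennreal (F x * heat t (x - y)) \<partial>lborel) = ennreal (F x)" by simp
qed

lemma nn_integral_add3:
  assumes [measurable]: "f \<in> borel_measurable M" "g \<in> borel_measurable M" "h \<in> borel_measurable M"
  shows "(\<integral>\<^sup>+x. f x + g x + h x \<partial>M) = (\<integral>\<^sup>+x. f x \<partial>M) + (\<integral>\<^sup>+x. g x \<partial>M) + (\<integral>\<^sup>+x. h x \<partial>M)"
  by (simp add: nn_integral_add)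

lemma nn_integral_iterated_add3:
  fixes f g h :: "'a::euclidean_space \<Rightarrow> 'a \<Rightarrow> ennreal"
  assumes [measurable]: "(\<lambda>(x, y). f x y) \<in> borel_measurable (borel \<Otimes>\<^sub>M borel)"
    "(\<lambda>(x, y). g x y) \<in> borel_measurable (borel \<Otimes>\<^sub>M borel)"
    "(\<lambda>(x, y). h x y) \<in> borel_measurable (borel \<Otimes>\<^sub>M borel)"
  shows "(\<integral>\<^sup>+x. (\<integral>\<^sup>+y. f x y + g x y + h x y \<partial>lborel) \<partial>lborel)
    = (\<integral>\<^sup>+x. (\<integral>\<^sup>+y. f x y \<partial>lborel) \<partial>lborel) + (\<integral>\<^sup>+x. (\<integral>\<^sup>+y. g x y \<partial>lborel) \<partial>lborel)
      + (\<integral>\<^sup>+x. (\<integral>\<^sup>+y. h x y \<partial>lborel) \<partial>lborel)"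
proof -
  have "(\<integral>\<^sup>+x. (\<integral>\<^sup>+y. f x y + g x y + h x y \<partial>lborel) \<partial>lborel)
    = (\<integral>\<^sup>+x. (\<integral>\<^sup>+y. f x y \<partial>lborel) + (\<integral>\<^sup>+y. g x y \<partial>lborel) + (\<integral>\<^sup>+y. h x y \<partial>lborel) \<partial>lborel)"
    by (rule nn_integral_cong, rule nn_integral_add3) measurable
  also have "\<dots> = (\<integral>\<^sup>+x. (\<integral>\<^sup>+y. f x y \<partial>lborel) \<partial>lborel) + (\<integral>\<^sup>+x. (\<integral>\<^sup>+y. g x y \<partial>lborel) \<partial>lborel)
      + (\<integral>\<^sup>+x. (\<integral>\<^sup>+y. h x y \<partial>lborel) \<partial>lborel)"
    by (rule nn_integral_add3) measurable
  finally show ?thesis .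
qed

text \<open>
  Integrating the pointwise identity against \<open>heat t (x - y)\<close>, the terms with \<open>w y / w x\<close> produce the
  heat flow of \<open>w\<close> divided by \<open>w\<close>, and the remaining diagonal terms produce the square integral of
  \<open>h\<close>. Both contain the integral of \<open>\<phi> x * flow_common a t x\<close>; it is bounded by the square integral of
  \<open>h\<close> and can therefore be cancelled. The function \<open>\<phi>\<close> is \<open>|h|\<^sup>2 / w\<close> with \<open>w\<close> normalised as
  \<open>heat_potential a\<close>.
\<close>

lemma ground_state_flow:
  fixes h g :: "'a::euclidean_space \<Rightarrow> complex"
  defines "d \<equiv> real DIM('a)"
  assumes [measurable]: "h \<in> borel_measurable borel"
    and t: "0 < t" and \<beta>: "0 < \<beta>" "\<beta> < d"
    and g: "g = (\<lambda>x. norm x powr ((d - \<beta>) / 2) *\<^sub>R h x)"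
    and L2: "(\<integral>\<^sup>+x. ennreal ((cmod (h x))\<^sup>2) \<partial>lborel) < \<infinity>"
  defines "a \<equiv> (d + \<beta>) / 4"
  defines "w \<equiv> (\<lambda>x::'a. norm x powr (- ((d - \<beta>) / 2)))"
  defines "\<phi> \<equiv> (\<lambda>x. (cmod (h x))\<^sup>2 / (riesz_coeff DIM('a) a * w x))"
  shows "(\<integral>\<^sup>+x. (\<integral>\<^sup>+y. ennreal ((cmod (h x - h y))\<^sup>2 * heat t (x - y)) \<partial>lborel) \<partial>lborel)
      + 2 * (\<integral>\<^sup>+x. ennreal (\<phi> x) * flow_gain a t x \<partial>lborel)
    = (\<integral>\<^sup>+x. (\<integral>\<^sup>+y. ennreal ((cmod (g x - g y))\<^sup>2 * w x * w y * heat t (x - y)) \<partial>lborel) \<partial>lborel)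
      + 2 * (\<integral>\<^sup>+x. ennreal (\<phi> x) * flow_loss a t x \<partial>lborel)"
proof -
  define k where "k = riesz_coeff DIM('a) a"
  have a: "0 < a" "a < d / 2" using \<beta> by (auto simp: a_def)
  have k: "0 < k" unfolding k_def using a by (intro riesz_coeff_pos) (simp add: d_def)
  have w: "0 < w x" if "x \<noteq> 0" for x using that by (simp add: w_def)
  have \<phi>0: "0 \<le> \<phi> x" for x unfolding \<phi>_def k_def[symmetric] using k by (simp add: w_def)
  have [measurable]: "g \<in> borel_measurable borel" unfolding g by measurable
  have [measurable]: "w \<in> borel_measurable borel" unfolding w_def by measurable
  have [measurable]: "\<phi> \<in> borel_measurable borel" unfolding \<phi>_def by measurable
  let ?E = "\<lambda>x y. ennreal ((cmod (h x - h y))\<^sup>2 * heat t (x - y))"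
  let ?R = "\<lambda>x y. ennreal ((cmod (g x - g y))\<^sup>2 * w x * w y * heat t (x - y))"
  let ?U = "\<lambda>x y. ennreal ((cmod (h x))\<^sup>2 * heat t (x - y))"
  let ?V = "\<lambda>x y. ennreal ((cmod (h y))\<^sup>2 * heat t (x - y))"
  have pot: "heat_potential a x = ennreal (k * w x)" if "x \<noteq> 0" for x :: 'a
  proof -
    have "2 * a - d = - ((d - \<beta>) / 2)" by (simp add: a_def field_simps)
    with heat_potential_eq[OF that, of a] a show ?thesis
      unfolding k_def w_def by (simp add: d_def)
  qed
  have gh: "h x = w x *\<^sub>R g x" if "x \<noteq> 0" for x
    using that by (simp add: g w_def powr_add[symmetric])
  have pw: "(cmod (h x - h y))\<^sup>2 + (cmod (h x))\<^sup>2 * (w y / w x) + (cmod (h y))\<^sup>2 * (w x / w y)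
    = (cmod (g x - g y))\<^sup>2 * w x * w y + (cmod (h x))\<^sup>2 + (cmod (h y))\<^sup>2" if "x \<noteq> 0" "y \<noteq> 0" for x y
    unfolding gh[OF that(1)] gh[OF that(2)] by (rule ground_state_pointwise) (use w that in auto)
  let ?A = "\<lambda>x y. ennreal (\<phi> x * heat t (x - y)) * heat_potential a y"
  define E where "E = (\<integral>\<^sup>+x. (\<integral>\<^sup>+y. ?E x y \<partial>lborel) \<partial>lborel)"
  define R where "R = (\<integral>\<^sup>+x. (\<integral>\<^sup>+y. ?R x y \<partial>lborel) \<partial>lborel)"
  define C where "C = (\<integral>\<^sup>+x. ennreal (\<phi> x) * flow_common a t x \<partial>lborel)"
  define G where "G = (\<integral>\<^sup>+x. ennreal (\<phi> x) * flow_gain a t x \<partial>lborel)"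
  define L where "L = (\<integral>\<^sup>+x. ennreal (\<phi> x) * flow_loss a t x \<partial>lborel)"
  define I where "I = (\<integral>\<^sup>+x. ennreal ((cmod (h x))\<^sup>2) \<partial>lborel)"
  have A1: "(\<integral>\<^sup>+x. (\<integral>\<^sup>+y. ?A x y \<partial>lborel) \<partial>lborel) = C + G"
  proof -
    have "(\<integral>\<^sup>+y. ?A x y \<partial>lborel) = ennreal (\<phi> x) * flow_common a t x + ennreal (\<phi> x) * flow_gain a t x" for x
    proof -
      have "(\<integral>\<^sup>+y. ?A x y \<partial>lborel) = (\<integral>\<^sup>+y. ennreal (\<phi> x) * (ennreal (heat t (x - y)) * heat_potential a y) \<partial>lborel)"
        using \<phi>0 by (simp add: ennreal_mult mult.assoc)
      also have "\<dots> = ennreal (\<phi> x) * (\<integral>\<^sup>+y. ennreal (heat t (x - y)) * heat_potential a y \<partial>lborel)"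
        by (rule nn_integral_cmult) measurable
      finally show ?thesis
        unfolding heat_flow_potential_split[OF t] by (simp add: distrib_left)
    qed
    then show ?thesis unfolding C_def G_def by (simp add: nn_integral_add)
  qed
  have A2: "(\<integral>\<^sup>+x. (\<integral>\<^sup>+y. ?A y x \<partial>lborel) \<partial>lborel) = C + G"
    unfolding A1[symmetric] by (rule lborel_pair.Fubini') measurable
  have I1: "(\<integral>\<^sup>+x. (\<integral>\<^sup>+y. ?U x y \<partial>lborel) \<partial>lborel) = I"
    unfolding I_def by (rule nn_integral_heat_marginal[OF t]) auto
  have I2: "(\<integral>\<^sup>+x. (\<integral>\<^sup>+y. ?V x y \<partial>lborel) \<partial>lborel) = I"
  proof -
    have "(\<integral>\<^sup>+x. (\<integral>\<^sup>+y. ?V x y \<partial>lborel) \<partial>lborel)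
      = (\<integral>\<^sup>+y. (\<integral>\<^sup>+x. ?V x y \<partial>lborel) \<partial>lborel)"
      by (rule lborel_pair.Fubini'[symmetric]) measurable
    also have "\<dots> = I" unfolding I1[symmetric] by (simp add: heat_minus_commute)
    finally show ?thesis .
  qed
  have "E + (C + G) + (C + G) = R + I + I"
  proof -
    have "E + (C + G) + (C + G) = (\<integral>\<^sup>+x. (\<integral>\<^sup>+y. ?E x y + ?A x y + ?A y x \<partial>lborel) \<partial>lborel)"
      unfolding E_def A1[symmetric] unfolding A1 A2[symmetric] unfolding A2
      by (subst nn_integral_iterated_add3) (simp_all add: A1 A2)
    also have "\<dots> = (\<integral>\<^sup>+x. (\<integral>\<^sup>+y. ?R x y
       + ?U x y + ?V x y \<partial>lborel) \<partial>lborel)"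
      using AE_lborel_singleton[of "0::'a"]
    proof (rule nn_integral_cong_AE[OF eventually_mono])
      fix x :: 'a assume x: "x \<noteq> 0"
      show "(\<integral>\<^sup>+y. ?E x y + ?A x y + ?A y x \<partial>lborel)
        = (\<integral>\<^sup>+y. ?R x y
       + ?U x y + ?V x y \<partial>lborel)"
        using AE_lborel_singleton[of "0::'a"]
      proof (rule nn_integral_cong_AE[OF eventually_mono])
        fix y :: 'a assume y: "y \<noteq> 0"
        have wx: "0 < w x" "0 < w y" using w x y by auto
        have Axy: "?A x y = ennreal ((cmod (h x))\<^sup>2 * (w y / w x) * heat t (x - y))"
          unfolding pot[OF y] \<phi>_def k_def[symmetric] using k wx by (simp add: ennreal_mult''[symmetric] field_simps)
        have Ayx: "?A y x = ennreal ((cmod (h y))\<^sup>2 * (w x / w y) * heat t (x - y))"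
          unfolding pot[OF x] \<phi>_def k_def[symmetric] heat_minus_commute[of t y x]
          using k wx by (simp add: ennreal_mult''[symmetric] field_simps)
        have "?E x y + ?A x y + ?A y x
          = ennreal (((cmod (h x - h y))\<^sup>2 + (cmod (h x))\<^sup>2 * (w y / w x) + (cmod (h y))\<^sup>2 * (w x / w y)) * heat t (x - y))"
          unfolding Axy Ayx distrib_right using wx by (simp add: ennreal_plus)
        also have "\<dots> = ennreal (((cmod (g x - g y))\<^sup>2 * w x * w y + (cmod (h x))\<^sup>2 + (cmod (h y))\<^sup>2) * heat t (x - y))"
          unfolding pw[OF x y] ..
        also have "\<dots> = ?R x y
          + ?U x y + ?V x y"
          unfolding distrib_right using wx by (simp add: ennreal_plus)
        finally show "?E x y + ?A x y + ?A y x
          = ?R x y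
          + ?U x y + ?V x y" .
      qed
    qed
    also have "\<dots> = R + I + I"
      by (subst nn_integral_iterated_add3) (simp_all add: I1 I2 R_def)
    finally show ?thesis .
  qed
  moreover have ICL: "I = C + L"
  proof -
    have "C + L = (\<integral>\<^sup>+x. ennreal (\<phi> x) * flow_common a t x + ennreal (\<phi> x) * flow_loss a t x \<partial>lborel)"
      unfolding C_def L_def by (rule nn_integral_add[symmetric]) measurable
    also have "\<dots> = I"
      unfolding I_def using AE_lborel_singleton[of "0::'a"]
    proof (rule nn_integral_cong_AE[OF eventually_mono])
      fix x :: 'a assume x: "x \<noteq> 0"
      have "ennreal (\<phi> x) * flow_common a t x + ennreal (\<phi> x) * flow_loss a t x = ennreal (\<phi> x) * heat_potential a x"
        unfolding heat_potential_split[OF a(1) t] by (simp add: distrib_left)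
      also have "\<dots> = ennreal ((cmod (h x))\<^sup>2)"
        unfolding pot[OF x] \<phi>_def k_def[symmetric] using k w[OF x] by (simp add: ennreal_mult''[symmetric])
      finally show "ennreal (\<phi> x) * flow_common a t x + ennreal (\<phi> x) * flow_loss a t x = ennreal ((cmod (h x))\<^sup>2)" .
    qed
    finally show ?thesis ..
  qed
  moreover have Cfin: "C \<noteq> \<infinity>"
  proof -
    have "C \<le> I" unfolding ICL by simp
    then show ?thesis using L2 unfolding I_def[symmetric] by auto
  qed
  ultimately have "(C + C) + (E + 2 * G) = (C + C) + (R + 2 * L)"
    by (simp add: mult_2 add_ac)
  then have "E + 2 * G = R + 2 * L"
    using Cfin by (simp add: ennreal_add_left_cancel)
  then show ?thesis unfolding E_def R_def G_def L_def .
qed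

lemma nn_integral_time_swap:
  fixes F :: "real \<Rightarrow> 'a::euclidean_space \<Rightarrow> ennreal"
  assumes [measurable]: "(\<lambda>(t, x). F t x) \<in> borel_measurable (borel \<Otimes>\<^sub>M borel)"
  shows "(\<integral>\<^sup>+t\<in>{0<..}. (\<integral>\<^sup>+x. F t x \<partial>lborel) * ennreal (t powr p) \<partial>lborel)
    = (\<integral>\<^sup>+x. (\<integral>\<^sup>+t\<in>{0<..}. F t x * ennreal (t powr p) \<partial>lborel) \<partial>lborel)"
  using nn_integral_swap_weight[of F "\<lambda>t. ennreal (t powr p) * indicator {0<..} t"] by (simp add: mult.assoc)

lemma nn_integral_time_add:
  assumes [measurable]: "A \<in> borel_measurable borel" "B \<in> borel_measurable borel"
  shows "(\<integral>\<^sup>+t\<in>{0<..}. (A t + 2 * B t) * ennreal (t powr p) \<partial>lborel)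
    = (\<integral>\<^sup>+t\<in>{0<..}. A t * ennreal (t powr p) \<partial>lborel) + 2 * (\<integral>\<^sup>+t\<in>{0<..}. B t * ennreal (t powr p) \<partial>(lborel :: real measure))"
proof -
  have "(\<integral>\<^sup>+t\<in>{0<..}. (A t + 2 * B t) * ennreal (t powr p) \<partial>lborel)
    = (\<integral>\<^sup>+t. A t * ennreal (t powr p) * indicator {0<..} t + 2 * (B t * ennreal (t powr p) * indicator {0<..} t) \<partial>lborel)"
    by (simp add: distrib_right mult.assoc)
  also have "\<dots> = (\<integral>\<^sup>+t\<in>{0<..}. A t * ennreal (t powr p) \<partial>lborel) + (\<integral>\<^sup>+t. 2 * (B t * ennreal (t powr p) * indicator {0<..} t) \<partial>lborel)"
    by (rule nn_integral_add) measurable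
  also have "(\<integral>\<^sup>+t. 2 * (B t * ennreal (t powr p) * indicator {0<..} t) \<partial>lborel) = 2 * (\<integral>\<^sup>+t\<in>{0<..}. B t * ennreal (t powr p) \<partial>lborel)"
    by (rule nn_integral_cmult) measurable
  finally show ?thesis .
qed

text \<open>
  The identity \<open>ground_state_flow\<close> is averaged over \<open>t\<close> with weight \<open>t powr (- 1 - b)\<close>. The heat energy
  becomes the integral of \<open>|\<xi>| powr \<beta> |H|\<^sup>2\<close>, the kernel \<open>heat t (x - y)\<close> becomes a power of
  \<open>|x - y|\<close>, and \<open>flow_gain\<close> and \<open>flow_loss\<close> become multiples of \<open>heat_potential (a - b)\<close>. Since
  \<open>heat_potential (a - b) / heat_potential a\<close> is a multiple of \<open>|x| powr (- \<beta>)\<close>, loss and gain leave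
  the weighted term, with the positive coefficient \<open>a / b - 1\<close>.
\<close>

theorem ground_state_representation:
  fixes H g :: "'a::euclidean_space \<Rightarrow> complex"
  defines "d \<equiv> real DIM('a)" and "h \<equiv> inv_fourier H"
  assumes H: "integrable lborel H" and M: "\<And>y. cmod (H y) \<le> M" and cont: "AE z in lborel. isCont H z"
    and \<beta>: "0 < \<beta>" "\<beta> < 2" "\<beta> < d"
    and g: "g = (\<lambda>x. norm x powr ((d - \<beta>) / 2) *\<^sub>R h x)"
    and L2: "(\<integral>\<^sup>+x. ennreal ((cmod (h x))\<^sup>2) \<partial>lborel) < \<infinity>"
    and X: "(\<integral>\<^sup>+x. ennreal (norm x powr (- \<beta>) * (cmod (h x))\<^sup>2) \<partial>lborel) < \<infinity>"
  defines "a \<equiv> (d + \<beta>) / 4" and "b \<equiv> \<beta> / 2"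
  defines "w \<equiv> (\<lambda>x::'a. norm x powr (- ((d - \<beta>) / 2)))"
  shows "ennreal (2 * pi powr b * Gamma (1 - b) / b) * (\<integral>\<^sup>+\<xi>. ennreal (norm \<xi> powr \<beta> * (cmod (H \<xi>))\<^sup>2) \<partial>lborel)
    = ennreal (riesz_coeff DIM('a) (- b)) *
        (\<integral>\<^sup>+x. (\<integral>\<^sup>+y. ennreal ((cmod (g x - g y))\<^sup>2 / norm (x - y) powr (d + \<beta>) * w x * w y) \<partial>lborel) \<partial>lborel)
      + ennreal (2 * ((a - b) / b) * Beta a (1 - b) * (riesz_coeff DIM('a) (a - b) / riesz_coeff DIM('a) a)) *
        (\<integral>\<^sup>+x. ennreal (norm x powr (- \<beta>) * (cmod (h x))\<^sup>2) \<partial>lborel)"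
proof -
  have [measurable]: "H \<in> borel_measurable borel" using H by simp
  have [measurable]: "h \<in> borel_measurable borel" unfolding h_def by measurable
  have [measurable]: "g \<in> borel_measurable borel" unfolding g by measurable
  have [measurable]: "w \<in> borel_measurable borel" unfolding w_def by measurable
  define k where "k = riesz_coeff DIM('a) a"
  define k' where "k' = riesz_coeff DIM('a) (a - b)"
  define \<phi> where "\<phi> = (\<lambda>x. (cmod (h x))\<^sup>2 / (riesz_coeff DIM('a) a * w x))"
  have a: "0 < a" "a < d / 2" "0 < a - b" "a - b < d / 2" using \<beta> by (auto simp: a_def b_def field_simps)
  have b: "0 < b" "b < 1" using \<beta> by (auto simp: b_def)
  have k: "0 < k" "0 < k'" unfolding k_def k'_def using a by (auto intro!: riesz_coeff_pos simp: d_def)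
  have B: "0 < Beta a (1 - b)"
    unfolding Beta_def using a b by (intro divide_pos_pos mult_pos_pos Gamma_real_pos) auto
  have \<phi>0: "0 \<le> \<phi> x" for x unfolding \<phi>_def k_def[symmetric] using k by (simp add: w_def)
  have [measurable]: "\<phi> \<in> borel_measurable borel" unfolding \<phi>_def by measurable
  let ?p = "- 1 - b" and ?\<kappa> = "riesz_coeff DIM('a) (- b)" and ?c1 = "2 * pi powr b * Gamma (1 - b) / b"
  let ?T = "\<lambda>A. \<integral>\<^sup>+t\<in>{0<..}. A t * ennreal (t powr ?p) \<partial>lborel"
  let ?r = "\<lambda>x y. (cmod (g x - g y))\<^sup>2 / norm (x - y) powr (d + \<beta>) * w x * w y"
  let ?q = "\<lambda>x y. (cmod (g x - g y))\<^sup>2 * w x * w y"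
  let ?X = "\<lambda>x. norm x powr (- \<beta>) * (cmod (h x))\<^sup>2"
  let ?Y = "\<lambda>\<xi>. norm \<xi> powr \<beta> * (cmod (H \<xi>))\<^sup>2"
  let ?Z = "\<lambda>t \<xi>. 2 * (1 - exp (- (pi * t * (norm \<xi>)\<^sup>2))) * (cmod (H \<xi>))\<^sup>2"
  define E where "E t = (\<integral>\<^sup>+x. (\<integral>\<^sup>+y. ennreal ((cmod (h x - h y))\<^sup>2 * heat t (x - y)) \<partial>lborel) \<partial>lborel)" for t
  define E' where "E' t = (\<integral>\<^sup>+\<xi>. ennreal (?Z t \<xi>) \<partial>lborel)" for t
  define R where "R t = (\<integral>\<^sup>+x. (\<integral>\<^sup>+y. ennreal (?q x y * heat t (x - y)) \<partial>lborel) \<partial>lborel)" for t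
  define G where "G t = (\<integral>\<^sup>+x. ennreal (\<phi> x) * flow_gain a t x \<partial>lborel)" for t
  define L where "L t = (\<integral>\<^sup>+x. ennreal (\<phi> x) * flow_loss a t x \<partial>lborel)" for t
  define XX where "XX = (\<integral>\<^sup>+x. ennreal (?X x) \<partial>lborel)"
  have [measurable]: "E' \<in> borel_measurable borel" "R \<in> borel_measurable borel" "G \<in> borel_measurable borel" "L \<in> borel_measurable borel"
    unfolding E'_def[abs_def] R_def[abs_def] G_def[abs_def] L_def[abs_def] by measurable
  have EE': "E t = E' t" if "0 < t" for t
    unfolding E_def E'_def h_def by (rule nn_integral_heat_energy[OF H M cont that])
  have flow: "E' t + 2 * G t = R t + 2 * L t" if "0 < t" for t
    unfolding EE'[OF that, symmetric] unfolding E_def G_def R_def L_def \<phi>_def w_def a_def d_def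
    by (rule ground_state_flow) (use that \<beta> g L2 in \<open>simp_all add: d_def\<close>)
  have "(\<integral>\<^sup>+t\<in>{0<..}. (E' t + 2 * G t) * ennreal (t powr ?p) \<partial>lborel) = (\<integral>\<^sup>+t\<in>{0<..}. (R t + 2 * L t) * ennreal (t powr ?p) \<partial>lborel)"
    by (rule nn_integral_cong) (use flow in \<open>auto simp: indicator_def\<close>)
  then have total: "?T E' + 2 * ?T G
    = ?T R + 2 * ?T L"
    by (simp add: nn_integral_time_add)
  have pot: "(\<integral>\<^sup>+x. ennreal (\<phi> x) * (ennreal c * heat_potential (a - b) x) \<partial>lborel) = ennreal (c * (k' / k)) * XX" if "0 \<le> c" for c
  proof -
    have "(\<integral>\<^sup>+x. ennreal (\<phi> x) * (ennreal c * heat_potential (a - b) x) \<partial>lborel)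
      = (\<integral>\<^sup>+x. ennreal (c * (k' / k)) * ennreal (?X x) \<partial>lborel)"
      using AE_lborel_singleton[of "0::'a"]
    proof (rule nn_integral_cong_AE[OF eventually_mono])
      fix x :: 'a assume x: "x \<noteq> 0"
      have e: "2 * (a - b) - d = - ((d - \<beta>) / 2) + - \<beta>" by (simp add: a_def b_def field_simps)
      have "heat_potential (a - b) x = ennreal (k' * norm x powr (2 * (a - b) - d))"
        using heat_potential_eq[OF x, of "a - b"] a unfolding k'_def d_def by simp
      also have "norm x powr (2 * (a - b) - d) = w x * norm x powr (- \<beta>)"
        unfolding e w_def by (rule powr_add)
      finally have p: "heat_potential (a - b) x = ennreal (k' * (w x * norm x powr (- \<beta>)))" .
      have "0 < w x" using x by (simp add: w_def)
      then have r: "\<phi> x * (c * (k' * (w x * norm x powr (- \<beta>)))) = c * (k' / k) * (?X x)"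
        using k unfolding \<phi>_def k_def[symmetric] by simp
      have "ennreal (\<phi> x) * (ennreal c * heat_potential (a - b) x) = ennreal (\<phi> x * (c * (k' * (w x * norm x powr (- \<beta>)))))"
        unfolding p using \<phi>0[of x] that k \<open>0 < w x\<close> by (simp only: ennreal_mult mult_nonneg_nonneg powr_ge_zero less_imp_le)
      also have "\<dots> = ennreal (c * (k' / k)) * ennreal (?X x)"
        unfolding r using that k by (intro ennreal_mult) auto
      finally show "ennreal (\<phi> x) * (ennreal c * heat_potential (a - b) x)
        = ennreal (c * (k' / k)) * ennreal (?X x)" .
    qed
    also have "\<dots> = ennreal (c * (k' / k)) * XX"
      unfolding XX_def by (rule nn_integral_cmult) measurable
    finally show ?thesis .
  qed
  have IG: "?T G = ennreal (Beta a (1 - b) * (k' / k)) * XX"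
  proof -
    have "?T G
      = (\<integral>\<^sup>+x. (\<integral>\<^sup>+t\<in>{0<..}. ennreal (\<phi> x) * flow_gain a t x * ennreal (t powr ?p) \<partial>lborel) \<partial>lborel)"
      unfolding G_def by (rule nn_integral_time_swap) measurable
    also have "\<dots> = (\<integral>\<^sup>+x. ennreal (\<phi> x) * (ennreal (Beta a (1 - b)) * heat_potential (a - b) x) \<partial>lborel)"
      unfolding nn_integral_flow_gain[OF a(1) b(2), symmetric]
      by (rule nn_integral_cong, simp only: mult.assoc, rule nn_integral_cmult) measurable
    also have "\<dots> = ennreal (Beta a (1 - b) * (k' / k)) * XX"
      using B by (intro pot) simp
    finally show ?thesis .
  qed
  have IL: "?T L = ennreal (a / b * Beta a (1 - b) * (k' / k)) * XX"
  proof -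
    have "?T L
      = (\<integral>\<^sup>+x. (\<integral>\<^sup>+t\<in>{0<..}. ennreal (\<phi> x) * flow_loss a t x * ennreal (t powr ?p) \<partial>lborel) \<partial>lborel)"
      unfolding L_def by (rule nn_integral_time_swap) measurable
    also have "\<dots> = (\<integral>\<^sup>+x. ennreal (\<phi> x) * (ennreal (a / b * Beta a (1 - b)) * heat_potential (a - b) x) \<partial>lborel)"
      unfolding nn_integral_flow_loss[OF a(1) b, symmetric]
      by (rule nn_integral_cong, simp only: mult.assoc, rule nn_integral_cmult) measurable
    also have "\<dots> = ennreal (a / b * Beta a (1 - b) * (k' / k)) * XX"
      using B a b by (intro pot) simp
    finally show ?thesis .
  qed
  have IE: "?T E'
     = ennreal ?c1 * (\<integral>\<^sup>+\<xi>. ennreal (?Y \<xi>) \<partial>lborel)"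
  proof -
    have "?T E'
      = (\<integral>\<^sup>+\<xi>. (\<integral>\<^sup>+t\<in>{0<..}. ennreal (?Z t \<xi>) * ennreal (t powr ?p) \<partial>lborel) \<partial>lborel)"
      unfolding E'_def by (rule nn_integral_time_swap) measurable
    also have "\<dots> = (\<integral>\<^sup>+\<xi>. ennreal ?c1 * ennreal (?Y \<xi>) \<partial>lborel)"
      using AE_lborel_singleton[of "0::'a"]
    proof (rule nn_integral_cong_AE[OF eventually_mono])
      fix \<xi> :: 'a assume \<xi>: "\<xi> \<noteq> 0"
      let ?c = "pi * (norm \<xi>)\<^sup>2"
      have c: "0 < ?c" using \<xi> by simp
      have cb: "?c powr b = pi powr b * norm \<xi> powr \<beta>"
        using \<xi> powr_powr[of "norm \<xi>" 2 b] by (simp add: powr_mult b_def)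
      have "(\<integral>\<^sup>+t\<in>{0<..}. ennreal (?Z t \<xi>) * ennreal (t powr ?p) \<partial>lborel)
        = (\<integral>\<^sup>+t. ennreal (2 * (cmod (H \<xi>))\<^sup>2) * (ennreal ((1 - exp (- (?c * t))) * t powr ?p) * indicator {0<..} t) \<partial>lborel)"
        by (rule nn_integral_cong) (simp add: ennreal_mult'[symmetric] ennreal_mult''[symmetric] mult_ac indicator_def)
      also have "\<dots> = ennreal (2 * (cmod (H \<xi>))\<^sup>2) * (\<integral>\<^sup>+t\<in>{0<..}. ennreal ((1 - exp (- (?c * t))) * t powr ?p) \<partial>lborel)"
        by (rule nn_integral_cmult) measurable
      also have "\<dots> = ennreal (2 * (cmod (H \<xi>))\<^sup>2) * ennreal (?c powr b * Gamma (1 - b) / b)"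
        unfolding set_nn_integral_one_minus_exp_powr[OF b c] ..
      also have "\<dots> = ennreal ?c1 * ennreal (?Y \<xi>)"
        unfolding cb by (simp add: ennreal_mult'[symmetric] ennreal_mult''[symmetric] mult_ac)
      finally show "(\<integral>\<^sup>+t\<in>{0<..}. ennreal (?Z t \<xi>) * ennreal (t powr ?p) \<partial>lborel)
        = ennreal ?c1 * ennreal (?Y \<xi>)" .
    qed
    also have "\<dots> = ennreal ?c1 * (\<integral>\<^sup>+\<xi>. ennreal (?Y \<xi>) \<partial>lborel)"
      by (rule nn_integral_cmult) measurable
    finally show ?thesis .
  qed
  define RR where "RR = (\<integral>\<^sup>+x. (\<integral>\<^sup>+y. ennreal (?r x y) \<partial>lborel) \<partial>lborel)"
  have IR: "?T R = ennreal ?\<kappa> * RR"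
  proof -
    have "?T R
      = (\<integral>\<^sup>+x. (\<integral>\<^sup>+t\<in>{0<..}. (\<integral>\<^sup>+y. ennreal (?q x y * heat t (x - y)) \<partial>lborel) * ennreal (t powr ?p) \<partial>lborel) \<partial>lborel)"
      unfolding R_def by (rule nn_integral_time_swap) measurable
    also have "\<dots> = (\<integral>\<^sup>+x. (\<integral>\<^sup>+y. (\<integral>\<^sup>+t\<in>{0<..}. ennreal (?q x y * heat t (x - y)) * ennreal (t powr ?p) \<partial>lborel) \<partial>lborel) \<partial>lborel)"
      by (rule nn_integral_cong, rule nn_integral_time_swap) measurable
    also have "\<dots> = (\<integral>\<^sup>+x. (\<integral>\<^sup>+y. ennreal ?\<kappa> * ennreal (?r x y) \<partial>lborel) \<partial>lborel)"
    proof (rule nn_integral_cong)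
      fix x :: 'a
      show "(\<integral>\<^sup>+y. (\<integral>\<^sup>+t\<in>{0<..}. ennreal (?q x y * heat t (x - y)) * ennreal (t powr ?p) \<partial>lborel) \<partial>lborel)
        = (\<integral>\<^sup>+y. ennreal ?\<kappa> * ennreal (?r x y) \<partial>lborel)"
        using AE_lborel_singleton[of x]
      proof (rule nn_integral_cong_AE[OF eventually_mono])
        fix y assume y: "y \<noteq> x"
        have q: "0 \<le> ?q x y" by (simp add: w_def)
        have "(\<integral>\<^sup>+t\<in>{0<..}. ennreal (?q x y * heat t (x - y)) * ennreal (t powr ?p) \<partial>lborel)
          = (\<integral>\<^sup>+t. ennreal (?q x y) * (ennreal (heat t (x - y) * t powr (- b - 1)) * indicator {0<..} t) \<partial>lborel)"
        proof (rule nn_integral_cong)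
          fix t :: real
          have p: "?p = - b - 1" by simp
          show "ennreal (?q x y * heat t (x - y)) * ennreal (t powr ?p) * indicator {0<..} t
            = ennreal (?q x y) * (ennreal (heat t (x - y) * t powr (- b - 1)) * indicator {0<..} t)"
            unfolding p ennreal_mult[OF q heat_nonneg] ennreal_mult[OF heat_nonneg powr_ge_zero] by (simp only: mult.assoc)
        qed
        also have "\<dots> = ennreal (?q x y) * heat_potential (- b) (x - y)"
          unfolding heat_potential_def by (rule nn_integral_cmult) measurable
        also have "heat_potential (- b) (x - y) = ennreal (?\<kappa> * norm (x - y) powr (- (d + \<beta>)))"
        proof -
          have e: "2 * - b - d = - (d + \<beta>)" by (simp add: b_def)
          have "x - y \<noteq> 0" "- b < d / 2" using y b by (simp_all add: d_def)
          then show ?thesis unfolding e[symmetric] unfolding d_def by (rule heat_potential_eq)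
        qed
        also have "ennreal (?q x y) * \<dots> = ennreal (?\<kappa> * (?r x y))"
          using q unfolding powr_minus by (subst ennreal_mult'[symmetric]) (auto simp: divide_inverse mult_ac)
        also have "\<dots> = ennreal ?\<kappa> * ennreal (?r x y)"
          by (rule ennreal_mult'') (simp add: w_def)
        finally show "(\<integral>\<^sup>+t\<in>{0<..}. ennreal (?q x y * heat t (x - y)) * ennreal (t powr ?p) \<partial>lborel)
          = ennreal ?\<kappa> * ennreal (?r x y)" .
      qed
    qed
    also have "\<dots> = (\<integral>\<^sup>+x. ennreal ?\<kappa> * (\<integral>\<^sup>+y. ennreal (?r x y) \<partial>lborel) \<partial>lborel)"
      by (rule nn_integral_cong, rule nn_integral_cmult) measurable
    also have "\<dots> = ennreal ?\<kappa> * RR"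
      unfolding RR_def by (rule nn_integral_cmult) measurable
    finally show ?thesis .
  qed
  \<comment> \<open>the gain is \<open>K * XX\<close>, the loss is \<open>(a / b) * K * XX\<close>, and the finiteness of \<open>XX\<close> allows to subtract\<close>
  define K where "K = Beta a (1 - b) * (k' / k)"
  have K: "0 < K" unfolding K_def using B k by simp
  have loss: "2 * (ennreal (a / b * Beta a (1 - b) * (k' / k)) * XX) = ennreal (2 * ((a - b) / b) * K) * XX + 2 * (ennreal K * XX)"
  proof -
    have r: "(a - b) / b = a / b - 1" using b by (simp add: diff_divide_distrib)
    have two: "2 * ennreal z = ennreal (2 * z)" for z
      by (simp add: ennreal_mult')
    have "2 * ennreal (a / b * Beta a (1 - b) * (k' / k)) = ennreal (2 * (a / b * Beta a (1 - b) * (k' / k)))"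
      by (rule two)
    also have "2 * (a / b * Beta a (1 - b) * (k' / k)) = 2 * ((a - b) / b) * K + 2 * K"
      unfolding r K_def by (simp add: algebra_simps)
    also have "ennreal (2 * ((a - b) / b) * K + 2 * K) = ennreal (2 * ((a - b) / b) * K) + 2 * ennreal K"
      using a b K by (subst ennreal_plus) (auto simp: ennreal_mult')
    finally show ?thesis by (simp add: mult.assoc[symmetric] distrib_right)
  qed
  have "2 * (ennreal K * XX) + ?T E' = 2 * (ennreal K * XX) + (ennreal ?\<kappa> * RR + ennreal (2 * ((a - b) / b) * K) * XX)"
    using total unfolding IG IL IR loss K_def by (simp only: add_ac)
  moreover have "2 * (ennreal K * XX) \<noteq> \<infinity>"
    using X unfolding XX_def[symmetric] by (auto simp: ennreal_mult_eq_top_iff)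
  ultimately have "?T E' = ennreal ?\<kappa> * RR + ennreal (2 * ((a - b) / b) * K) * XX"
    by (simp add: ennreal_add_left_cancel)
  then show ?thesis
    unfolding IE XX_def RR_def K_def k_def k'_def by (simp add: mult.assoc)
qed

section \<open>The sharp Stein-Weiss inequality\<close>

text \<open>
  Local integrability follows from Riesz composition: the convolution of two potentials is finite at a
  point \<open>e\<close> outside of the unit ball, and for \<open>x\<close> in the ball the factor that depends on \<open>e - x\<close> is
  bounded from below.
\<close>

lemma nn_integral_riesz_kernel_finite:
  assumes \<beta>: "0 < \<beta>" "\<beta> < real DIM('a)"
  shows "(\<integral>\<^sup>+x\<in>{x. norm x < 1}. ennreal (norm (x::'a::euclidean_space) powr (- \<beta>)) \<partial>lborel) < \<infinity>"
proof -
  define d where "d = real DIM('a)"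
  define c where "c = (d - \<beta>) / 2"
  \<comment> \<open>any small positive exponent would do: the composition is finite for \<open>c + c'\<close> below \<open>d / 2\<close>\<close>
  define c' where "c' = \<beta> / 4"
  obtain b :: 'a where b: "b \<in> Basis" using nonempty_Basis by blast
  define e where "e = 2 *\<^sub>R b"
  have e: "norm e = 2" using b by (simp add: e_def)
  have c: "0 < c" "c < d / 2" "0 < c'" "c' < d / 2" "c + c' < d / 2"
    using \<beta> by (auto simp: c_def c'_def d_def field_simps)
  define k where "k = riesz_coeff DIM('a) c"
  define k' where "k' = riesz_coeff DIM('a) c'"
  have k: "0 < k" "0 < k'" unfolding k_def k'_def using c by (auto intro!: riesz_coeff_pos simp: d_def)
  define m where "m = k' * 3 powr (2 * c' - d) * k"
  have m: "0 < m" unfolding m_def using k by simp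
  have le: "ennreal m * (ennreal (norm x powr (- \<beta>)) * indicator {x. norm x < 1} x) \<le> heat_potential c' (e - x) * heat_potential c x"
    if x: "x \<noteq> 0" for x :: 'a
  proof (cases "x \<in> {x. norm x < 1}")
    case True
    then have x1: "norm x < 1" by simp
    have "e - x \<noteq> 0" using e x1 by auto
    then have p': "heat_potential c' (e - x) = ennreal (k' * norm (e - x) powr (2 * c' - d))"
      unfolding k'_def d_def using c by (intro heat_potential_eq) (simp_all add: d_def)
    have e2: "2 * c - d = - \<beta>" by (simp add: c_def field_simps)
    have p: "heat_potential c x = ennreal (k * norm x powr (- \<beta>))"
      unfolding e2[symmetric] unfolding k_def d_def using c x by (intro heat_potential_eq) (simp_all add: d_def)
    have "norm (e - x) \<le> 3" using norm_triangle_ineq4[of e x] e x1 by simp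
    then have "3 powr (2 * c' - d) \<le> norm (e - x) powr (2 * c' - d)"
      using c \<open>e - x \<noteq> 0\<close> by (intro powr_mono2') auto
    then have "k' * 3 powr (2 * c' - d) * (k * norm x powr (- \<beta>)) \<le> k' * norm (e - x) powr (2 * c' - d) * (k * norm x powr (- \<beta>))"
      using k by (intro mult_right_mono mult_left_mono) auto
    then have "ennreal (m * norm x powr (- \<beta>)) \<le> ennreal (k' * norm (e - x) powr (2 * c' - d) * (k * norm x powr (- \<beta>)))"
      unfolding m_def by (intro ennreal_leI) (simp add: mult.assoc)
    then show ?thesis
      unfolding p p' using True m k by (simp add: ennreal_mult)
  qed simp
  have "ennreal m * (\<integral>\<^sup>+x\<in>{x. norm x < 1}. ennreal (norm (x::'a) powr (- \<beta>)) \<partial>lborel)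
    = (\<integral>\<^sup>+x. ennreal m * (ennreal (norm (x::'a) powr (- \<beta>)) * indicator {x. norm x < 1} x) \<partial>lborel)"
    by (rule nn_integral_cmult[symmetric]) measurable
  also have "\<dots> \<le> (\<integral>\<^sup>+x. heat_potential c' (e - x) * heat_potential c x \<partial>lborel)"
    using AE_lborel_singleton[of "0::'a"] by (intro nn_integral_mono_AE) (auto elim!: eventually_mono intro: le)
  also have "\<dots> = ennreal (Beta c c') * heat_potential (c + c') e"
    using c by (intro heat_potential_convolution)
  also have "\<dots> < \<infinity>"
  proof -
    have "e \<noteq> 0" using e by auto
    then have "heat_potential (c + c') e = ennreal (riesz_coeff DIM('a) (c + c') * norm e powr (2 * (c + c') - real DIM('a)))"
      using c by (intro heat_potential_eq) (simp_all add: d_def)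
    then show ?thesis by (simp add: ennreal_mult_less_top)
  qed
  finally show ?thesis
    using m by (auto simp: ennreal_mult_less_top)
qed

lemma nn_integral_weighted_finite:
  fixes h :: "'a::euclidean_space \<Rightarrow> complex"
  assumes [measurable]: "h \<in> borel_measurable borel" and M: "\<And>x. cmod (h x) \<le> M"
    and L2: "(\<integral>\<^sup>+x. ennreal ((cmod (h x))\<^sup>2) \<partial>lborel) < \<infinity>"
    and \<beta>: "0 < \<beta>" "\<beta> < real DIM('a)"
  shows "(\<integral>\<^sup>+x. ennreal (norm x powr (- \<beta>) * (cmod (h x))\<^sup>2) \<partial>lborel) < \<infinity>"
proof -
  have "(\<integral>\<^sup>+x. ennreal (norm x powr (- \<beta>) * (cmod (h x))\<^sup>2) \<partial>lborel)
    \<le> (\<integral>\<^sup>+x. ennreal (M\<^sup>2) * (ennreal (norm x powr (- \<beta>)) * indicator {x. norm x < 1} x) + ennreal ((cmod (h x))\<^sup>2) \<partial>lborel)"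
  proof (rule nn_integral_mono)
    fix x :: 'a
    show "ennreal (norm x powr (- \<beta>) * (cmod (h x))\<^sup>2)
      \<le> ennreal (M\<^sup>2) * (ennreal (norm x powr (- \<beta>)) * indicator {x. norm x < 1} x) + ennreal ((cmod (h x))\<^sup>2)"
    proof (cases "x \<in> {x. norm x < 1}")
      case True
      have "norm x powr (- \<beta>) * (cmod (h x))\<^sup>2 \<le> M\<^sup>2 * norm x powr (- \<beta>)"
        using M[of x] by (subst mult.commute) (intro mult_right_mono power_mono, auto)
      then have "ennreal (norm x powr (- \<beta>) * (cmod (h x))\<^sup>2) \<le> ennreal (M\<^sup>2) * ennreal (norm x powr (- \<beta>))"
        by (simp add: ennreal_mult[symmetric] ennreal_leI)
      then show ?thesis using True by (simp add: add_increasing2)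
    next
      case False
      then have "1 \<le> norm x" by simp
      then have "norm x powr (- \<beta>) \<le> norm x powr 0" using \<beta> by (intro powr_mono) auto
      then have "norm x powr (- \<beta>) \<le> 1" using \<open>1 \<le> norm x\<close> by (auto split: if_splits)
      then have "norm x powr (- \<beta>) * (cmod (h x))\<^sup>2 \<le> 1 * (cmod (h x))\<^sup>2"
        by (intro mult_right_mono) auto
      then show ?thesis using False by (simp add: ennreal_leI)
    qed
  qed
  also have "\<dots> = ennreal (M\<^sup>2) * (\<integral>\<^sup>+x\<in>{x. norm x < 1}. ennreal (norm (x::'a) powr (- \<beta>)) \<partial>lborel) + (\<integral>\<^sup>+x. ennreal ((cmod (h x))\<^sup>2) \<partial>lborel)"
    by (subst nn_integral_add, measurable, simp, subst nn_integral_cmult, measurable)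
  also have "\<dots> < \<infinity>"
    using nn_integral_riesz_kernel_finite[OF \<beta>] L2 by (simp add: ennreal_mult_less_top)
  finally show ?thesis .
qed

text \<open>
  The heat flow acts on an inverse Fourier integral by the multiplier \<open>exp (- \<pi> s |\<xi>|\<^sup>2)\<close>.
\<close>

lemma heat_mean_inv_fourier:
  fixes H :: "'a::euclidean_space \<Rightarrow> complex"
  assumes H: "integrable lborel H" and s: "0 < s"
  shows "(\<integral>y. heat s (x - y) *\<^sub>R inv_fourier H y \<partial>lborel)
    = (\<integral>\<xi>. exp (- (pi * s * (norm \<xi>)\<^sup>2)) *\<^sub>R (cis (- (2 * pi * (\<xi> \<bullet> x))) * H \<xi>) \<partial>lborel)"
proof -
  define A where "A y = complex_of_real (heat s (x - y))" for y
  have [measurable]: "(\<lambda>y::'a. complex_of_real (heat s y)) \<in> borel_measurable borel" by measurable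
  have "integrable lborel (\<lambda>y. heat s (y + (- x)))"
    by (rule lborel_integrable_shift[OF integrable_heat[OF s]])
  then have "integrable lborel (\<lambda>y. heat s (x - y))"
    by (simp add: heat_minus_commute[of s x])
  then have A: "integrable lborel A"
    unfolding A_def by (rule complex_of_real_integrable_eq[THEN iffD2])
  have "(\<integral>y. heat s (x - y) *\<^sub>R inv_fourier H y \<partial>lborel)
    = (\<integral>y. A y * (\<integral>\<xi>. cis (- (2 * pi * (\<xi> \<bullet> y))) * H \<xi> \<partial>lborel) \<partial>lborel)"
    unfolding A_def inv_fourier_def by (simp only: scaleR_conv_of_real)
  also have "\<dots> = (\<integral>\<xi>. (\<integral>y. cis (- (2 * pi * (\<xi> \<bullet> y))) * A y \<partial>lborel) * H \<xi> \<partial>lborel)"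
    by (rule fubini_cis[OF A H]) measurable
  also have "\<dots> = (\<integral>\<xi>. exp (- (pi * s * (norm \<xi>)\<^sup>2)) *\<^sub>R (cis (- (2 * pi * (\<xi> \<bullet> x))) * H \<xi>) \<partial>lborel)"
  proof (rule Bochner_Integration.integral_cong[OF refl])
    fix \<xi>
    have "(\<integral>y. cis (- (2 * pi * (\<xi> \<bullet> y))) * A y \<partial>lborel)
      = (\<integral>u. cis (- (2 * pi * (\<xi> \<bullet> (x - u)))) * A (x - u) \<partial>lborel)"
      by (rule lborel_integral_reflect[symmetric, where f="\<lambda>y. cis (- (2 * pi * (\<xi> \<bullet> y))) * A y"])
        (simp add: A_def cis_conv_exp)
    also have "\<dots> = (\<integral>u. cis (- (2 * pi * (\<xi> \<bullet> x))) * (heat s u * cis (2 * pi * (\<xi> \<bullet> u))) \<partial>lborel)"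
    proof (rule Bochner_Integration.integral_cong[OF refl])
      fix u
      have "cis (- (2 * pi * (\<xi> \<bullet> (x - u)))) = cis (- (2 * pi * (\<xi> \<bullet> x))) * cis (2 * pi * (\<xi> \<bullet> u))"
        by (simp add: cis_mult inner_diff_right algebra_simps)
      then show "cis (- (2 * pi * (\<xi> \<bullet> (x - u)))) * A (x - u) = cis (- (2 * pi * (\<xi> \<bullet> x))) * (heat s u * cis (2 * pi * (\<xi> \<bullet> u)))"
        by (simp add: A_def)
    qed
    also have "\<dots> = cis (- (2 * pi * (\<xi> \<bullet> x))) * complex_of_real (exp (- (pi * s * (norm \<xi>)\<^sup>2)))"
      by (simp only: integral_mult_right_zero integral_heat_cis[OF s])
    finally show "(\<integral>y. cis (- (2 * pi * (\<xi> \<bullet> y))) * A y \<partial>lborel) * H \<xi>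
      = exp (- (pi * s * (norm \<xi>)\<^sup>2)) *\<^sub>R (cis (- (2 * pi * (\<xi> \<bullet> x))) * H \<xi>)"
      by (simp add: scaleR_conv_of_real)
  qed
  finally show ?thesis .
qed

text \<open>
  Up to a constant, \<open>inv_fourier F\<close> is the Riesz potential of \<open>inv_fourier H\<close>: the factor
  \<open>|\<xi>| powr (- 2 c)\<close> is a time integral of the heat multipliers, hence \<open>inv_fourier F\<close> is a time integral
  of the heat flow of \<open>inv_fourier H\<close>. Fubini applies because \<open>F\<close>, and not only \<open>H\<close>, is integrable.
\<close>

lemma inv_fourier_le_heat_potential:
  fixes F H :: "'a::euclidean_space \<Rightarrow> complex"
  assumes F: "integrable lborel F" and H: "integrable lborel H" and c: "0 < c"
    and HF: "H = (\<lambda>\<xi>. norm \<xi> powr (2 * c) *\<^sub>R F \<xi>)"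
  shows "ennreal (Gamma c * pi powr (- c) * cmod (inv_fourier F x))
    \<le> (\<integral>\<^sup>+y. heat_potential c (x - y) * ennreal (cmod (inv_fourier H y)) \<partial>lborel)"
proof -
  let ?h = "inv_fourier H"
  let ?c0 = "Gamma c * pi powr (- c)"
  let ?e = "\<lambda>\<xi>. cis (- (2 * pi * (\<xi> \<bullet> x)))"
  let ?K = "\<lambda>s y. ennreal (heat s (x - y) * s powr (c - 1)) * indicator {0<..} s * ennreal (cmod (?h y))"
  let ?m = "\<lambda>s. \<integral>y. heat s (x - y) *\<^sub>R ?h y \<partial>lborel"
  have [measurable]: "F \<in> borel_measurable borel" "H \<in> borel_measurable borel" using F H by simp_all
  define Q where "Q s \<xi> = indicator {0<..} s * (s powr (c - 1) * exp (- (pi * s * (norm \<xi>)\<^sup>2)))" for s and \<xi> :: 'a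
  have Q0: "0 \<le> Q s \<xi>" for s \<xi> by (simp add: Q_def)
  have [measurable]: "(\<lambda>p. Q (fst p) (snd p)) \<in> borel_measurable (borel \<Otimes>\<^sub>M borel)" unfolding Q_def by measurable
  have [measurable]: "(\<lambda>s. Q s \<xi>) \<in> borel_measurable borel" for \<xi> unfolding Q_def by measurable
  have [measurable]: "(\<lambda>\<xi>. Q s \<xi>) \<in> borel_measurable borel" for s unfolding Q_def by measurable
  have NQ: "(\<integral>\<^sup>+s. ennreal (Q s \<xi>) \<partial>lborel) = ennreal (?c0 * norm \<xi> powr (- (2 * c)))" if "\<xi> \<noteq> 0" for \<xi>
  proof -
    have "(\<integral>\<^sup>+s. ennreal (Q s \<xi>) \<partial>lborel) = (\<integral>\<^sup>+s\<in>{0<..}. ennreal (s powr (c - 1) * exp (- (pi * (norm \<xi>)\<^sup>2 * s))) \<partial>lborel)"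
      by (rule nn_integral_cong) (simp add: Q_def indicator_def mult_ac)
    also have "\<dots> = ennreal (Gamma c * (pi * (norm \<xi>)\<^sup>2) powr (- c))"
      using that by (intro set_nn_integral_Gamma c) simp
    also have "(pi * (norm \<xi>)\<^sup>2) powr (- c) = pi powr (- c) * norm \<xi> powr (- (2 * c))"
      using that powr_powr[of "norm \<xi>" 2 "- c"] by (simp add: powr_mult)
    finally show ?thesis by (simp add: mult.assoc)
  qed
  have IQ: "(\<integral>s. Q s \<xi> \<partial>lborel) = ?c0 * norm \<xi> powr (- (2 * c))" if "\<xi> \<noteq> 0" for \<xi>
    using c by (subst integral_eq_nn_integral) (auto simp: NQ[OF that] Q0)
  define Z where "Z = (\<lambda>s \<xi>. Q s \<xi> *\<^sub>R (?e \<xi> * H \<xi>))"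
  have [measurable]: "(\<lambda>\<xi>. ?e \<xi>) \<in> borel_measurable borel" unfolding cis_conv_exp by measurable
  have Zm[measurable]: "(\<lambda>(s, \<xi>). Z s \<xi>) \<in> borel_measurable (borel \<Otimes>\<^sub>M borel)" unfolding Z_def by measurable
  have ZI: "integrable (lborel \<Otimes>\<^sub>M lborel) (\<lambda>(s, \<xi>). Z s \<xi>)"
  proof (rule integrableI_bounded)
    have "(\<integral>\<^sup>+p. ennreal (norm (case p of (s, \<xi>) \<Rightarrow> Z s \<xi>)) \<partial>(lborel \<Otimes>\<^sub>M lborel))
      = (\<integral>\<^sup>+\<xi>. (\<integral>\<^sup>+s. ennreal (norm (Z s \<xi>)) \<partial>lborel) \<partial>lborel)"
      by (subst lborel_pair.nn_integral_snd[symmetric]) simp_all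
    also have "\<dots> = (\<integral>\<^sup>+\<xi>. ennreal ?c0 * ennreal (cmod (F \<xi>)) \<partial>lborel)"
      using AE_lborel_singleton[of "0::'a"]
    proof (rule nn_integral_cong_AE[OF eventually_mono])
      fix \<xi> :: 'a assume \<xi>: "\<xi> \<noteq> 0"
      have "(\<integral>\<^sup>+s. ennreal (norm (Z s \<xi>)) \<partial>lborel) = (\<integral>\<^sup>+s. ennreal (Q s \<xi>) * ennreal (cmod (H \<xi>)) \<partial>lborel)"
        by (rule nn_integral_cong) (simp add: Z_def norm_mult Q0 ennreal_mult)
      also have "\<dots> = (\<integral>\<^sup>+s. ennreal (Q s \<xi>) \<partial>lborel) * ennreal (cmod (H \<xi>))"
        by (rule nn_integral_multc) measurable
      also have "\<dots> = ennreal ?c0 * ennreal (cmod (F \<xi>))"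
        unfolding NQ[OF \<xi>] HF using \<xi> c by (simp add: ennreal_mult[symmetric] powr_minus field_simps)
      finally show "(\<integral>\<^sup>+s. ennreal (norm (Z s \<xi>)) \<partial>lborel) = ennreal ?c0 * ennreal (cmod (F \<xi>))" .
    qed
    also have "\<dots> = ennreal ?c0 * (\<integral>\<^sup>+\<xi>. ennreal (cmod (F \<xi>)) \<partial>lborel)"
      by (rule nn_integral_cmult) measurable
    also have "\<dots> < \<infinity>"
      using F by (simp add: integrable_iff_bounded ennreal_mult_less_top)
    finally show "(\<integral>\<^sup>+p. ennreal (norm (case p of (s, \<xi>) \<Rightarrow> Z s \<xi>)) \<partial>(lborel \<Otimes>\<^sub>M lborel)) < \<infinity>" .
  qed measurable
  have "?c0 *\<^sub>R inv_fourier F x = (\<integral>\<xi>. ?c0 *\<^sub>R (?e \<xi> * F \<xi>) \<partial>lborel)"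
    unfolding inv_fourier_def by (rule integral_scaleR_right[symmetric])
  also have "\<dots> = (\<integral>\<xi>. (\<integral>s. Z s \<xi> \<partial>lborel) \<partial>lborel)"
  proof (rule integral_cong_AE)
    show "AE \<xi> in lborel. ?c0 *\<^sub>R (?e \<xi> * F \<xi>) = (\<integral>s. Z s \<xi> \<partial>lborel)"
      using AE_lborel_singleton[of "0::'a"]
    proof eventually_elim
      fix \<xi> :: 'a assume \<xi>: "\<xi> \<noteq> 0"
      have "(\<integral>s. Z s \<xi> \<partial>lborel) = (\<integral>s. Q s \<xi> \<partial>lborel) *\<^sub>R (?e \<xi> * H \<xi>)"
        unfolding Z_def
      proof (rule integral_scaleR_left)
        show "integrable lborel (\<lambda>s. Q s \<xi>)"
          by (rule integrableI_nn_integral_finite[OF _ _ NQ[OF \<xi>]]) (simp_all add: Q0)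
      qed
      also have "\<dots> = ?c0 *\<^sub>R (?e \<xi> * F \<xi>)"
        unfolding IQ[OF \<xi>] HF using \<xi> by (simp add: powr_minus)
      finally show "?c0 *\<^sub>R (?e \<xi> * F \<xi>) = (\<integral>s. Z s \<xi> \<partial>lborel)" ..
    qed
  qed measurable
  also have "\<dots> = (\<integral>s. (\<integral>\<xi>. Z s \<xi> \<partial>lborel) \<partial>lborel)"
    by (rule lborel_pair.Fubini_integral[OF ZI])
  finally have "ennreal (norm (?c0 *\<^sub>R inv_fourier F x)) = ennreal (norm (\<integral>s. (\<integral>\<xi>. Z s \<xi> \<partial>lborel) \<partial>lborel))"
    by simp
  also have "\<dots> \<le> (\<integral>\<^sup>+s. ennreal (norm (\<integral>\<xi>. Z s \<xi> \<partial>lborel)) \<partial>lborel)"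
    by (rule integral_norm_bound_ennreal[OF lborel_pair.integrable_fst[OF ZI]])
  also have "\<dots> \<le> (\<integral>\<^sup>+s. (\<integral>\<^sup>+y. ?K s y \<partial>lborel) \<partial>lborel)"
  proof (rule nn_integral_mono)
    fix s :: real
    show "ennreal (norm (\<integral>\<xi>. Z s \<xi> \<partial>lborel)) \<le> (\<integral>\<^sup>+y. ?K s y \<partial>lborel)"
    proof (cases "0 < s")
      case True
      have "(\<integral>\<xi>. Z s \<xi> \<partial>lborel) = (\<integral>\<xi>. s powr (c - 1) *\<^sub>R (exp (- (pi * s * (norm \<xi>)\<^sup>2)) *\<^sub>R (?e \<xi> * H \<xi>)) \<partial>lborel)"
        unfolding Z_def Q_def using True by simp
      also have "\<dots> = s powr (c - 1) *\<^sub>R (?m s)"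
        unfolding heat_mean_inv_fourier[OF H True] by (rule integral_scaleR_right)
      finally have e: "(\<integral>\<xi>. Z s \<xi> \<partial>lborel) = s powr (c - 1) *\<^sub>R (?m s)" .
      have "ennreal (norm (\<integral>\<xi>. Z s \<xi> \<partial>lborel)) = ennreal (s powr (c - 1)) * ennreal (norm (?m s))"
        unfolding e by (simp add: ennreal_mult)
      also have "\<dots> \<le> ennreal (s powr (c - 1)) * (\<integral>\<^sup>+y. ennreal (norm (heat s (x - y) *\<^sub>R ?h y)) \<partial>lborel)"
      proof (rule mult_left_mono)
        show "ennreal (norm (?m s)) \<le> (\<integral>\<^sup>+y. ennreal (norm (heat s (x - y) *\<^sub>R ?h y)) \<partial>lborel)"
        proof (cases "integrable lborel (\<lambda>y. heat s (x - y) *\<^sub>R ?h y)")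
          case True
          then show ?thesis by (rule integral_norm_bound_ennreal)
        qed (simp add: not_integrable_integral_eq)
      qed simp
      also have "\<dots> = (\<integral>\<^sup>+y. ennreal (s powr (c - 1)) * ennreal (norm (heat s (x - y) *\<^sub>R ?h y)) \<partial>lborel)"
        by (rule nn_integral_cmult[symmetric]) measurable
      also have "\<dots> = (\<integral>\<^sup>+y. ?K s y \<partial>lborel)"
        using True by (intro nn_integral_cong) (simp add: ennreal_mult mult_ac)
      finally show ?thesis .
    next
      case False
      then have "Z s \<xi> = 0" for \<xi> by (simp add: Z_def Q_def)
      then show ?thesis by simp
    qed
  qed
  also have "\<dots> = (\<integral>\<^sup>+y. (\<integral>\<^sup>+s. ?K s y \<partial>lborel) \<partial>lborel)"
    by (rule lborel_pair.Fubini') measurable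
  also have "\<dots> = (\<integral>\<^sup>+y. heat_potential c (x - y) * ennreal (cmod (?h y)) \<partial>lborel)"
    unfolding heat_potential_def by (rule nn_integral_cong, rule nn_integral_multc) measurable
  finally show ?thesis
    using c by (simp add: abs_mult)
qed

text \<open>
  Schur test. By Cauchy-Schwarz with the test function \<open>heat_potential a\<close>, the square of \<open>f x\<close> is
  bounded by the potential of the test function times the potential of \<open>|h|\<^sup>2\<close> divided by it. The first
  factor is again a power; together with the weight \<open>|x| powr (- \<alpha>)\<close> it is a multiple of
  \<open>heat_potential a'\<close>, the test function for the adjoint kernel, whose potential is a power as well. As
  both test functions are mapped exactly to powers, the constant is the sharp one.
\<close>

theorem stein_weiss:
  fixes f h :: "'a::euclidean_space \<Rightarrow> complex"
  defines "d \<equiv> real DIM('a)"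
  assumes [measurable]: "f \<in> borel_measurable borel" "h \<in> borel_measurable borel"
    and c: "0 < c" and \<beta>: "0 < \<beta>" and \<alpha>: "\<beta> + 4 * c = \<alpha>" "\<alpha> < d"
    and fh: "\<And>x. ennreal (cmod (f x)) \<le> (\<integral>\<^sup>+y. heat_potential c (x - y) * ennreal (cmod (h y)) \<partial>lborel)"
  defines "a \<equiv> (d + \<beta>) / 4" and "a' \<equiv> (d - \<alpha>) / 4"
  shows "(\<integral>\<^sup>+x. ennreal (norm x powr (- \<alpha>) * (cmod (f x))\<^sup>2) \<partial>lborel)
    \<le> ennreal (Beta a c * Beta a' c * (riesz_coeff DIM('a) (a + c) / riesz_coeff DIM('a) a')
          * (riesz_coeff DIM('a) (a' + c) / riesz_coeff DIM('a) a))
      * (\<integral>\<^sup>+x. ennreal (norm x powr (- \<beta>) * (cmod (h x))\<^sup>2) \<partial>lborel)"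
proof -
  define k1 where "k1 = riesz_coeff DIM('a) a"
  define k2 where "k2 = riesz_coeff DIM('a) (a + c)"
  define k3 where "k3 = riesz_coeff DIM('a) a'"
  define k4 where "k4 = riesz_coeff DIM('a) (a' + c)"
  define kc where "kc = riesz_coeff DIM('a) c"
  have a: "0 < a" "a < d / 2" "a + c < d / 2" "0 < a'" "a' < d / 2" "a' + c < d / 2" "c < d / 2"
    using c \<beta> \<alpha> by (auto simp: a_def a'_def field_simps)
  have k: "0 < k1" "0 < k2" "0 < k3" "0 < k4" "0 < kc"
    unfolding k1_def k2_def k3_def k4_def kc_def using a by (auto intro!: riesz_coeff_pos simp: d_def)
  have B: "0 < Beta a c" "0 < Beta a' c"
    unfolding Beta_def using a c by (auto intro!: divide_pos_pos mult_pos_pos Gamma_real_pos)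
  define W where "W y = k1 * norm y powr (2 * a - d)" for y :: 'a
  define \<phi> where "\<phi> y = (cmod (h y))\<^sup>2 / W y" for y
  define \<kappa> where "\<kappa> z = kc * norm z powr (2 * c - d)" for z :: 'a
  have W: "0 < W y" if "y \<noteq> 0" for y using that k by (simp add: W_def)
  have nn: "0 \<le> W y" "0 \<le> \<phi> y" "0 \<le> \<kappa> y" for y using k by (simp_all add: W_def \<phi>_def \<kappa>_def)
  have potW: "heat_potential a y = ennreal (W y)" if "y \<noteq> 0" for y :: 'a
    unfolding W_def k1_def d_def by (rule heat_potential_eq) (use that a in \<open>simp_all add: d_def\<close>)
  have potK: "heat_potential c z = ennreal (\<kappa> z)" if "z \<noteq> 0" for z :: 'a
    unfolding \<kappa>_def kc_def d_def by (rule heat_potential_eq) (use that a in \<open>simp_all add: d_def\<close>)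
  have [measurable]: "W \<in> borel_measurable borel" "\<kappa> \<in> borel_measurable borel" unfolding W_def \<kappa>_def by measurable
  have [measurable]: "\<phi> \<in> borel_measurable borel" unfolding \<phi>_def by measurable
  let ?F = "\<lambda>x y. heat_potential a' x * (heat_potential c (x - y) * ennreal (\<phi> y))"
  let ?J = "\<lambda>x. \<integral>\<^sup>+y. heat_potential c (x - y) * ennreal (\<phi> y) \<partial>lborel"
  let ?s = "\<lambda>x y. sqrt (\<kappa> (x - y) * W y)"
  let ?t = "\<lambda>x y. sqrt (\<kappa> (x - y) * \<phi> y)"
  let ?X = "\<lambda>y. norm y powr (- \<beta>) * (cmod (h y))\<^sup>2"
  let ?Y = "\<lambda>x. norm x powr (- \<alpha>) * (cmod (f x))\<^sup>2"
  have schur: "ennreal ((cmod (f x))\<^sup>2) \<le> (ennreal (Beta a c) * heat_potential (a + c) x) * (?J x)" for x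
  proof -
    have "ennreal ((cmod (f x))\<^sup>2) = (ennreal (cmod (f x)))\<^sup>2" by (simp add: ennreal_power)
    also have "\<dots> \<le> (\<integral>\<^sup>+y. heat_potential c (x - y) * ennreal (cmod (h y)) \<partial>lborel)\<^sup>2"
      by (intro power_mono fh) simp
    also have "(\<integral>\<^sup>+y. heat_potential c (x - y) * ennreal (cmod (h y)) \<partial>lborel)
      = (\<integral>\<^sup>+y. ennreal (?s x y) * ennreal (?t x y) \<partial>lborel)"
    proof (rule nn_integral_cong_AE, use AE_lborel_singleton[of "0::'a"] AE_lborel_singleton[of x] in eventually_elim)
      fix y assume y: "y \<noteq> 0" "y \<noteq> x"
      have "W y * \<phi> y = (cmod (h y))\<^sup>2" using W[OF y(1)] by (simp add: \<phi>_def)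
      then have "sqrt (W y) * sqrt (\<phi> y) = cmod (h y)"
        by (simp add: real_sqrt_mult[symmetric])
      moreover have "?s x y * ?t x y
        = (sqrt (\<kappa> (x - y)) * sqrt (\<kappa> (x - y))) * (sqrt (W y) * sqrt (\<phi> y))"
        by (simp only: real_sqrt_mult mult_ac)
      ultimately have "?s x y * ?t x y = \<kappa> (x - y) * cmod (h y)"
        using nn(3)[of "x - y"] by simp
      then show "heat_potential c (x - y) * ennreal (cmod (h y)) = ennreal (?s x y) * ennreal (?t x y)"
        using y nn by (simp add: potK ennreal_mult[symmetric])
    qed
    also have "(\<integral>\<^sup>+y. ennreal (?s x y) * ennreal (?t x y) \<partial>lborel)\<^sup>2
      \<le> (\<integral>\<^sup>+y. (ennreal (?s x y))\<^sup>2 \<partial>lborel) * (\<integral>\<^sup>+y. (ennreal (?t x y))\<^sup>2 \<partial>lborel)"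
      by (rule Cauchy_Schwarz_nn_integral) measurable
    also have "(\<integral>\<^sup>+y. (ennreal (?s x y))\<^sup>2 \<partial>lborel) = (\<integral>\<^sup>+y. heat_potential c (x - y) * heat_potential a y \<partial>lborel)"
      by (rule nn_integral_cong_AE, use AE_lborel_singleton[of "0::'a"] AE_lborel_singleton[of x] in eventually_elim)
        (use nn in \<open>simp add: potK potW ennreal_power ennreal_mult\<close>)
    also have "\<dots> = ennreal (Beta a c) * heat_potential (a + c) x"
      by (rule heat_potential_convolution[OF c a(1)])
    also have "(\<integral>\<^sup>+y. (ennreal (?t x y))\<^sup>2 \<partial>lborel) = (?J x)"
      by (rule nn_integral_cong_AE, use AE_lborel_singleton[of x] in eventually_elim)
        (use nn in \<open>simp add: potK ennreal_power ennreal_mult\<close>)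
    finally show ?thesis .
  qed
  define m where "m = Beta a c * (k2 / k3)"
  have m: "0 \<le> m" unfolding m_def using B k by simp
  have "(\<integral>\<^sup>+x. ennreal (?Y x) \<partial>lborel)
    \<le> (\<integral>\<^sup>+x. ennreal m * (\<integral>\<^sup>+y. ?F x y \<partial>lborel) \<partial>lborel)"
  proof (rule nn_integral_mono_AE, use AE_lborel_singleton[of "0::'a"] in eventually_elim)
    fix x :: 'a assume x: "x \<noteq> 0"
    have p2: "heat_potential (a + c) x = ennreal (k2 * norm x powr (2 * (a + c) - d))"
      unfolding k2_def d_def by (rule heat_potential_eq) (use x a in \<open>simp_all add: d_def\<close>)
    have p3: "heat_potential a' x = ennreal (k3 * norm x powr (2 * a' - d))"
      unfolding k3_def d_def by (rule heat_potential_eq) (use x a in \<open>simp_all add: d_def\<close>)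
    have e: "- \<alpha> + (2 * (a + c) - d) = 2 * a' - d" using \<alpha> by (simp add: a_def a'_def field_simps)
    have "norm x powr (- \<alpha>) * (Beta a c * (k2 * norm x powr (2 * (a + c) - d))) = Beta a c * k2 * (norm x powr (- \<alpha>) * norm x powr (2 * (a + c) - d))"
      by simp
    also have "\<dots> = m * (k3 * norm x powr (2 * a' - d))"
      unfolding powr_add[symmetric] e m_def using k by simp
    finally have w: "ennreal (norm x powr (- \<alpha>)) * (ennreal (Beta a c) * heat_potential (a + c) x) = ennreal m * heat_potential a' x"
      unfolding p2 p3 using B k m by (simp add: ennreal_mult[symmetric])
    have "ennreal (?Y x) = ennreal (norm x powr (- \<alpha>)) * ennreal ((cmod (f x))\<^sup>2)"
      by (simp add: ennreal_mult)
    also have "\<dots> \<le> ennreal (norm x powr (- \<alpha>)) * ((ennreal (Beta a c) * heat_potential (a + c) x) * (?J x))"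
      by (rule mult_left_mono[OF schur]) simp
    also have "\<dots> = ennreal m * (heat_potential a' x * (?J x))"
      using w by (metis mult.assoc)
    also have "heat_potential a' x * (?J x)
      = (\<integral>\<^sup>+y. ?F x y \<partial>lborel)"
      by (rule nn_integral_cmult[symmetric]) measurable
    finally show "ennreal (?Y x)
      \<le> ennreal m * (\<integral>\<^sup>+y. ?F x y \<partial>lborel)" .
  qed
  also have "\<dots> = ennreal m * (\<integral>\<^sup>+x. (\<integral>\<^sup>+y. ?F x y \<partial>lborel) \<partial>lborel)"
    by (rule nn_integral_cmult) measurable
  also have "(\<integral>\<^sup>+x. (\<integral>\<^sup>+y. ?F x y \<partial>lborel) \<partial>lborel)
    = (\<integral>\<^sup>+y. (\<integral>\<^sup>+x. ?F x y \<partial>lborel) \<partial>lborel)"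
    by (rule lborel_pair.Fubini'[symmetric]) measurable
  also have "\<dots> = (\<integral>\<^sup>+y. ennreal (Beta a' c * (k4 / k1)) * ennreal (?X y) \<partial>lborel)"
  proof (rule nn_integral_cong_AE, use AE_lborel_singleton[of "0::'a"] in eventually_elim)
    fix y :: 'a assume y: "y \<noteq> 0"
    have "(\<integral>\<^sup>+x. ?F x y \<partial>lborel)
      = (\<integral>\<^sup>+x. (heat_potential c (y - x) * heat_potential a' x) * ennreal (\<phi> y) \<partial>lborel)"
      by (rule nn_integral_cong) (metis heat_potential_uminus minus_diff_eq mult.assoc mult.commute)
    also have "\<dots> = (\<integral>\<^sup>+x. heat_potential c (y - x) * heat_potential a' x \<partial>lborel) * ennreal (\<phi> y)"
      by (rule nn_integral_multc) measurable
    also have "\<dots> = ennreal (Beta a' c) * heat_potential (a' + c) y * ennreal (\<phi> y)"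
      unfolding heat_potential_convolution[OF c a(4)] ..
    also have "heat_potential (a' + c) y = ennreal (k4 * norm y powr (2 * (a' + c) - d))"
      unfolding k4_def d_def by (rule heat_potential_eq) (use y a in \<open>simp_all add: d_def\<close>)
    also have "ennreal (Beta a' c) * ennreal (k4 * norm y powr (2 * (a' + c) - d)) * ennreal (\<phi> y)
      = ennreal (Beta a' c * (k4 * norm y powr (2 * (a' + c) - d)) * \<phi> y)"
      using B k nn by (simp add: ennreal_mult[symmetric])
    also have "Beta a' c * (k4 * norm y powr (2 * (a' + c) - d)) * \<phi> y = Beta a' c * (k4 / k1) * (?X y)"
    proof -
      have "2 * (a' + c) - d = (2 * a - d) + - \<beta>" using \<alpha> by (simp add: a_def a'_def field_simps)
      then have p: "norm y powr (2 * (a' + c) - d) = norm y powr (2 * a - d) * norm y powr (- \<beta>)"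
        by (simp only: powr_add)
      have "0 < norm y powr (2 * a - d)" using y by simp
      then show ?thesis unfolding p \<phi>_def W_def using k by simp
    qed
    also have "ennreal (Beta a' c * (k4 / k1) * (?X y))
      = ennreal (Beta a' c * (k4 / k1)) * ennreal (?X y)"
      using B k by (intro ennreal_mult) auto
    finally show "(\<integral>\<^sup>+x. ?F x y \<partial>lborel)
      = ennreal (Beta a' c * (k4 / k1)) * ennreal (?X y)" .
  qed
  also have "\<dots> = ennreal (Beta a' c * (k4 / k1)) * (\<integral>\<^sup>+y. ennreal (?X y) \<partial>lborel)"
    by (rule nn_integral_cmult) measurable
  finally have fin: "(\<integral>\<^sup>+x. ennreal (?Y x) \<partial>lborel)
    \<le> ennreal m * (ennreal (Beta a' c * (k4 / k1)) * (\<integral>\<^sup>+y. ennreal (?X y) \<partial>lborel))" .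
  have "ennreal m * ennreal (Beta a' c * (k4 / k1)) = ennreal (Beta a c * Beta a' c * (k2 / k3) * (k4 / k1))"
    unfolding m_def using B k by (simp add: ennreal_mult[symmetric] mult_ac)
  with fin show ?thesis
    unfolding k1_def k2_def k3_def k4_def by (simp only: mult.assoc[symmetric])
qed

section \<open>The constants and the inequality\<close>

lemma C_const_pos:
  assumes "0 < \<alpha>" "\<alpha> < real n"
  shows "0 < C_const n \<alpha>"
  unfolding C_const_def using assms
  by (intro mult_pos_pos zero_less_power divide_pos_pos Gamma_real_pos) auto

lemma riesz_coeff_reflect:
  assumes "real d / 2 - a = s"
  shows "riesz_coeff d a = Gamma s * pi powr (- s)"
proof -
  have "a - real d / 2 = - s" using assms by simp
  then show ?thesis unfolding riesz_coeff_def assms by simp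
qed

text \<open>
  Subtraction from \<open>d / 2\<close> exchanges \<open>a\<close> with \<open>a' + c\<close> and \<open>a'\<close> with \<open>a + c\<close>. Hence only four values of
  the Gamma function occur besides \<open>Gamma c\<close>, which cancels.
\<close>

lemma stein_weiss_constant:
  fixes d :: nat
  assumes c: "0 < c" and \<beta>: "0 < \<beta>" and \<alpha>: "\<beta> + 4 * c = \<alpha>" "\<alpha> < real d"
  defines "a \<equiv> (real d + \<beta>) / 4" and "a' \<equiv> (real d - \<alpha>) / 4"
  shows "(Gamma c * pi powr (- c)) powr (- 2) * (Beta a c * Beta a' c * (riesz_coeff d (a + c) / riesz_coeff d a')
          * (riesz_coeff d (a' + c) / riesz_coeff d a)) = C_const d \<alpha> / C_const d \<beta>"
proof -
  have aa: "0 < a" "0 < a'" using c \<beta> \<alpha> by (auto simp: a_def a'_def intro: add_nonneg_pos)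
  define ga where "ga = Gamma a"
  define gac where "gac = Gamma (a + c)"
  define ga' where "ga' = Gamma a'"
  define gac' where "gac' = Gamma (a' + c)"
  define gc where "gc = Gamma c"
  have pos: "0 < ga" "0 < gac" "0 < ga'" "0 < gac'" "0 < gc"
    unfolding ga_def gac_def ga'_def gac'_def gc_def using aa c
    by (auto intro!: Gamma_real_pos)
  have e: "real d / 2 - (a + c) = a'" "real d / 2 - a' = a + c" "real d / 2 - (a' + c) = a" "real d / 2 - a = a' + c"
    using \<alpha> by (simp_all add: a_def a'_def field_simps)
  have r: "riesz_coeff d (a + c) = ga' * pi powr (- a')" "riesz_coeff d a' = gac * pi powr (- (a + c))"
    "riesz_coeff d (a' + c) = ga * pi powr (- a)" "riesz_coeff d a = gac' * pi powr (- (a' + c))"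
    unfolding ga_def gac_def ga'_def gac'_def by (intro riesz_coeff_reflect e)+
  have p: "pi powr (- a') / pi powr (- (a + c)) * (pi powr (- a) / pi powr (- (a' + c))) = pi powr (2 * c)"
    by (simp add: powr_diff[symmetric] powr_add[symmetric])
  have "(Gamma c * pi powr (- c)) powr (- 2) = pi powr (2 * c) / gc\<^sup>2"
  proof -
    have "(gc * pi powr (- c)) powr (- 2) = inverse ((gc * pi powr (- c))\<^sup>2)"
      using pos(5) powr_numeral[of "gc * pi powr (- c)" "num.Bit0 num.One"] powr_minus[of "gc * pi powr (- c)" 2] by simp
    also have "\<dots> = inverse (gc\<^sup>2 * pi powr (- (2 * c)))"
      by (simp add: power_mult_distrib power2_eq_square[of "pi powr (- c)"] powr_add[symmetric])
    also have "\<dots> = pi powr (2 * c) / gc\<^sup>2"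
      unfolding powr_minus by (simp add: divide_inverse mult.commute)
    finally show ?thesis unfolding gc_def .
  qed
  then have "(Gamma c * pi powr (- c)) powr (- 2) * (Beta a c * Beta a' c * (riesz_coeff d (a + c) / riesz_coeff d a')
          * (riesz_coeff d (a' + c) / riesz_coeff d a))
    = pi powr (2 * c) / gc\<^sup>2 * ((ga * gc / gac) * (ga' * gc / gac') * (ga' * pi powr (- a') / (gac * pi powr (- (a + c))))
       * (ga * pi powr (- a) / (gac' * pi powr (- (a' + c)))))"
    unfolding r Beta_def ga_def gac_def ga'_def gac'_def gc_def by simp
  also have "\<dots> = pi powr (2 * c) * (pi powr (- a') / pi powr (- (a + c)) * (pi powr (- a) / pi powr (- (a' + c)))) * (ga * ga' / (gac * gac'))\<^sup>2"
    using pos by (simp add: field_simps power2_eq_square)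
  also have "\<dots> = pi powr (\<alpha> - \<beta>) * (ga * ga' / (gac * gac'))\<^sup>2"
  proof -
    have "2 * c + 2 * c = \<alpha> - \<beta>" using \<alpha> by simp
    then show ?thesis unfolding p by (simp only: powr_add[symmetric])
  qed
  also have "\<dots> = C_const d \<alpha> / C_const d \<beta>"
  proof -
    have eqs: "(real d + \<alpha>) / 4 = a + c" "(real d - \<beta>) / 4 = a' + c"
      using \<alpha> by (simp_all add: a_def a'_def field_simps)
    have eqC: "C_const d \<alpha> = pi powr \<alpha> * (ga' / gac)\<^sup>2" "C_const d \<beta> = pi powr \<beta> * (gac' / ga)\<^sup>2"
      unfolding C_const_def eqs a_def[symmetric] a'_def[symmetric] ga_def gac_def ga'_def gac'_def by (rule refl)+
    show ?thesis
      unfolding eqC powr_diff using pos by (simp add: field_simps power2_eq_square)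
  qed
  finally show ?thesis .
qed

text \<open>
  With \<open>a - b = (d - \<beta>) / 4\<close>, subtraction from \<open>d / 2\<close> exchanges \<open>a\<close> and \<open>a - b\<close>, and the factor
  \<open>a - b\<close> cancels against \<open>Gamma (a + 1 - b) = (a - b) * Gamma (a - b)\<close>.
\<close>

lemma ground_state_constants:
  fixes d :: nat
  assumes \<beta>: "0 < \<beta>" "\<beta> < 2" "\<beta> < real d"
  defines "a \<equiv> (real d + \<beta>) / 4" and "b \<equiv> \<beta> / 2"
  shows "riesz_coeff d (- b) = (2 * pi powr b * Gamma (1 - b) / b) / D_const d \<beta>"
    and "2 * ((a - b) / b) * Beta a (1 - b) * (riesz_coeff d (a - b) / riesz_coeff d a)
      = (2 * pi powr b * Gamma (1 - b) / b) / C_const d \<beta>"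
proof -
  have b: "0 < b" "b < 1" using \<beta> by (auto simp: b_def)
  have ab: "0 < a - b" "a - b = (real d - \<beta>) / 4" using \<beta> by (auto simp: a_def b_def field_simps)
  have g1: "0 < Gamma (1 - b)" using b by (intro Gamma_real_pos) simp
  have g2: "0 < Gamma (real d / 2 + b)" using b by (intro Gamma_real_pos) (simp add: add_nonneg_pos)
  have D: "D_const d \<beta> = 2 / b * pi powr (real d / 2 + 2 * b) * (Gamma (1 - b) / Gamma (real d / 2 + b))"
    unfolding D_const_def b_def by (simp add: add_divide_distrib)
  have p: "pi powr b / pi powr (real d / 2 + 2 * b) = pi powr (- b - real d / 2)"
    by (simp add: powr_diff[symmetric])
  have "(2 * pi powr b * Gamma (1 - b) / b) / D_const d \<beta>
    = (pi powr b / pi powr (real d / 2 + 2 * b)) * Gamma (real d / 2 + b)"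
  proof -
    have "(2 * x * y / b) / (2 / b * z * (y / v)) = (x / z) * v" if "0 < y" "0 < v" "0 < z" for x y z v :: real
      using that b by (simp add: field_simps)
    then show ?thesis unfolding D using g1 g2 by simp
  qed
  also have "\<dots> = riesz_coeff d (- b)"
    unfolding p riesz_coeff_def by simp
  finally show "riesz_coeff d (- b) = (2 * pi powr b * Gamma (1 - b) / b) / D_const d \<beta>" ..
  define u where "u = Gamma a"
  define v where "v = Gamma (a - b)"
  have uv: "0 < u" "0 < v" unfolding u_def v_def using ab b by (auto intro!: Gamma_real_pos)
  have e: "real d / 2 - (a - b) = a" "real d / 2 - a = a - b"
    by (simp_all add: a_def b_def field_simps)
  have r: "riesz_coeff d (a - b) = u * pi powr (- a)" "riesz_coeff d a = v * pi powr (- (a - b))"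
    unfolding u_def v_def by (intro riesz_coeff_reflect e)+
  have "Gamma (a + (1 - b)) = (a - b) * v"
    unfolding v_def using ab Gamma_plus1[of "a - b"] by (simp add: algebra_simps nonpos_Ints_def)
  then have Beta: "Beta a (1 - b) = u * Gamma (1 - b) / ((a - b) * v)"
    unfolding Beta_def u_def by simp
  have C: "C_const d \<beta> = pi powr (2 * b) * (v / u)\<^sup>2"
    unfolding C_const_def u_def v_def ab(2) by (simp add: a_def b_def)
  have q: "pi powr (- a) / pi powr (- (a - b)) = pi powr b / pi powr (2 * b)"
    by (simp add: powr_diff[symmetric])
  have "2 * ((a - b) / b) * Beta a (1 - b) * (riesz_coeff d (a - b) / riesz_coeff d a)
    = 2 / b * Gamma (1 - b) * (u / v)\<^sup>2 * (pi powr (- a) / pi powr (- (a - b)))"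
    unfolding Beta r using ab(1) b uv by (simp add: field_simps power2_eq_square)
  also have "\<dots> = (2 * pi powr b * Gamma (1 - b) / b) / C_const d \<beta>"
    unfolding q C using b uv by (simp add: field_simps power2_eq_square)
  finally show "2 * ((a - b) / b) * Beta a (1 - b) * (riesz_coeff d (a - b) / riesz_coeff d a)
      = (2 * pi powr b * Gamma (1 - b) / b) / C_const d \<beta>" .
qed

text \<open>
  For \<open>\<beta> < \<alpha>\<close> the function \<open>f\<close> is a Riesz potential of \<open>h\<close> and the Stein-Weiss inequality applies. For
  \<open>\<alpha> = \<beta>\<close> the multiplier is \<open>1\<close> off the origin, so that \<open>h = f\<close> by Fourier inversion.
\<close>

lemma weighted_hardy_reduction:
  fixes f :: "'a::euclidean_space \<Rightarrow> complex"
  assumes f: "schwartz f" and \<beta>: "0 < \<beta>" and \<alpha>: "\<beta> \<le> \<alpha>" "\<alpha> < real DIM('a)"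
  defines "h \<equiv> laplacian_power ((\<alpha> - \<beta>) / 4) f"
  shows "(\<integral>\<^sup>+x. ennreal (norm x powr (- \<alpha>) * (cmod (f x))\<^sup>2) \<partial>lborel)
    \<le> ennreal (C_const DIM('a) \<alpha> / C_const DIM('a) \<beta>) * (\<integral>\<^sup>+x. ennreal (norm x powr (- \<beta>) * (cmod (h x))\<^sup>2) \<partial>lborel)"
proof (cases "\<alpha> = \<beta>")
  case True
  have "h x = f x" for x
  proof -
    have "h x = inv_fourier (fourier f) x"
      unfolding h_def laplacian_power_def inv_fourier_def True
    proof (rule integral_cong_AE)
      have [measurable]: "fourier f \<in> borel_measurable borel"
        using integrable_fourier_schwartz[OF f] by simp
      show "(\<lambda>\<xi>. cis (- (2 * pi * (\<xi> \<bullet> x))) * (norm \<xi> powr (2 * ((\<beta> - \<beta>) / 4)) *\<^sub>R fourier f \<xi>)) \<in> borel_measurable lborel"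
        "(\<lambda>\<xi>. cis (- (2 * pi * (\<xi> \<bullet> x))) * fourier f \<xi>) \<in> borel_measurable lborel"
        unfolding cis_conv_exp by measurable
      show "AE \<xi> in lborel. cis (- (2 * pi * (\<xi> \<bullet> x))) * (norm \<xi> powr (2 * ((\<beta> - \<beta>) / 4)) *\<^sub>R fourier f \<xi>) = cis (- (2 * pi * (\<xi> \<bullet> x))) * fourier f \<xi>"
        using AE_lborel_singleton[of "0::'a"] by eventually_elim simp
    qed
    then show ?thesis using schwartz_fourier_inversion[OF f] by simp
  qed
  moreover have "0 < C_const DIM('a) \<beta>" using \<beta> \<alpha> by (intro C_const_pos) auto
  ultimately show ?thesis unfolding True by simp
next
  case False
  define c where "c = (\<alpha> - \<beta>) / 4"
  have c: "0 < c" "\<beta> + 4 * c = \<alpha>" using False \<alpha> by (auto simp: c_def field_simps)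
  define A where "A = Gamma c * pi powr (- c)"
  have A: "0 < A" unfolding A_def using c by (intro mult_pos_pos Gamma_real_pos) auto
  define H where "H = (\<lambda>\<xi>::'a. norm \<xi> powr (2 * c) *\<^sub>R fourier f \<xi>)"
  have hH: "h = inv_fourier H" unfolding h_def laplacian_power_def H_def c_def ..
  have H: "integrable lborel H"
    unfolding H_def using c \<alpha> \<beta> by (intro fourier_multiplier_integrable[OF f]) (auto simp: c_def)
  have [measurable]: "f \<in> borel_measurable borel" by (rule schwartz_measurable[OF f])
  have [measurable]: "h \<in> borel_measurable borel" using H unfolding hH by measurable
  let ?K = "Beta ((real DIM('a) + \<beta>) / 4) c * Beta ((real DIM('a) - \<alpha>) / 4) c *
     (riesz_coeff DIM('a) ((real DIM('a) + \<beta>) / 4 + c) / riesz_coeff DIM('a) ((real DIM('a) - \<alpha>) / 4)) *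
     (riesz_coeff DIM('a) ((real DIM('a) - \<alpha>) / 4 + c) / riesz_coeff DIM('a) ((real DIM('a) + \<beta>) / 4))"
  have SW: "(\<integral>\<^sup>+x. ennreal (norm x powr (- \<alpha>) * (cmod (A *\<^sub>R f x))\<^sup>2) \<partial>lborel)
    \<le> ennreal ?K * (\<integral>\<^sup>+x. ennreal (norm x powr (- \<beta>) * (cmod (h x))\<^sup>2) \<partial>lborel)"
  proof (rule stein_weiss[OF _ _ c(1) \<beta> c(2) \<alpha>(2)])
    fix x :: 'a
    show "ennreal (cmod (A *\<^sub>R f x)) \<le> (\<integral>\<^sup>+y. heat_potential c (x - y) * ennreal (cmod (h y)) \<partial>lborel)"
      using inv_fourier_le_heat_potential[OF integrable_fourier_schwartz[OF f] H c(1) H_def, of x] A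
      unfolding schwartz_fourier_inversion[OF f] hH A_def[symmetric] by simp
  qed measurable
  have "(\<integral>\<^sup>+x. ennreal (norm x powr (- \<alpha>) * (cmod (f x))\<^sup>2) \<partial>lborel)
    = (\<integral>\<^sup>+x. ennreal (A powr (- 2)) * ennreal (norm x powr (- \<alpha>) * (cmod (A *\<^sub>R f x))\<^sup>2) \<partial>lborel)"
    using A by (intro nn_integral_cong) (simp add: ennreal_mult[symmetric] power_mult_distrib powr_minus powr_numeral)
  also have "\<dots> = ennreal (A powr (- 2)) * (\<integral>\<^sup>+x. ennreal (norm x powr (- \<alpha>) * (cmod (A *\<^sub>R f x))\<^sup>2) \<partial>lborel)"
    by (rule nn_integral_cmult) measurable
  also have "\<dots> \<le> ennreal (A powr (- 2)) * (ennreal ?K * (\<integral>\<^sup>+x. ennreal (norm x powr (- \<beta>) * (cmod (h x))\<^sup>2) \<partial>lborel))"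
    by (rule mult_left_mono[OF SW]) simp
  also have "\<dots> = ennreal (A powr (- 2) * ?K) * (\<integral>\<^sup>+x. ennreal (norm x powr (- \<beta>) * (cmod (h x))\<^sup>2) \<partial>lborel)"
    by (simp only: ennreal_mult'[OF powr_ge_zero] mult.assoc)
  also have "A powr (- 2) * ?K = C_const DIM('a) \<alpha> / C_const DIM('a) \<beta>"
    unfolding A_def by (rule stein_weiss_constant[OF c(1) \<beta> c(2) \<alpha>(2)])
  finally show ?thesis .
qed

text \<open>
  The ground state representation of \<open>h\<close>, multiplied by \<open>C_const n \<alpha>\<close>, contains the weighted term with
  the factor \<open>C_const n \<alpha> / C_const n \<beta>\<close>, which is exactly the constant of the Stein-Weiss inequality.
\<close>

theorem fractional_hardy_remainder:
  fixes f g :: "'a::euclidean_space \<Rightarrow> complex"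
  defines "n \<equiv> DIM('a)"
  assumes f: "schwartz f" and \<beta>: "0 < \<beta>" "\<beta> < 2" and \<alpha>: "\<beta> \<le> \<alpha>" "\<alpha> < real n"
    and g: "g = (\<lambda>x. norm x powr ((real n - \<beta>) / 2) *\<^sub>R laplacian_power ((\<alpha> - \<beta>) / 4) f x)"
  shows "(\<integral>\<^sup>+ x. ennreal (norm x powr (- \<alpha>) * (cmod (f x))\<^sup>2) \<partial>lborel)
           + ennreal (C_const n \<alpha> / D_const n \<beta>) *
             (\<integral>\<^sup>+ (x, y). ennreal ((cmod (g x - g y))\<^sup>2 / norm (x - y) powr (real n + \<beta>)
                 * norm x powr (- ((real n - \<beta>) / 2)) * norm y powr (- ((real n - \<beta>) / 2)))
               \<partial>(lborel \<Otimes>\<^sub>M lborel))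
     \<le> ennreal (C_const n \<alpha>) * (\<integral>\<^sup>+ \<xi>. ennreal (norm \<xi> powr \<alpha> * (cmod (fourier f \<xi>))\<^sup>2) \<partial>lborel)"
proof -
  define \<gamma> where "\<gamma> = (\<alpha> - \<beta>) / 2"
  have \<gamma>: "0 \<le> \<gamma>" "\<gamma> \<le> real DIM('a)" using \<alpha> \<beta> by (auto simp: \<gamma>_def n_def)
  define H where "H = (\<lambda>\<xi>::'a. norm \<xi> powr \<gamma> *\<^sub>R fourier f \<xi>)"
  define h where "h = laplacian_power ((\<alpha> - \<beta>) / 4) f"
  have hH: "h = inv_fourier H"
  proof -
    have "2 * ((\<alpha> - \<beta>) / 4) = \<gamma>" by (simp add: \<gamma>_def field_simps)
    then show ?thesis unfolding h_def laplacian_power_def H_def by (simp only:)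
  qed
  have H: "integrable lborel H" unfolding H_def by (rule fourier_multiplier_integrable[OF f \<gamma>])
  obtain M where M: "\<And>\<xi>. cmod (H \<xi>) \<le> M"
    using fourier_multiplier_bounded[OF f \<gamma>] unfolding H_def by auto
  have cont: "AE \<xi> in lborel. isCont H \<xi>" unfolding H_def by (rule fourier_multiplier_isCont[OF f \<gamma>])
  have Hm[measurable]: "H \<in> borel_measurable borel" using H by simp
  have hm[measurable]: "h \<in> borel_measurable borel" unfolding hH by measurable
  have \<beta>n: "\<beta> < real DIM('a)" using \<alpha> by (simp add: n_def)
  have L2: "(\<integral>\<^sup>+x. ennreal ((cmod (h x))\<^sup>2) \<partial>lborel) < \<infinity>"
  proof -
    have "(\<integral>\<^sup>+x. ennreal ((cmod (h x))\<^sup>2) \<partial>lborel) = (\<integral>\<^sup>+\<xi>. ennreal ((cmod (H \<xi>))\<^sup>2) \<partial>lborel)"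
      unfolding hH by (rule plancherel_inv_fourier[OF H M cont])
    also have "\<dots> \<le> (\<integral>\<^sup>+\<xi>. ennreal M * ennreal (cmod (H \<xi>)) \<partial>lborel)"
      using M order_trans[OF norm_ge_zero M]
      by (intro nn_integral_mono) (auto simp: ennreal_mult[symmetric] power2_eq_square intro!: ennreal_leI mult_right_mono)
    also have "\<dots> = ennreal M * (\<integral>\<^sup>+\<xi>. ennreal (cmod (H \<xi>)) \<partial>lborel)"
      by (rule nn_integral_cmult) measurable
    also have "\<dots> < \<infinity>" using H by (simp add: integrable_iff_bounded ennreal_mult_less_top)
    finally show ?thesis .
  qed
  have X: "(\<integral>\<^sup>+x. ennreal (norm x powr (- \<beta>) * (cmod (h x))\<^sup>2) \<partial>lborel) < \<infinity>"
    by (rule nn_integral_weighted_finite[OF hm _ L2 \<beta>(1) \<beta>n]) (unfold hH, rule norm_inv_fourier_le)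
  define XX where "XX = (\<integral>\<^sup>+x. ennreal (norm x powr (- \<beta>) * (cmod (h x))\<^sup>2) \<partial>lborel)"
  define T where "T = (\<integral>\<^sup>+ \<xi>. ennreal (norm \<xi> powr \<alpha> * (cmod (fourier f \<xi>))\<^sup>2) \<partial>lborel)"
  have T: "(\<integral>\<^sup>+\<xi>. ennreal (norm \<xi> powr \<beta> * (cmod (H \<xi>))\<^sup>2) \<partial>lborel) = T"
    unfolding T_def
  proof (rule nn_integral_cong)
    fix \<xi> :: 'a
    have "norm \<xi> powr \<beta> * (norm \<xi> powr \<gamma> * norm \<xi> powr \<gamma>) = norm \<xi> powr \<alpha>"
      unfolding powr_add[symmetric] by (simp add: \<gamma>_def)
    then have "norm \<xi> powr \<beta> * (norm \<xi> powr \<gamma>)\<^sup>2 * (cmod (fourier f \<xi>))\<^sup>2 = norm \<xi> powr \<alpha> * (cmod (fourier f \<xi>))\<^sup>2"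
      by (simp only: power2_eq_square[of "norm \<xi> powr \<gamma>"])
    then show "ennreal (norm \<xi> powr \<beta> * (cmod (H \<xi>))\<^sup>2) = ennreal (norm \<xi> powr \<alpha> * (cmod (fourier f \<xi>))\<^sup>2)"
      by (simp add: H_def power_mult_distrib mult.assoc)
  qed
  define w where "w = (\<lambda>x::'a. norm x powr (- ((real n - \<beta>) / 2)))"
  define RR where "RR = (\<integral>\<^sup>+x. (\<integral>\<^sup>+y. ennreal ((cmod (g x - g y))\<^sup>2 / norm (x - y) powr (real n + \<beta>) * w x * w y) \<partial>lborel) \<partial>lborel)"
  have gm[measurable]: "g \<in> borel_measurable borel"
    unfolding g h_def[symmetric] by measurable
  have [measurable]: "w \<in> borel_measurable borel" unfolding w_def by measurable
  have RR: "(\<integral>\<^sup>+ (x, y). ennreal ((cmod (g x - g y))\<^sup>2 / norm (x - y) powr (real n + \<beta>)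
                 * norm x powr (- ((real n - \<beta>) / 2)) * norm y powr (- ((real n - \<beta>) / 2)))
               \<partial>(lborel \<Otimes>\<^sub>M lborel)) = RR"
    unfolding RR_def w_def[symmetric] w_def[THEN fun_cong, symmetric]
    by (subst lborel.nn_integral_fst[symmetric]) simp_all
  define K where "K = 2 * pi powr (\<beta> / 2) * Gamma (1 - \<beta> / 2) / (\<beta> / 2)"
  have K: "0 < K" unfolding K_def using \<beta> by (intro divide_pos_pos mult_pos_pos Gamma_real_pos) auto
  define C where "C = C_const n \<alpha>"
  have C: "0 < C" "0 < C_const n \<beta>" unfolding C_def using \<alpha> \<beta> by (auto intro!: C_const_pos)
  have D: "0 < D_const n \<beta>"
    unfolding D_const_def using \<beta> by (intro mult_pos_pos divide_pos_pos Gamma_real_pos) (auto simp: add_nonneg_pos)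
  have "ennreal K * T = ennreal (K / D_const n \<beta>) * RR + ennreal (K / C_const n \<beta>) * XX"
    using ground_state_representation[OF H M cont \<beta> \<beta>n, of g, folded hH]
    unfolding T ground_state_constants[OF \<beta> \<beta>n] K_def[symmetric] XX_def[symmetric]
    using g L2 X unfolding RR_def w_def n_def h_def[symmetric] XX_def by simp
  then have "ennreal (C / K) * (ennreal K * T) = ennreal (C / K) * (ennreal (K / D_const n \<beta>) * RR + ennreal (K / C_const n \<beta>) * XX)"
    by simp
  also have "ennreal (C / K) * (ennreal K * T) = ennreal C * T"
    using C K by (simp add: mult.assoc[symmetric] ennreal_mult[symmetric])
  also have "ennreal (C / K) * (ennreal (K / D_const n \<beta>) * RR + ennreal (K / C_const n \<beta>) * XX)
    = ennreal (C / D_const n \<beta>) * RR + ennreal (C / C_const n \<beta>) * XX"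
    using C K D by (simp add: distrib_left mult.assoc[symmetric] ennreal_mult[symmetric])
  finally have "ennreal C * T = ennreal (C / D_const n \<beta>) * RR + ennreal (C / C_const n \<beta>) * XX" .
  moreover have "(\<integral>\<^sup>+ x. ennreal (norm x powr (- \<alpha>) * (cmod (f x))\<^sup>2) \<partial>lborel) \<le> ennreal (C / C_const n \<beta>) * XX"
    unfolding C_def XX_def h_def n_def by (rule weighted_hardy_reduction[OF f \<beta>(1) \<alpha>[unfolded n_def]])
  ultimately show ?thesis
    unfolding RR T_def[symmetric] C_def[symmetric] by (simp add: add.commute add_left_mono)
qed

theorem theorem1:
  fixes f g :: "real ^ 'n \<Rightarrow> complex" and n :: nat and \<alpha> \<beta> :: real
  assumes n: "n = CARD('n)"
    and f: "schwartz f"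
    and \<beta>: "0 < \<beta>" "\<beta> < 2"
    and \<alpha>: "\<beta> \<le> \<alpha>" "\<alpha> < real n"
    and g: "g = (\<lambda>x. norm x powr ((real n - \<beta>) / 2) *\<^sub>R laplacian_power ((\<alpha> - \<beta>) / 4) f x)"
  shows "ennreal (C_const n \<alpha>) *
           (\<integral>\<^sup>+ \<xi>. ennreal (norm \<xi> powr \<alpha> * (cmod (fourier f \<xi>))\<^sup>2) \<partial>lborel)
         \<ge> (\<integral>\<^sup>+ x. ennreal (norm x powr (- \<alpha>) * (cmod (f x))\<^sup>2) \<partial>lborel)
           + ennreal (C_const n \<alpha> / D_const n \<beta>) *
             (\<integral>\<^sup>+ (x, y). ennreal ((cmod (g x - g y))\<^sup>2 / norm (x - y) powr (real n + \<beta>)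
                 * norm x powr (- ((real n - \<beta>) / 2)) * norm y powr (- ((real n - \<beta>) / 2)))
               \<partial>(lborel \<Otimes>\<^sub>M lborel))"
proof -
  have d: "DIM(real ^ 'n) = n" by (simp add: n)
  show ?thesis
    using fractional_hardy_remainder[OF f \<beta>, of \<alpha> g, unfolded d] \<alpha> g by blast
qed

end
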